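(* Let $\nu(dy)=p_1(y)\,dy$ be a probability measure on $\mathbb{R}^d$ with $D:=(1/\sqrt2)\,\mathrm{diam}(\mathrm{supp}(\nu))$, and let $v$ be the velocity field associated with $\nu$. (a) For any $t\in(0,1)$, $$\frac{\dot a_t}{a_t}\mathbf{I}_d\preceq\nabla_xv(t,x)\preceq\left\{\frac{b_t(a_t\dot b_t-\dot a_tb_t)}{a_t^3}D^2+\frac{\dot a_t}{a_t}\right\}\mathbf{I}_d.$$ (b) Suppose that $p_1$ is $\beta$-semi-log-convex with $\beta>0$ and $\mathrm{supp}(p_1)=\mathbb{R}^d$. Then for any $t\in(0,1]$, $$\nabla_xv(t,x)\succeq\frac{\beta a_t\dot a_t+b_t\dot b_t}{\beta a_t^2+b_t^2}\mathbf{I}_d.$$ (c) Suppose that $p_1$ is $\kappa$-semi-log-concave with $\kappa\in\mathbb{R}$. Then for any $t\in(t_0,1]$, $$\nabla_xv(t,x)\preceq\frac{\kappa a_t\dot a_t+b_t\dot b_t}{\kappa a_t^2+b_t^2}\mathbf{I}_d,$$ where $t_0$ is the root of the equation $\kappa+\frac{b_t^2}{a_t^2}=0$ over $t\in(0,1)$ if $\kappa<0$, and $t_0=0$ if $\kappa\ge0$. (d) Fix a probability measure $\rho$ on $\mathbb{R}^d$ supported on a Euclidean ball of radius $R$, and let $\nu:=N(0,\sigma^2\mathbf{I}_d)*\rho$ with $\sigma>0$. Then for any $t\in(0,1)$, $$\frac{\dot a_ta_t+\sigma^2\dot b_tb_t}{a_t^2+\sigma^2b_t^2}\mathbf{I}_d\preceq\nabla_xv(t,x)\preceq\left\{\frac{a_tb_t(a_t\dot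 b_t-\dot a_tb_t)}{(a_t^2+\sigma^2b_t^2)^2}R^2+\frac{\dot a_ta_t+\sigma^2\dot b_tb_t}{a_t^2+\sigma^2b_t^2}\right\}\mathbf{I}_d.$$ (e) Suppose that $\frac{d\nu}{d\gamma_d}(x)$ is $L$-log-Lipschitz for some $L\ge0$. Then for any $t\in(0,1)$, $$\left\{\left(\tfrac{\dot b_t}{b_t}a_t^2-\dot a_ta_t\right)\left(-B_t-L^2\left(\tfrac{b_t}{a_t^2+b_t^2}\right)^2\right)+\tfrac{\dot a_ta_t+\dot b_tb_t}{a_t^2+b_t^2}\right\}\mathbf{I}_d\preceq\nabla_xv(t,x)\preceq\left\{\left(\tfrac{\dot b_t}{b_t}a_t^2-\dot a_ta_t\right)B_t+\tfrac{\dot a_ta_t+\dot b_tb_t}{a_t^2+b_t^2}\right\}\mathbf{I}_d,$$ where $B_t:=5Lb_t(a_t^2+b_t^2)^{-3/2}\left(L+\left(\log(\sqrt{a_t^2+b_t^2}/b_t)\right)^{-1/2}\right)$.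
   Context: Fix functions $a_t,b_t$ of $t\in[0,1]$ (a dot denotes the time derivative) satisfying: $\dot a_t\le 0$, $\dot b_t\ge 0$, $a_0>0$, $b_0\ge 0$, $a_1=0$, $b_1=1$; $a_t>0$ and $b_t>0$ for all $t\in(0,1)$; $a_t,b_t\in C^2([0,1))$, $a_t^2\in C^1([0,1])$, $b_t\in C^1([0,1])$. At $t=1$ the product $a_t\dot a_t$ means $\frac12\frac{d}{dt}a_t^2$. Let $\gamma_d:=N(0,\mathbf{I}_d)$. Given $\nu$, let $\mathsf{Z}\sim\gamma_d$ and $\mathsf{X}_1\sim\nu$ be independent and $\mathsf{X}_t=a_t\mathsf{Z}+b_t\mathsf{X}_1$. The velocity field associated with $\nu$ is $v(t,x)=\mathbb{E}[\dot a_t\mathsf{Z}+\dot b_t\mathsf{X}_1\mid\mathsf{X}_t=x]$ for $t\in(0,1)$, $v(0,x)=\lim_{t\downarrow0}v(t,x)$, $v(1,x)=\lim_{t\uparrow1}v(t,x)$. A probability measure $\exp(-U)\,dx$ (or its density) is $\kappa$-semi-log-concave ($\kappa\in\mathbb{R}$) if its support $\Omega\subseteq\mathbb{R}^d$ is convex and $U\in C^2(\Omega)$ satisfies $\nabla^2U(x)\succeq\kappa\mathbf{I}_d$ for all $x\in\Omega$; it is $\beta$-semi-log-convex ($\beta>0$) if its support $\Omega$ is convex and $U\in C^2(\Omega)$ satisfies $\nabla^2U(x)\preceq\beta\mathbf{I}_d$ for all $x\in\Omega$. A function $f:\mathbb{R}^d\to\mathbb{R}_+$ is $L$-log-Lipschitz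 if $\log f$ is $L$-Lipschitz. $A\preceq B$ means $B-A$ is positive semi-definite.
   Formalization: In (c) at t=1, v(1,x) need not exist for x outside supp(ν) (e.g. ν uniform on a ball, a_t=√(1−t²)); the gradient is shown to exist for x in the interior of supp(ν), and the bound is claimed at every x where the gradient exists. *)

theory Defs
  imports "HOL-Probability.Probability"
begin

section \<open>Positive semi-definite order\<close>

definition pos_semidef :: "real^'n^'n \<Rightarrow> bool" where
  "pos_semidef A \<longleftrightarrow> transpose A = A \<and> (\<forall>u. 0 \<le> u \<bullet> (A *v u))"

definition loewner_le :: "real^'n^'n \<Rightarrow> real^'n^'n \<Rightarrow> bool"  (infix \<open>\<preceq>\<close> 50) where
  "A \<preceq> B \<longleftrightarrow> pos_semidef (B - A)"


section \<open>Measures and densities\<close>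

definition measure_supp :: "'a::topological_space measure \<Rightarrow> 'a set" where
  "measure_supp \<nu> = {x. \<forall>S. open S \<and> x \<in> S \<longrightarrow> emeasure \<nu> S > 0}"

text \<open>The centred Gaussian \<open>N(0, \<sigma>\<^sup>2 I)\<close>; the parameter is the standard deviation.\<close>

definition gaussian :: "real \<Rightarrow> (real^'n) measure" where
  "gaussian \<sigma> = density lborel (\<lambda>x. ennreal (\<Prod>i\<in>UNIV. normal_density 0 \<sigma> (x $ i)))"

text \<open>
  \<open>U \<in> C\<^sup>2(\<Omega>)\<close> with Hessian \<open>H\<close>. Derivatives are taken within \<open>\<Omega>\<close>. They are
  unique when \<open>\<Omega>\<close> is convex with non-empty interior, as is the case for the positivity
  set of a probability density whenever that set is convex.
\<close>

definition C2_with_hessian ::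
    "(real^'n) set \<Rightarrow> (real^'n \<Rightarrow> real) \<Rightarrow> (real^'n \<Rightarrow> real^'n^'n) \<Rightarrow> bool" where
  "C2_with_hessian \<Omega> U H \<longleftrightarrow>
     (\<exists>G. \<forall>x\<in>\<Omega>. (U has_derivative (\<lambda>h. G x \<bullet> h)) (at x within \<Omega>) \<and>
                 (G has_derivative (\<lambda>h. H x *v h)) (at x within \<Omega>)) \<and>
     continuous_on \<Omega> H"

text \<open>
  In the next two definitions \<open>\<Omega>\<close> is forced to be \<open>{x. p x \<noteq> 0}\<close>, which need not be closed.
  So a density such as \<open>x exp(-x)\<close> on the half-line, with \<open>U\<close> unbounded at the boundary of
  the support, is admitted; a \<open>U\<close> that is \<open>C\<^sup>2\<close> up to the boundary of a closed \<open>\<Omega>\<close> is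
  covered as well.
\<close>

definition semi_log_concave :: "real \<Rightarrow> (real^'n \<Rightarrow> real) \<Rightarrow> bool" where
  "semi_log_concave \<kappa> p \<longleftrightarrow>
     (\<exists>\<Omega> U H. convex \<Omega> \<and> (\<forall>x. p x = (if x \<in> \<Omega> then exp (- U x) else 0)) \<and>
        C2_with_hessian \<Omega> U H \<and> (\<forall>x\<in>\<Omega>. mat \<kappa> \<preceq> H x))"

definition semi_log_convex :: "real \<Rightarrow> (real^'n \<Rightarrow> real) \<Rightarrow> bool" where
  "semi_log_convex \<beta> p \<longleftrightarrow>
     (\<exists>\<Omega> U H. convex \<Omega> \<and> (\<forall>x. p x = (if x \<in> \<Omega> then exp (- U x) else 0)) \<and>
        C2_with_hessian \<Omega> U H \<and> (\<forall>x\<in>\<Omega>. H x \<preceq> mat \<beta>))"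

definition log_lipschitz :: "real \<Rightarrow> (real^'n \<Rightarrow> real) \<Rightarrow> bool" where
  "log_lipschitz L f \<longleftrightarrow> (\<forall>x. 0 < f x) \<and> L-lipschitz_on UNIV (\<lambda>x. ln (f x))"


section \<open>Interpolation coefficients\<close>

text \<open>The derivative on \<open>[0,1]\<close>, one-sided at the end points.\<close>

definition time_deriv :: "(real \<Rightarrow> real) \<Rightarrow> real \<Rightarrow> real" where
  "time_deriv f t = vector_derivative f (at t within {0..1})"

fun Ck_on :: "nat \<Rightarrow> real set \<Rightarrow> (real \<Rightarrow> real) \<Rightarrow> bool" where
  "Ck_on 0 S f \<longleftrightarrow> continuous_on S f"
| "Ck_on (Suc k) S f \<longleftrightarrow>
     (\<exists>f'. (\<forall>t\<in>S. (f has_real_derivative f' t) (at t within S)) \<and> Ck_on k S f')"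

definition interpolation_coeffs :: "(real \<Rightarrow> real) \<Rightarrow> (real \<Rightarrow> real) \<Rightarrow> bool" where
  "interpolation_coeffs a b \<longleftrightarrow>
     Ck_on 2 {0..<1} a \<and> Ck_on 2 {0..<1} b \<and>
     Ck_on 1 {0..1} (\<lambda>t. (a t)\<^sup>2) \<and> Ck_on 1 {0..1} b \<and>
     (\<forall>t\<in>{0..<1}. time_deriv a t \<le> 0) \<and> (\<forall>t\<in>{0..1}. time_deriv b t \<ge> 0) \<and>
     a 0 > 0 \<and> b 0 \<ge> 0 \<and> a 1 = 0 \<and> b 1 = 1 \<and>
     (\<forall>t\<in>{0<..<1}. a t > 0 \<and> b t > 0)"

text \<open>The product of \<open>a\<close> and its derivative; \<open>a\<close> itself need not be differentiable at \<open>1\<close>.\<close>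

definition a_adot :: "(real \<Rightarrow> real) \<Rightarrow> real \<Rightarrow> real" where
  "a_adot a t = (if t = 1 then time_deriv (\<lambda>s. (a s)\<^sup>2) 1 / 2 else a t * time_deriv a t)"


section \<open>Velocity field\<close>

text \<open>
  \<open>x \<mapsto> E[Y | X = x]\<close> is determined only up to null sets of the law of \<open>X\<close>; pointwise values
  are those of the continuous version, unique when that law has full support. As
  \<^const>\<open>real_cond_exp\<close> conditions the positive and the negative part separately, it
  makes sense for non-integrable \<open>Y\<close> if both conditional expectations are finite almost
  surely. This holds for the velocity field below, so no moments of \<open>\<nu>\<close> are needed.
\<close>

definition continuous_cond_exp ::
    "'w measure \<Rightarrow> ('w \<Rightarrow> real^'n) \<Rightarrow> ('w \<Rightarrow> real^'n) \<Rightarrow> (real^'n \<Rightarrow> real^'n) \<Rightarrow> bool" where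
  "continuous_cond_exp M Y X g \<longleftrightarrow> continuous_on UNIV g \<and>
     (\<forall>i. AE \<omega> in M. g (X \<omega>) $ i =
        real_cond_exp M (vimage_algebra (space M) X borel) (\<lambda>\<omega>. Y \<omega> $ i) \<omega>)"

text \<open>
  \<open>(Z, X\<^sub>1)\<close> is realised as the pair of coordinates on the product of the standard Gaussian
  and \<open>\<nu>\<close>.
\<close>

definition interior_velocity_version ::
    "(real \<Rightarrow> real) \<Rightarrow> (real \<Rightarrow> real) \<Rightarrow> (real^'n) measure \<Rightarrow> real \<Rightarrow> (real^'n \<Rightarrow> real^'n) \<Rightarrow> bool"
  where
  "interior_velocity_version a b \<nu> t g \<longleftrightarrow>
     continuous_cond_exp (gaussian 1 \<Otimes>\<^sub>M \<nu>)
       (\<lambda>(z, y). time_deriv a t *\<^sub>R z + time_deriv b t *\<^sub>R y)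
       (\<lambda>(z, y). a t *\<^sub>R z + b t *\<^sub>R y) g"

definition interior_velocity ::
    "(real \<Rightarrow> real) \<Rightarrow> (real \<Rightarrow> real) \<Rightarrow> (real^'n) measure \<Rightarrow> real \<Rightarrow> real^'n \<Rightarrow> real^'n" where
  "interior_velocity a b \<nu> t = (THE g. interior_velocity_version a b \<nu> t g)"

definition velocity ::
    "(real \<Rightarrow> real) \<Rightarrow> (real \<Rightarrow> real) \<Rightarrow> (real^'n) measure \<Rightarrow> real \<Rightarrow> real^'n \<Rightarrow> real^'n" where
  "velocity a b \<nu> t x =
     (if t = 0 then Lim (at_right 0) (\<lambda>s. interior_velocity a b \<nu> s x)
      else if t = 1 then Lim (at_left 1) (\<lambda>s. interior_velocity a b \<nu> s x)
      else interior_velocity a b \<nu> t x)"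

text \<open>
  \<^const>\<open>The\<close> and \<^const>\<open>Lim\<close> return an arbitrary value where nothing qualifies; the
  next two definitions keep such values out of statements about the gradient. They matter at
  \<open>t = 1\<close>, where the limit does not exist outside the support of \<open>\<nu>\<close>.
\<close>

definition velocity_exists ::
    "(real \<Rightarrow> real) \<Rightarrow> (real \<Rightarrow> real) \<Rightarrow> (real^'n) measure \<Rightarrow> real \<Rightarrow> real^'n \<Rightarrow> bool" where
  "velocity_exists a b \<nu> t x \<longleftrightarrow>
     (if t = 0 then \<exists>l. ((\<lambda>s. interior_velocity a b \<nu> s x) \<longlongrightarrow> l) (at_right 0)
      else if t = 1 then \<exists>l. ((\<lambda>s. interior_velocity a b \<nu> s x) \<longlongrightarrow> l) (at_left 1)
      else \<exists>!g. interior_velocity_version a b \<nu> t g)"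

definition velocity_differentiable ::
    "(real \<Rightarrow> real) \<Rightarrow> (real \<Rightarrow> real) \<Rightarrow> (real^'n) measure \<Rightarrow> real \<Rightarrow> real^'n \<Rightarrow> bool" where
  "velocity_differentiable a b \<nu> t x \<longleftrightarrow>
     (\<forall>\<^sub>F y in nhds x. velocity_exists a b \<nu> t y) \<and> velocity a b \<nu> t differentiable (at x)"

definition velocity_grad ::
    "(real \<Rightarrow> real) \<Rightarrow> (real \<Rightarrow> real) \<Rightarrow> (real^'n) measure \<Rightarrow> real \<Rightarrow> real^'n \<Rightarrow> real^'n^'n" where
  "velocity_grad a b \<nu> t x = jacobian (velocity a b \<nu> t) (at x)"

end

(*
  Write P(t,x) for the integral of exp(-|x - b y|^2 / (2 a^2)) against nu, at time t. Up to a
  constant it is the density of X_t, and the velocity is v = (b'/b) x + k grad log P with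
  k = (b'/b) a^2 - a a' >= 0, so every bound on the gradient of v is a bound on the Hessian of
  log P, which equals -1/a^2 + (b/a^2)^2 Cov(X_1 | X_t = x).

  (a) and (d) bound this covariance by the size of the support; in (d) completing the square
  turns P for the convolution into P for rho with a^2 replaced by a^2 + sigma^2 b^2.
  In (b) and (c), log P plus a quadratic is midpoint convex by Cauchy-Schwarz, respectively
  midpoint concave by the Prekopa-Leindler inequality. In (e) the Lipschitz bound is used only
  through translations of a Gaussian, which avoids differentiating the density.

  At t = 1, suitably normalised P(t,.) converges pointwise to the density where it is continuous,
  and semiconvexity (or semiconcavity) upgrades this to convergence of the scores. Outside the
  support the velocity blows up along a subsequence because log a is unbounded near t = 1.
*)
theory Submission
  imports Defs
begin

section \<open>The Prekopa-Leindler inequality\<close>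

text \<open>Expanding the square in exp(-|x - b y|^2 / (2 a^2)) leaves a Gaussian factor in x times
  a Laplace transform with a quadratic weight in y. The weight beats every exponential, so P is
  smooth for any \<open>\<nu>\<close>, with or without moments, and P > 0 makes the continuous
  version of the conditional expectation unique. The constants in (b) and (c) come from one
  minimisation: over w, the minimum of |v - b w|^2 / a^2 + c |w|^2 is c / (c a^2 + b^2) |v|^2. Thus
  a midpoint inequality for the density with quadratic term c |w|^2 becomes one for P with this
  coefficient, and b'/b - k c / (c a^2 + b^2) simplifies to the quotient in the statement. In (e)
  the same completion of the square centres the posterior at b x / (a^2 + b^2), so that x survives
  only as a shift in the argument of the density. The Hessian is then bounded by a first absolute
  moment and that moment by the Hessian; solving the resulting quadratic inequality closes the
  loop.\<close>

lemma brunn_minkowski_midpoint_real: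
  fixes A B C :: "real set"
  assumes [measurable]: "A \<in> sets borel" "B \<in> sets borel" "C \<in> sets borel"
    and ne: "A \<noteq> {}" "B \<noteq> {}" and bd: "bdd_above A" "bdd_below B"
    and mid: "\<And>x y. x \<in> A \<Longrightarrow> y \<in> B \<Longrightarrow> (x + y) / 2 \<in> C"
  shows "emeasure lborel A + emeasure lborel B \<le> 2 * emeasure lborel C"
proof (rule ennreal_le_epsilon)
  fix e :: real assume "e > 0"
  then obtain x0 where x0: "x0 \<in> A" "x0 > Sup A - e / 2"
    using less_cSup_iff[OF ne(1) bd(1), of "Sup A - e/2"] by auto
  obtain y0 where y0: "y0 \<in> B" "y0 < Inf B + e / 2"
    using cInf_less_iff[OF ne(2) bd(2), of "Inf B + e/2"] \<open>e > 0\<close> by auto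
  \<comment> \<open>The set (A + y0) / 2, cut at \<open>x0\<close>, lies in \<open>C\<close> to the
    left of \<open>p\<close>, and (x0 + B) / 2, cut at \<open>y0\<close>, lies in \<open>C\<close>
    to its right, so the two do not overlap. What is cut off from \<open>A\<close> and from
    \<open>B\<close> has length at most \<open>e/2\<close> each; this replaces extrema that need not
    be attained.\<close>
  define p where "p = (x0 + y0) / 2"
  have half: "2 * emeasure lborel S = (\<integral>\<^sup>+x. indicator S (c / 2 + (1/2) * x) \<partial>lborel)"
    if [measurable]: "S \<in> sets borel" for S :: "real set" and c
  proof -
    have "emeasure lborel S = (\<integral>\<^sup>+x. indicator S x \<partial>lborel)" by simp
    also have "\<dots> = ennreal \<bar>1/2\<bar> * (\<integral>\<^sup>+x. indicator S (c / 2 + (1/2) * x) \<partial>lborel)"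
      by (rule nn_integral_real_affine) auto
    finally have "2 * emeasure lborel S
        = (2 * ennreal (1/2)) * (\<integral>\<^sup>+x. indicator S (c / 2 + (1/2) * x) \<partial>lborel)"
      by (simp add: mult.assoc)
    also have "2 * ennreal (1/2) = 1"
      by (metis ennreal_1 ennreal_mult' ennreal_numeral field_sum_of_halves mult_2 zero_le_numeral)
    finally show ?thesis by simp
  qed
  have A1: "emeasure lborel (A \<inter> {..x0}) \<le> 2 * emeasure lborel (C \<inter> {..p})"
    unfolding half[of "C \<inter> {..p}" y0, simplified]
    using mid[OF _ y0(1)]
    by (subst nn_integral_indicator[symmetric], simp, intro nn_integral_mono)
      (auto simp: indicator_def p_def field_simps)
  have B1: "emeasure lborel (B \<inter> {y0<..}) \<le> 2 * emeasure lborel (C \<inter> {p<..})"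
    unfolding half[of "C \<inter> {p<..}" x0, simplified]
    using mid[OF x0(1)]
    by (subst nn_integral_indicator[symmetric], simp, intro nn_integral_mono)
      (auto simp: indicator_def p_def field_simps)
  have C: "emeasure lborel (C \<inter> {..p}) + emeasure lborel (C \<inter> {p<..}) = emeasure lborel C"
    by (subst plus_emeasure) (auto intro!: arg_cong[where f="emeasure lborel"])
  have A2: "emeasure lborel A \<le> emeasure lborel (A \<inter> {..x0}) + ennreal (e/2)"
  proof -
    have "emeasure lborel A \<le> emeasure lborel ((A \<inter> {..x0}) \<union> {x0..Sup A})"
      using cSup_upper[OF _ bd(1)] by (intro emeasure_mono) auto
    also have "\<dots> \<le> emeasure lborel (A \<inter> {..x0}) + emeasure lborel {x0..Sup A}"
      by (intro emeasure_subadditive) auto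
    also have "emeasure lborel {x0..Sup A} \<le> ennreal (e/2)"
      using x0 cSup_upper[OF x0(1) bd(1)] by (auto intro!: ennreal_leI)
    finally show ?thesis by (simp add: add_left_mono)
  qed
  have B2: "emeasure lborel B \<le> emeasure lborel (B \<inter> {y0<..}) + ennreal (e/2)"
  proof -
    have "emeasure lborel B \<le> emeasure lborel ((B \<inter> {y0<..}) \<union> {Inf B..y0})"
      using cInf_lower[OF _ bd(2)] by (intro emeasure_mono) auto
    also have "\<dots> \<le> emeasure lborel (B \<inter> {y0<..}) + emeasure lborel {Inf B..y0}"
      by (intro emeasure_subadditive) auto
    also have "emeasure lborel {Inf B..y0} \<le> ennreal (e/2)"
      using y0 cInf_lower[OF y0(1) bd(2)] by (auto intro!: ennreal_leI)
    finally show ?thesis by (simp add: add_left_mono)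
  qed
  have e: "ennreal (e/2) + ennreal (e/2) = ennreal e"
    using \<open>e > 0\<close> by (subst ennreal_plus[symmetric]) auto
  have "emeasure lborel A + emeasure lborel B
      \<le> (2 * emeasure lborel (C \<inter> {..p}) + ennreal (e/2)) + (2 * emeasure lborel (C \<inter> {p<..}) + ennreal (e/2))"
    by (intro add_mono order_trans[OF A2] order_trans[OF B2] A1 B1 order_refl)
  also have "\<dots> = 2 * (emeasure lborel (C \<inter> {..p}) + emeasure lborel (C \<inter> {p<..})) + (ennreal (e/2) + ennreal (e/2))"
    by (simp only: distrib_left ac_simps)
  also have "\<dots> = 2 * emeasure lborel C + ennreal e"
    by (simp only: C e)
  finally show "emeasure lborel A + emeasure lborel B \<le> 2 * emeasure lborel C + ennreal e" .
qed

lemma nn_integral_below_unit: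
  assumes "0 \<le> c" "c \<le> (1::real)"
  shows "(\<integral>\<^sup>+s. indicator ({0<..<1} \<inter> {s. s < c}) s \<partial>lborel) = ennreal c"
proof -
  have "{0<..<1} \<inter> {s. s < c} = {0<..<c}" using assms by auto
  then show ?thesis using assms by simp
qed

text \<open>Counterpart for \<open>h\<close>, whose normalised values may exceed 1: heights above 1
  are cut off, which can only lower the integral.\<close>

lemma nn_integral_below_unit_le:
  "(\<integral>\<^sup>+s. indicator ({0<..<1} \<inter> {s. s < c}) s \<partial>lborel) \<le> ennreal c"
proof -
  have "{0<..<1} \<inter> {s. s < c} \<subseteq> {0<..<max 0 c}" by auto
  then have "emeasure lborel ({0<..<1} \<inter> {s. s < c}) \<le> emeasure lborel {0<..<max 0 c}"
    by (intro emeasure_mono) auto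
  also have "\<dots> = ennreal c" by (simp add: max_def ennreal_neg)
  finally show ?thesis
    by (subst nn_integral_indicator) auto
qed

lemma measurable_emeasure_superlevel [measurable]:
  fixes f :: "real \<Rightarrow> real"
  assumes [measurable]: "f \<in> borel_measurable borel"
  shows "(\<lambda>s. emeasure lborel {x. s < f x / c}) \<in> borel_measurable borel"
proof -
  have "emeasure lborel {x. s < f x / c} = (\<integral>\<^sup>+x. (if s < f x / c then 1 else 0) \<partial>lborel)" for s
  proof -
    have "emeasure lborel {x. s < f x / c} = (\<integral>\<^sup>+x. indicator {x. s < f x / c} x \<partial>lborel)"
      by (subst nn_integral_indicator) auto
    then show ?thesis by (simp add: indicator_def of_bool_def)
  qed
  then show ?thesis by simp
qed

text \<open>Layer-cake formula by Tonelli, with heights restricted to (0,1), the range in which the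
  level sets of the normalised functions are nonempty.\<close>

lemma nn_integral_level_sets:
  fixes f :: "real \<Rightarrow> real"
  assumes [measurable]: "f \<in> borel_measurable borel"
  shows "(\<integral>\<^sup>+x. (\<integral>\<^sup>+s. indicator ({0<..<1} \<inter> {s. s < f x / c}) s \<partial>lborel) \<partial>lborel)
       = (\<integral>\<^sup>+s. indicator {0<..<1} s * emeasure lborel {x. s < f x / c} \<partial>lborel)"
proof -
  have "(\<integral>\<^sup>+x. (\<integral>\<^sup>+s. indicator ({0<..<1} \<inter> {s. s < f x / c}) s \<partial>lborel) \<partial>lborel)
      = (\<integral>\<^sup>+x. (\<integral>\<^sup>+s. (if 0 < s \<and> s < 1 \<and> s < f x / c then 1 else 0) \<partial>lborel) \<partial>lborel)"
    by (intro nn_integral_cong) (auto simp: indicator_def)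
  also have "\<dots> = (\<integral>\<^sup>+s. (\<integral>\<^sup>+x. (if 0 < s \<and> s < 1 \<and> s < f x / c then 1 else 0) \<partial>lborel) \<partial>lborel)"
    by (intro lborel_pair.Fubini') measurable
  also have "\<dots> = (\<integral>\<^sup>+s. indicator {0<..<1} s * emeasure lborel {x. s < f x / c} \<partial>lborel)"
  proof (intro nn_integral_cong)
    fix s
    have "emeasure lborel {x. s < f x / c} = (\<integral>\<^sup>+x. indicator {x. s < f x / c} x \<partial>lborel)"
      by (subst nn_integral_indicator) auto
    then show "(\<integral>\<^sup>+x. (if 0 < s \<and> s < 1 \<and> s < f x / c then 1 else 0) \<partial>lborel)
        = indicator {0<..<1} s * emeasure lborel {x. s < f x / c}"
      by (auto simp: indicator_def of_bool_def)
  qed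
  finally show ?thesis .
qed

lemma four_mult_le_square_sum: "4 * (p * q) \<le> (p + q)\<^sup>2" for p q :: real
  using zero_le_power2[of "p - q"] by (simp add: power2_eq_square algebra_simps)

text \<open>
  Normalising the suprema of f and g to 1 makes all superlevel sets at heights in (0,1)
  nonempty, so that the one-dimensional Brunn-Minkowski inequality applies at every height.
\<close>

lemma prekopa_leindler_real_bounded:
  fixes f g h :: "real \<Rightarrow> real"
  assumes [measurable]: "f \<in> borel_measurable borel" "g \<in> borel_measurable borel"
      "h \<in> borel_measurable borel"
    and f: "\<And>x. 0 \<le> f x" "\<And>x. f x \<le> n" "\<And>x. n < \<bar>x\<bar> \<Longrightarrow> f x = 0"
    and g: "\<And>x. 0 \<le> g x" "\<And>x. g x \<le> n" "\<And>x. n < \<bar>x\<bar> \<Longrightarrow> g x = 0"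
    and h: "\<And>x. 0 \<le> h x" and fgh: "\<And>x y. f x * g y \<le> (h ((x + y) / 2))\<^sup>2"
  shows "(\<integral>\<^sup>+x. f x \<partial>lborel) * (\<integral>\<^sup>+x. g x \<partial>lborel) \<le> (\<integral>\<^sup>+x. h x \<partial>lborel)\<^sup>2"
proof (cases "(\<forall>x. f x = 0) \<or> (\<forall>x. g x = 0) \<or> (\<integral>\<^sup>+x. h x \<partial>lborel) = \<infinity>")
  case True
  then show ?thesis by (auto simp: power2_eq_square ennreal_top_mult)
next
  case False
  then obtain xf xg where nz: "f xf > 0" "g xg > 0" and hfin: "(\<integral>\<^sup>+x. h x \<partial>lborel) \<noteq> \<infinity>"
    using f(1) g(1) by (metis order_le_less)
  define \<alpha> \<beta> where "\<alpha> = Sup (range f)" and "\<beta> = Sup (range g)"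
  have bdd: "bdd_above (range f)" "bdd_above (range g)"
    using f(2) g(2) by (auto intro!: bdd_aboveI)
  have f\<alpha>: "f x \<le> \<alpha>" and g\<beta>: "g x \<le> \<beta>" for x
    unfolding \<alpha>_def \<beta>_def using bdd by (auto intro!: cSup_upper)
  have pos: "\<alpha> > 0" "\<beta> > 0" using nz f\<alpha>[of xf] g\<beta>[of xg] by linarith+
  \<comment> \<open>The geometric mean of the two suprema: height s in \<open>f / \<alpha>\<close>
    and in \<open>g / \<beta>\<close> then forces height s in \<open>h / \<gamma>\<close> at the
    midpoint.\<close>
  define \<gamma> where "\<gamma> = sqrt (\<alpha> * \<beta>)"
  have \<gamma>: "\<gamma> > 0" "\<gamma>\<^sup>2 = \<alpha> * \<beta>" using pos by (auto simp: \<gamma>_def)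
  have level: "emeasure lborel {x. s < f x / \<alpha>} + emeasure lborel {x. s < g x / \<beta>}
      \<le> 2 * emeasure lborel {x. s < h x / \<gamma>}" if s: "s \<in> {0<..<1}" for s
  proof (rule brunn_minkowski_midpoint_real)
    have "\<alpha> * s < \<alpha>" "\<beta> * s < \<beta>" using s pos by auto
    then show "{x. s < f x / \<alpha>} \<noteq> {}" "{x. s < g x / \<beta>} \<noteq> {}"
      using less_cSup_iff[OF _ bdd(1), of "\<alpha> * s"] less_cSup_iff[OF _ bdd(2), of "\<beta> * s"] pos
      unfolding \<alpha>_def[symmetric] \<beta>_def[symmetric] by (auto simp: field_simps)
    have "x \<le> n" if "s < f x / \<alpha>" for x
      using that s f(3)[of x] by (cases "n < \<bar>x\<bar>") auto
    then show "bdd_above {x. s < f x / \<alpha>}" by (auto intro!: bdd_aboveI)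
    have "- n \<le> x" if "s < g x / \<beta>" for x
      using that s g(3)[of x] by (cases "n < \<bar>x\<bar>") auto
    then show "bdd_below {x. s < g x / \<beta>}" by (auto intro!: bdd_belowI)
    fix x y assume "x \<in> {x. s < f x / \<alpha>}" "y \<in> {x. s < g x / \<beta>}"
    then have "\<alpha> * s < f x" "\<beta> * s < g y" using pos by (auto simp: field_simps)
    moreover have "0 \<le> \<alpha> * s" "0 \<le> \<beta> * s" using pos s by auto
    ultimately have "(\<alpha> * s) * (\<beta> * s) < f x * g y" by (intro mult_strict_mono') auto
    also have "\<dots> \<le> (h ((x + y) / 2))\<^sup>2" by (rule fgh)
    also have "(\<alpha> * s) * (\<beta> * s) = (\<gamma> * s)\<^sup>2" by (simp add: power_mult_distrib \<gamma>(2)) (simp add: power2_eq_square)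
    finally have "\<gamma> * s < h ((x + y) / 2)" using h by (rule power_less_imp_less_base)
    then show "(x + y) / 2 \<in> {x. s < h x / \<gamma>}" using \<gamma> by (simp add: field_simps)
  qed auto
  have "(\<integral>\<^sup>+x. ennreal (f x / \<alpha>) \<partial>lborel) + (\<integral>\<^sup>+x. ennreal (g x / \<beta>) \<partial>lborel)
      = (\<integral>\<^sup>+s. indicator {0<..<1} s * emeasure lborel {x. s < f x / \<alpha>} \<partial>lborel)
        + (\<integral>\<^sup>+s. indicator {0<..<1} s * emeasure lborel {x. s < g x / \<beta>} \<partial>lborel)"
  proof -
    have "(\<integral>\<^sup>+x. ennreal (k x / c) \<partial>lborel)
        = (\<integral>\<^sup>+s. indicator {0<..<1} s * emeasure lborel {x. s < k x / c} \<partial>lborel)"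
      if "k \<in> borel_measurable borel" "\<And>x. 0 \<le> k x" "\<And>x. k x \<le> c" "c > 0"
      for k :: "real \<Rightarrow> real" and c
      unfolding nn_integral_level_sets[OF that(1), symmetric]
      using that by (intro nn_integral_cong nn_integral_below_unit[symmetric]) auto
    then show ?thesis using pos f(1) g(1) f\<alpha> g\<beta> assms(1,2) by simp
  qed
  also have "\<dots> = (\<integral>\<^sup>+s. indicator {0<..<1} s * emeasure lborel {x. s < f x / \<alpha>}
      + indicator {0<..<1} s * emeasure lborel {x. s < g x / \<beta>} \<partial>lborel)"
    by (rule nn_integral_add[symmetric]) simp_all
  also have "\<dots> \<le> (\<integral>\<^sup>+s. 2 * (indicator {0<..<1} s * emeasure lborel {x. s < h x / \<gamma>}) \<partial>lborel)"
    using level by (intro nn_integral_mono) (auto simp: indicator_def)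
  also have "\<dots> = 2 * (\<integral>\<^sup>+s. indicator {0<..<1} s * emeasure lborel {x. s < h x / \<gamma>} \<partial>lborel)"
    by (rule nn_integral_cmult) simp
  also have "\<dots> \<le> 2 * (\<integral>\<^sup>+x. ennreal (h x / \<gamma>) \<partial>lborel)"
    unfolding nn_integral_level_sets[OF assms(3), symmetric]
    by (intro mult_left_mono nn_integral_mono nn_integral_below_unit_le) simp
  finally have key: "(\<integral>\<^sup>+x. ennreal (f x / \<alpha>) \<partial>lborel) + (\<integral>\<^sup>+x. ennreal (g x / \<beta>) \<partial>lborel)
      \<le> 2 * (\<integral>\<^sup>+x. ennreal (h x / \<gamma>) \<partial>lborel)" .
  have int: "integrable lborel k"
    if [measurable]: "k \<in> borel_measurable borel" and k: "\<And>x. 0 \<le> k x" "\<And>x. k x \<le> n"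
      "\<And>x. n < \<bar>x\<bar> \<Longrightarrow> k x = 0" for k :: "real \<Rightarrow> real"
  proof (rule Bochner_Integration.integrable_bound)
    show "integrable lborel (\<lambda>x. n * indicator {-n..n} x)"
      by (intro integrable_mult_right integrable_real_indicator) (auto simp: emeasure_lborel_Icc_eq)
    have "norm (k x) \<le> norm (n * indicator {-n..n} x)" for x
      using k(1,2)[of x] k(3)[of x] by (cases "n < \<bar>x\<bar>") (auto simp: indicator_def abs_if split: if_splits)
    then show "AE x in lborel. norm (k x) \<le> norm (n * indicator {-n..n} x)" by simp
  qed simp
  have hint: "integrable lborel h"
    using hfin h by (intro integrableI_nonneg) (auto simp: top.not_eq_extremum)
  define F where "F k = integral\<^sup>L lborel k" for k :: "real \<Rightarrow> real"
  have F: "(\<integral>\<^sup>+x. ennreal (k x / c) \<partial>lborel) = ennreal (F k / c)" "F k \<ge> 0"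
    if "integrable lborel k" "\<And>x. 0 \<le> k x" "c > 0" for k c
  proof -
    have "(\<integral>\<^sup>+x. ennreal (k x / c) \<partial>lborel) = ennreal (\<integral>x. k x / c \<partial>lborel)"
      using that by (intro nn_integral_eq_integral) auto
    then show "(\<integral>\<^sup>+x. ennreal (k x / c) \<partial>lborel) = ennreal (F k / c)" by (simp add: F_def)
    show "F k \<ge> 0" using that by (simp add: F_def)
  qed
  have F1: "(\<integral>\<^sup>+x. k x \<partial>lborel) = ennreal (F k)"
    if "integrable lborel k" "\<And>x. 0 \<le> k x" for k
    using F(1)[OF that, of 1] by simp
  have fi: "integrable lborel f" and gi: "integrable lborel g"
    using int[OF assms(1) f] int[OF assms(2) g] by blast+
  have nn: "0 \<le> F f" "0 \<le> F g" "0 \<le> F h"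
    using F(2)[OF fi f(1)] F(2)[OF gi g(1)] F(2)[OF hint h] zero_less_one by blast+
  have "ennreal (F f / \<alpha>) + ennreal (F g / \<beta>) \<le> 2 * ennreal (F h / \<gamma>)"
    using key F(1)[OF fi f(1) pos(1)] F(1)[OF gi g(1) pos(2)] F(1)[OF hint h \<gamma>(1)] by simp
  also have "2 * ennreal (F h / \<gamma>) = ennreal (2 * (F h / \<gamma>))"
    by (subst ennreal_mult') auto
  finally have "ennreal (F f / \<alpha> + F g / \<beta>) \<le> ennreal (2 * (F h / \<gamma>))"
    using nn pos by simp
  then have "F f / \<alpha> + F g / \<beta> \<le> 2 * (F h / \<gamma>)"
    using nn pos \<gamma>(1) by (subst (asm) ennreal_le_iff) auto
  \<comment> \<open>The arithmetic-geometric mean inequality turns the additive estimate into a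
    multiplicative one; the normalisations cancel because \<alpha> \<beta> = \<gamma>^2.\<close>
  then have "(F f / \<alpha> + F g / \<beta>)\<^sup>2 \<le> (2 * (F h / \<gamma>))\<^sup>2"
    using nn pos by (intro power_mono) auto
  moreover have "4 * ((F f / \<alpha>) * (F g / \<beta>)) \<le> (F f / \<alpha> + F g / \<beta>)\<^sup>2"
    by (rule four_mult_le_square_sum)
  ultimately have "4 * ((F f / \<alpha>) * (F g / \<beta>)) \<le> 4 * ((F h)\<^sup>2 / \<gamma>\<^sup>2)"
    by (simp add: power_mult_distrib power_divide)
  then have "F f * F g / (\<alpha> * \<beta>) \<le> (F h)\<^sup>2 / (\<alpha> * \<beta>)"
    by (simp add: \<gamma>(2))
  then have "F f * F g \<le> (F h)\<^sup>2" using pos by (simp add: divide_le_cancel)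
  then have "ennreal (F f * F g) \<le> ennreal ((F h)\<^sup>2)" by (rule ennreal_leI)
  then show ?thesis
    using nn by (simp add: F1[OF fi f(1)] F1[OF gi g(1)] F1[OF hint h] ennreal_mult ennreal_power)
qed

lemma SUP_mult_SUP_le_ennreal:
  fixes u v :: "nat \<Rightarrow> ennreal"
  assumes "incseq u" "incseq v" "\<And>n. u n * v n \<le> c"
  shows "(SUP n. u n) * (SUP n. v n) \<le> c"
proof -
  have "u m * v n \<le> c" for m n
    using assms(1)[THEN incseqD, of m "max m n"] assms(2)[THEN incseqD, of n "max m n"]
      assms(3)[of "max m n"] by (meson max.cobounded1 max.cobounded2 mult_mono order_trans zero_le)
  then show ?thesis
    by (auto simp: SUP_mult_left_ennreal SUP_mult_right_ennreal intro!: SUP_least)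
qed

text \<open>Cutting \<open>f\<close> and \<open>g\<close> off in height and in space reduces to the
  bounded case, and monotone convergence removes the cut-off.\<close>

lemma prekopa_leindler_real:
  fixes f g h :: "real \<Rightarrow> ennreal"
  assumes [measurable]: "f \<in> borel_measurable borel" "g \<in> borel_measurable borel"
      "h \<in> borel_measurable borel"
    and fgh: "\<And>x y. f x * g y \<le> (h ((x + y) / 2))\<^sup>2"
  shows "(\<integral>\<^sup>+x. f x \<partial>lborel) * (\<integral>\<^sup>+x. g x \<partial>lborel) \<le> (\<integral>\<^sup>+x. h x \<partial>lborel)\<^sup>2"
proof -
  define T where "T k n x = min (k x) (of_nat n) * indicator {- real n..real n} x"
    for k :: "real \<Rightarrow> ennreal" and n x
  have T_mono: "incseq (\<lambda>n. T k n x)" for k x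
    unfolding T_def by (intro incseq_SucI mult_mono) (auto simp: min_def indicator_def intro: order_trans)
  have T_sup: "(SUP n. T k n x) = k x" for k x
  proof (rule antisym)
    show "(SUP n. T k n x) \<le> k x"
      by (auto intro!: SUP_least simp: T_def indicator_def)
    show "k x \<le> (SUP n. T k n x)"
    proof (rule dense_le)
      fix y assume "y < k x"
      then obtain m where m: "y < of_nat m"
        using ennreal_Ex_less_of_nat[of y] top.not_eq_extremum by fastforce
      obtain N where N: "\<bar>x\<bar> \<le> real N" using real_arch_simple by blast
      have "y \<le> T k (max m N) x"
        using m N \<open>y < k x\<close> by (auto simp: T_def indicator_def min_def max_def
            intro: less_imp_le order.strict_implies_order order_trans)
      then show "y \<le> (SUP n. T k n x)" by (rule SUP_upper2[rotated]) simp
    qed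
  qed
  have T_int: "(SUP n. \<integral>\<^sup>+x. T k n x \<partial>lborel) = (\<integral>\<^sup>+x. k x \<partial>lborel)"
    if [measurable]: "k \<in> borel_measurable borel" for k
  proof -
    have "T k n \<in> borel_measurable borel" for n unfolding T_def by measurable
    then show ?thesis
      by (subst nn_integral_monotone_convergence_SUP[symmetric])
        (use T_mono in \<open>auto simp: incseq_def le_fun_def T_sup\<close>)
  qed
  have T_int_mono: "incseq (\<lambda>n. \<integral>\<^sup>+x. T k n x \<partial>lborel)" for k
    using T_mono by (auto intro!: nn_integral_mono simp: incseq_def)
  have "(\<integral>\<^sup>+x. T f n x \<partial>lborel) * (\<integral>\<^sup>+x. T g n x \<partial>lborel) \<le> (\<integral>\<^sup>+x. h x \<partial>lborel)\<^sup>2" for n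
  proof -
    \<comment> \<open>\<open>h\<close> is capped in height only, to be real-valued. Where the cap is
      active it equals n, and the product of the two truncations is at most n^2 anyway.\<close>
    define k where "k x = min (h x) (of_nat n)" for x
    have fin: "T f n x < \<infinity>" "k x < \<infinity>" "T g n x < \<infinity>" for x
      by (auto simp: T_def k_def min_less_iff_disj indicator_def of_nat_less_top)
    have T_zero: "T k n x = 0" if "real n < \<bar>x\<bar>" for k x
      using that by (auto simp: T_def indicator_def)
    have le: "T f n x \<le> of_nat n" "T g n x \<le> of_nat n" for x
      by (auto simp: T_def indicator_def)
    have "T f n x * T g n y \<le> (k ((x + y) / 2))\<^sup>2" for x y
    proof (cases "h ((x + y) / 2) \<le> of_nat n")
      case True
      have "T f n x * T g n y \<le> f x * g y"
        by (intro mult_mono) (auto simp: T_def indicator_def)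
      then show ?thesis using fgh[of x y] True by (simp add: k_def min_def)
    next
      case False
      then have "k ((x + y) / 2) = of_nat n" by (simp add: k_def min_def)
      then show ?thesis using le mult_mono[OF le(1)[of x] le(2)[of y]] by (simp add: power2_eq_square)
    qed
    then have ineq: "enn2real (T f n x) * enn2real (T g n y) \<le> (enn2real (k ((x + y) / 2)))\<^sup>2" for x y
      using fin[of x] fin[of y] fin[of "(x + y)/2"]
      by (metis enn2real_mono enn2real_mult ennreal_less_top power2_eq_square ennreal_mult_less_top infinity_ennreal_def)
    have le': "enn2real (T f n x) \<le> real n" "enn2real (T g n x) \<le> real n" for x
      using le[of x] by (metis enn2real_leI ennreal_of_nat_eq_real_of_nat of_nat_0_le_iff)+
    have [measurable]: "k \<in> borel_measurable borel" "T f n \<in> borel_measurable borel"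
       "T g n \<in> borel_measurable borel"
      unfolding k_def T_def by measurable
    have "(\<integral>\<^sup>+x. T f n x \<partial>lborel) * (\<integral>\<^sup>+x. T g n x \<partial>lborel) \<le> (\<integral>\<^sup>+x. k x \<partial>lborel)\<^sup>2"
      using prekopa_leindler_real_bounded[where f="\<lambda>x. enn2real (T f n x)"
          and g="\<lambda>x. enn2real (T g n x)" and h="\<lambda>x. enn2real (k x)" and n="real n"] ineq le' fin
      by (auto simp: T_zero)
    also have "\<dots> \<le> (\<integral>\<^sup>+x. h x \<partial>lborel)\<^sup>2"
      by (intro power_mono nn_integral_mono) (auto simp: k_def)
    finally show ?thesis .
  qed
  then show ?thesis
    using SUP_mult_SUP_le_ennreal[OF T_int_mono T_int_mono, of f g] by (simp add: T_int)
qed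

text \<open>Induction on the coordinates: the one-dimensional inequality on each fibre says that the
  functions obtained by integrating out coordinate \<open>i\<close> satisfy the hypothesis again.
  The points are extensional because midpoints must be the canonical representatives in the product
  space.\<close>

lemma prekopa_leindler_PiM:
  fixes f g h :: "('i \<Rightarrow> real) \<Rightarrow> ennreal"
  assumes "finite I"
    and "f \<in> borel_measurable (Pi\<^sub>M I (\<lambda>_. lborel))" "g \<in> borel_measurable (Pi\<^sub>M I (\<lambda>_. lborel))"
      "h \<in> borel_measurable (Pi\<^sub>M I (\<lambda>_. lborel))"
    and "\<And>x y. x \<in> extensional I \<Longrightarrow> y \<in> extensional I \<Longrightarrow>
      f x * g y \<le> (h (\<lambda>i\<in>I. (x i + y i) / 2))\<^sup>2"
  shows "integral\<^sup>N (Pi\<^sub>M I (\<lambda>_. lborel)) f * integral\<^sup>N (Pi\<^sub>M I (\<lambda>_. lborel)) g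
    \<le> (integral\<^sup>N (Pi\<^sub>M I (\<lambda>_. lborel)) h)\<^sup>2"
  using assms
proof (induction I arbitrary: f g h rule: finite_induct)
  case empty
  interpret product_sigma_finite "\<lambda>_::'i. lborel :: real measure"
    by standard
  have "restrict (\<lambda>i. (undefined + undefined) / 2) {} = (\<lambda>_::'i. undefined::real)" by auto
  then show ?case
    using empty(4)[of "\<lambda>_. undefined" "\<lambda>_. undefined"] by (simp add: nn_integral_empty)
next
  case (insert i I)
  interpret product_sigma_finite "\<lambda>_::'i. lborel :: real measure"
    by standard
  note meas[measurable] = insert.prems(1,2,3)
  let ?P = "Pi\<^sub>M I (\<lambda>_::'i. lborel :: real measure)"
  define m where "m k x = (\<integral>\<^sup>+r. k (x(i := r)) \<partial>lborel)" for k :: "('i \<Rightarrow> real) \<Rightarrow> ennreal" and x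
  have ins: "integral\<^sup>N (Pi\<^sub>M (insert i I) (\<lambda>_. lborel)) k = integral\<^sup>N ?P (m k)"
    if "k \<in> borel_measurable (Pi\<^sub>M (insert i I) (\<lambda>_. lborel))" for k
    using product_nn_integral_insert[OF insert.hyps(1,2) that] by (simp add: m_def[abs_def])
  have m_meas: "m k \<in> borel_measurable ?P"
    if [measurable]: "k \<in> borel_measurable (Pi\<^sub>M (insert i I) (\<lambda>_. lborel))" for k
    unfolding m_def by measurable
  have slice: "(\<lambda>r. k (x(i := r))) \<in> borel_measurable borel"
    if [measurable]: "k \<in> borel_measurable (Pi\<^sub>M (insert i I) (\<lambda>_. lborel))"
      and "x \<in> extensional I" for k :: "('i \<Rightarrow> real) \<Rightarrow> ennreal" and x
  proof -
    have "x \<in> space ?P" using that by (simp add: space_PiM PiE_def)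
    then have "(\<lambda>r. k (x(i := r))) \<in> borel_measurable lborel"
      using insert.hyps by (intro measurable_compose[OF measurable_component_update that(1)]) auto
    then show ?thesis by simp
  qed
  have "integral\<^sup>N ?P (m f) * integral\<^sup>N ?P (m g) \<le> (integral\<^sup>N ?P (m h))\<^sup>2"
  proof (rule insert.IH[OF m_meas m_meas m_meas], fact+)
    fix x y :: "'i \<Rightarrow> real" assume xy: "x \<in> extensional I" "y \<in> extensional I"
    let ?z = "\<lambda>i\<in>I. (x i + y i) / 2"
    have "f (x(i := r)) * g (y(i := s)) \<le> (h (?z(i := (r + s) / 2)))\<^sup>2" for r s
    proof -
      have "(\<lambda>j\<in>insert i I. ((x(i := r)) j + (y(i := s)) j) / 2) = ?z(i := (r + s) / 2)"
        using insert.hyps by (auto simp: restrict_def)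
      moreover have "x(i := r) \<in> extensional (insert i I)" "y(i := s) \<in> extensional (insert i I)"
        using xy by (auto simp: extensional_def)
      ultimately show ?thesis using insert.prems(4) by metis
    qed
    then show "m f x * m g y \<le> (m h ?z)\<^sup>2"
      unfolding m_def using xy by (intro prekopa_leindler_real slice meas) (auto simp del: restrict_apply)
  qed
  then show ?case by (simp add: ins meas)
qed

lemma prekopa_leindler:
  fixes f g h :: "'a::euclidean_space \<Rightarrow> ennreal"
  assumes [measurable]: "f \<in> borel_measurable borel" "g \<in> borel_measurable borel"
      "h \<in> borel_measurable borel"
    and fgh: "\<And>x y. f x * g y \<le> (h ((1/2) *\<^sub>R (x + y)))\<^sup>2"
  shows "(\<integral>\<^sup>+x. f x \<partial>lborel) * (\<integral>\<^sup>+x. g x \<partial>lborel) \<le> (\<integral>\<^sup>+x. h x \<partial>lborel)\<^sup>2"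
proof -
  let ?e = "\<lambda>x. \<Sum>b\<in>Basis. x b *\<^sub>R (b::'a)"
  let ?P = "Pi\<^sub>M Basis (\<lambda>_::'a. lborel :: real measure)"
  have [measurable]: "?e \<in> measurable ?P borel" by measurable
  have int: "(\<integral>\<^sup>+x. k x \<partial>lborel) = (\<integral>\<^sup>+x. k (?e x) \<partial>?P)"
    if [measurable]: "k \<in> borel_measurable borel" for k :: "'a \<Rightarrow> ennreal"
    by (subst lborel_eq) (simp add: nn_integral_distr)
  have mid: "(1/2) *\<^sub>R (?e x + ?e y) = ?e (\<lambda>i\<in>Basis. (x i + y i) / 2)" for x y
    by (simp add: scaleR_sum_right sum.distrib[symmetric] scaleR_add_left[symmetric] add_divide_distrib
        cong: sum.cong)
  have "integral\<^sup>N ?P (\<lambda>x. f (?e x)) * integral\<^sup>N ?P (\<lambda>x. g (?e x))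
      \<le> (integral\<^sup>N ?P (\<lambda>x. h (?e x)))\<^sup>2"
  proof (rule prekopa_leindler_PiM)
    show "f (?e x) * g (?e y) \<le> (h (?e (\<lambda>i\<in>Basis. (x i + y i) / 2)))\<^sup>2" for x y
      using fgh[of "?e x" "?e y"] unfolding mid .
  qed simp_all
  then show ?thesis
    by (simp only: int[OF assms(1)] int[OF assms(2)] int[OF assms(3)])
qed

section \<open>Gaussian mixtures\<close>

lemma has_derivative_of_quadratic_remainder:
  fixes f :: "'a::real_normed_vector \<Rightarrow> 'b::real_normed_vector"
  assumes L: "bounded_linear L"
    and rem: "\<And>h. norm h \<le> 1 \<Longrightarrow> norm (f (x + h) - f x - L h) \<le> C * (norm h)\<^sup>2"
  shows "(f has_derivative L) (at x)"
  unfolding has_derivative_at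
proof (intro conjI L)
  have "\<forall>\<^sub>F h in at 0. norm (norm (f (x + h) - f x - L h) / norm h) \<le> C * norm h"
    unfolding eventually_at
  proof (intro exI[of _ 1] conjI ballI impI)
    fix h :: 'a assume h: "h \<noteq> 0 \<and> dist h 0 < 1"
    then have "norm (f (x + h) - f x - L h) / norm h \<le> C * (norm h)\<^sup>2 / norm h"
      by (intro divide_right_mono rem) auto
    also have "\<dots> = C * norm h" using h by (simp add: power2_eq_square)
    finally show "norm (norm (f (x + h) - f x - L h) / norm h) \<le> C * norm h" by simp
  qed simp
  moreover have "((\<lambda>h::'a. C * norm h) \<longlongrightarrow> 0) (at 0)"
    by (auto intro!: tendsto_eq_intros)
  ultimately show "((\<lambda>h. norm (f (x + h) - f x - L h) / norm h) \<longlongrightarrow> 0) (at 0)"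
    by (rule Lim_null_comparison)
qed

lemma exp_remainder2_le: "\<bar>exp s - 1 - s\<bar> \<le> s\<^sup>2 * exp \<bar>s\<bar>" for s :: real
proof -
  obtain t where t: "\<bar>t\<bar> \<le> \<bar>s\<bar>" "exp s = (\<Sum>m<2. s ^ m / fact m) + exp t / fact 2 * s ^ 2"
    using Maclaurin_exp_le[of s 2] by blast
  then have "exp s - 1 - s = exp t / 2 * s\<^sup>2"
    by (simp add: numeral_2_eq_2)
  then have "\<bar>exp s - 1 - s\<bar> = \<bar>exp t / 2 * s\<^sup>2\<bar>" by (rule arg_cong)
  also have "\<dots> = exp t / 2 * s\<^sup>2" by (intro abs_of_nonneg) simp
  also have "\<dots> \<le> exp \<bar>s\<bar> * s\<^sup>2"
  proof (rule mult_right_mono)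
    have "exp t \<le> exp \<bar>s\<bar>" using t(1) by simp
    then show "exp t / 2 \<le> exp \<bar>s\<bar>" using exp_gt_zero[of t] by linarith
  qed simp
  finally show ?thesis by (simp add: mult.commute)
qed

text \<open>This class contains the constants and the coordinates, is closed under products (so
  differentiating under the integral stays inside it), and each member is integrable against the
  Gaussian weight for every probability measure.\<close>

definition exp_bounded :: "('a::euclidean_space \<Rightarrow> 'b::{banach,second_countable_topology}) \<Rightarrow> bool"
  where "exp_bounded g \<longleftrightarrow> g \<in> borel_measurable borel \<and> (\<exists>C A. \<forall>y. norm (g y) \<le> C * exp (A * norm y))"

lemma exp_boundedI:
  assumes "g \<in> borel_measurable borel" "\<And>y. norm (g y) \<le> C * exp (A * norm y)"
  shows "exp_bounded g"
  using assms unfolding exp_bounded_def by blast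

lemma exp_bounded_const [simp]: "exp_bounded (\<lambda>_. c)"
  by (rule exp_boundedI[where C="norm c" and A=0]) auto

lemma norm_le_exp: "norm y \<le> exp (norm y)"
  using exp_ge_add_one_self[of "norm y"] by linarith

lemma exp_bounded_ident [simp]: "exp_bounded (\<lambda>y. y)"
  by (rule exp_boundedI[where C=1 and A=1]) (auto simp: norm_le_exp)

lemma exp_bounded_scaleR [simp]:
  assumes "exp_bounded f" "exp_bounded g"
  shows "exp_bounded (\<lambda>y. f y *\<^sub>R g y)"
proof -
  obtain C A D B where *: "\<And>y. norm (f y) \<le> C * exp (A * norm y)" "\<And>y. norm (g y) \<le> D * exp (B * norm y)"
    using assms unfolding exp_bounded_def by metis
  have "norm (f y *\<^sub>R g y) \<le> (C * D) * exp ((A + B) * norm y)" for y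
  proof -
    have "norm (f y *\<^sub>R g y) \<le> (C * exp (A * norm y)) * (D * exp (B * norm y))"
      using *[of y] by (auto intro!: mult_mono intro: order_trans[OF norm_ge_zero])
    then show ?thesis by (simp add: exp_add algebra_simps)
  qed
  then show ?thesis using assms by (intro exp_boundedI) (auto simp: exp_bounded_def)
qed

lemma exp_bounded_mult [simp]:
  assumes "exp_bounded f" "exp_bounded g"
  shows "exp_bounded (\<lambda>y. f y * g y :: real)"
  using exp_bounded_scaleR[OF assms] by simp

lemma exp_bounded_inner [simp]: "exp_bounded (\<lambda>y. h \<bullet> y)"
proof (rule exp_boundedI[where C="norm h" and A=1])
  fix y :: 'a
  have "norm (h \<bullet> y) \<le> norm h * norm y" by (simp add: Cauchy_Schwarz_ineq2)
  also have "\<dots> \<le> norm h * exp (norm y)" by (intro mult_left_mono norm_le_exp) auto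
  finally show "norm (h \<bullet> y) \<le> norm h * exp (1 * norm y)" by simp
qed auto

lemma exp_bounded_add [simp]:
  assumes "exp_bounded f" "exp_bounded g"
  shows "exp_bounded (\<lambda>y. f y + g y)"
proof -
  obtain C A D B where *: "\<And>y. norm (f y) \<le> C * exp (A * norm y)" "\<And>y. norm (g y) \<le> D * exp (B * norm y)"
    using assms unfolding exp_bounded_def by metis
  have "0 \<le> C" "0 \<le> D"
    using order_trans[OF norm_ge_zero *(1)[of 0]] order_trans[OF norm_ge_zero *(2)[of 0]] by auto
  have "norm (f y + g y) \<le> (C + D) * exp (max A B * norm y)" for y
  proof -
    have "norm (f y + g y) \<le> C * exp (A * norm y) + D * exp (B * norm y)"
      using *[of y] norm_triangle_ineq[of "f y" "g y"] by linarith
    also have "\<dots> \<le> C * exp (max A B * norm y) + D * exp (max A B * norm y)"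
      using \<open>0 \<le> C\<close> \<open>0 \<le> D\<close> by (intro add_mono mult_left_mono) (auto intro!: mult_right_mono)
    finally show ?thesis by (simp add: algebra_simps)
  qed
  then show ?thesis using assms by (intro exp_boundedI) (auto simp: exp_bounded_def)
qed

lemma exp_bounded_minus [simp]: "exp_bounded f \<Longrightarrow> exp_bounded (\<lambda>y. - f y)"
  unfolding exp_bounded_def by auto

lemma exp_bounded_diff [simp]:
  "exp_bounded f \<Longrightarrow> exp_bounded g \<Longrightarrow> exp_bounded (\<lambda>y. f y - g y)"
  using exp_bounded_add[of f "\<lambda>y. - g y"] by simp

lemma exp_bounded_power2 [simp]: "exp_bounded f \<Longrightarrow> exp_bounded (\<lambda>y. (f y)\<^sup>2 :: real)"
  unfolding power2_eq_square by simp


section \<open>Gaussian mixtures as Laplace transforms\<close>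

locale gauss_mixture = prob_space \<nu> for \<nu> :: "'a::euclidean_space measure" +
  fixes s b :: real
  assumes sets_eq [measurable_cong]: "sets \<nu> = sets borel" and s_pos: "0 < s" and b_pos: "0 < b"
begin

text \<open>The part of the mixture integral that remains once the factor depending on
  \<open>x\<close> alone is taken out of the kernel; the quadratic term makes it finite for every
  \<theta>.\<close>

definition laplace :: "('a \<Rightarrow> 'b::{banach,second_countable_topology}) \<Rightarrow> 'a \<Rightarrow> 'b" where
  "laplace g \<theta> = (\<integral>y. exp (\<theta> \<bullet> y - (b / s)\<^sup>2 / 2 * (norm y)\<^sup>2) *\<^sub>R g y \<partial>\<nu>)"

text \<open>The integrand is bounded: a linear exponent M r against the weight c r^2 never exceeds
  M^2 / (4 c).\<close>

lemma integrable_laplace: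
  assumes g: "exp_bounded g"
  shows "integrable \<nu> (\<lambda>y. exp (\<theta> \<bullet> y - (b / s)\<^sup>2 / 2 * (norm y)\<^sup>2) *\<^sub>R g y)"
proof -
  obtain C A where CA: "\<And>y. norm (g y) \<le> C * exp (A * norm y)"
    using g unfolding exp_bounded_def by blast
  have [measurable]: "g \<in> borel_measurable borel" using g by (simp add: exp_bounded_def)
  have C: "C \<ge> 0" using order_trans[OF norm_ge_zero CA[of 0]] by auto
  define c where "c = (b / s)\<^sup>2 / 2"
  have c: "c > 0" using s_pos b_pos by (simp add: c_def)
  define M where "M = norm \<theta> + A"
  have "norm (exp (\<theta> \<bullet> y - c * (norm y)\<^sup>2) *\<^sub>R g y) \<le> C * exp (M\<^sup>2 / (4 * c))" for y
  proof -
    have "norm (exp (\<theta> \<bullet> y - c * (norm y)\<^sup>2) *\<^sub>R g y)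
        \<le> exp (\<theta> \<bullet> y - c * (norm y)\<^sup>2) * (C * exp (A * norm y))"
      by (auto intro!: mult_left_mono CA)
    also have "\<dots> = C * exp (\<theta> \<bullet> y + A * norm y - c * (norm y)\<^sup>2)"
      by (simp add: exp_add[symmetric] algebra_simps)
    also have "\<dots> \<le> C * exp (M\<^sup>2 / (4 * c))"
    proof -
      have "\<theta> \<bullet> y \<le> norm \<theta> * norm y" by (rule norm_cauchy_schwarz)
      moreover have "0 \<le> c * (norm y - M / (2 * c))\<^sup>2" using c by simp
      moreover have "c * (norm y - M / (2 * c))\<^sup>2 = c * (norm y)\<^sup>2 - M * norm y + M\<^sup>2 / (4 * c)"
        using c by (simp add: power2_eq_square field_simps)
      ultimately have "M * norm y - c * (norm y)\<^sup>2 \<le> M\<^sup>2 / (4 * c)" "\<theta> \<bullet> y \<le> norm \<theta> * norm y"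
        by linarith+
      then show ?thesis using C by (intro mult_left_mono) (auto simp: M_def algebra_simps)
    qed
    finally show ?thesis .
  qed
  then show ?thesis
    unfolding c_def[symmetric] by (intro integrable_const_bound AE_I2) auto
qed

lemma laplace_has_derivative:
  assumes g: "exp_bounded g"
  shows "(laplace g has_derivative (\<lambda>h. laplace (\<lambda>y. (h \<bullet> y) *\<^sub>R g y) \<theta>)) (at \<theta>)"
proof -
  define w where "w = (\<lambda>\<theta> y::'a. exp (\<theta> \<bullet> y - (b / s)\<^sup>2 / 2 * (norm y)\<^sup>2))"
  have int: "integrable \<nu> (\<lambda>y. w \<theta> y *\<^sub>R k y)" if "exp_bounded k" for k :: "'a \<Rightarrow> 'c::{banach,second_countable_topology}" and \<theta>
    using integrable_laplace[OF that] by (simp add: w_def)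
  have lap: "laplace k \<theta> = (\<integral>y. w \<theta> y *\<^sub>R k y \<partial>\<nu>)" for k :: "'a \<Rightarrow> 'c::{banach,second_countable_topology}" and \<theta>
    by (simp add: laplace_def w_def)
  define L where "L h = laplace (\<lambda>y. (h \<bullet> y) *\<^sub>R g y) \<theta>" for h
  \<comment> \<open>Constant of the quadratic remainder. Of the three factors exp |y|, two come from
    |y|^2 \<le> exp (2 |y|) and one from exp |h \<bullet> y| with |h| \<le> 1.\<close>
  define K where "K = laplace (\<lambda>y. norm (g y) * exp (3 * norm y)) \<theta>"
  have gK: "exp_bounded (\<lambda>y. norm (g y) * exp (3 * norm y))"
  proof -
    have "exp_bounded (\<lambda>y. norm (g y))" using g by (auto simp: exp_bounded_def)
    moreover have "exp_bounded (\<lambda>y::'a. exp (3 * norm y))"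
      by (rule exp_boundedI[where C=1 and A=3]) auto
    ultimately show ?thesis by simp
  qed
  have gh: "exp_bounded (\<lambda>y. (h \<bullet> y) *\<^sub>R g y)" for h using g by simp
  have rem: "norm (laplace g (\<theta> + h) - laplace g \<theta> - L h) \<le> K * (norm h)\<^sup>2" if h: "norm h \<le> 1" for h
  proof -
    have "laplace g (\<theta> + h) - laplace g \<theta> - L h
        = (\<integral>y. w (\<theta> + h) y *\<^sub>R g y - w \<theta> y *\<^sub>R g y - w \<theta> y *\<^sub>R ((h \<bullet> y) *\<^sub>R g y) \<partial>\<nu>)"
      unfolding L_def lap
      using int[OF g] int[OF gh] by (simp add: Bochner_Integration.integral_diff)
    also have "norm \<dots> \<le> (\<integral>y. (norm h)\<^sup>2 * (w \<theta> y * (norm (g y) * exp (3 * norm y))) \<partial>\<nu>)"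
    proof (rule Bochner_Integration.integral_norm_bound_integral)
      show "integrable \<nu> (\<lambda>y. w (\<theta> + h) y *\<^sub>R g y - w \<theta> y *\<^sub>R g y - w \<theta> y *\<^sub>R (h \<bullet> y) *\<^sub>R g y)"
        using int[OF g] int[OF gh] by auto
      show "integrable \<nu> (\<lambda>y. (norm h)\<^sup>2 * (w \<theta> y * (norm (g y) * exp (3 * norm y))))"
        using int[OF gK] by simp
      fix y
      let ?t = "h \<bullet> y"
      have t: "\<bar>?t\<bar> \<le> norm h * norm y" by (rule Cauchy_Schwarz_ineq2)
      then have t': "\<bar>?t\<bar> \<le> norm y" using h by (meson mult_left_le_one_le norm_ge_zero order_trans)
      have "w (\<theta> + h) y *\<^sub>R g y - w \<theta> y *\<^sub>R g y - w \<theta> y *\<^sub>R ?t *\<^sub>R g y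
          = (w \<theta> y * (exp ?t - 1 - ?t)) *\<^sub>R g y"
        by (simp add: w_def inner_add_left exp_add[symmetric] algebra_simps)
      also have "norm \<dots> = w \<theta> y * \<bar>exp ?t - 1 - ?t\<bar> * norm (g y)"
        by (simp add: w_def abs_mult)
      also have "\<dots> \<le> w \<theta> y * ((norm h)\<^sup>2 * exp (3 * norm y)) * norm (g y)"
      proof (intro mult_right_mono mult_left_mono)
        have "\<bar>exp ?t - 1 - ?t\<bar> \<le> ?t\<^sup>2 * exp \<bar>?t\<bar>" by (rule exp_remainder2_le)
        also have "\<dots> \<le> (norm h * norm y)\<^sup>2 * exp (norm y)"
          using t t' power_mono[OF t, of 2] by (intro mult_mono) auto
        also have "\<dots> \<le> (norm h * exp (norm y))\<^sup>2 * exp (norm y)"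
          by (intro mult_right_mono power_mono mult_left_mono norm_le_exp) auto
        also have "\<dots> = (norm h)\<^sup>2 * (exp (norm y) * exp (norm y) * exp (norm y))"
          by (simp add: power2_eq_square)
        also have "exp (norm y) * exp (norm y) * exp (norm y) = exp (3 * norm y)"
          by (simp flip: exp_add)
        finally show "\<bar>exp ?t - 1 - ?t\<bar> \<le> (norm h)\<^sup>2 * exp (3 * norm y)" .
      qed (auto simp: w_def)
      finally show "norm (w (\<theta> + h) y *\<^sub>R g y - w \<theta> y *\<^sub>R g y - w \<theta> y *\<^sub>R (h \<bullet> y) *\<^sub>R g y)
          \<le> (norm h)\<^sup>2 * (w \<theta> y * (norm (g y) * exp (3 * norm y)))"
        by (simp add: algebra_simps)
    qed
    also have "\<dots> = K * (norm h)\<^sup>2"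
      by (simp add: K_def lap)
    finally show ?thesis .
  qed
  have "bounded_linear L"
  proof (intro bounded_linear_intro[where K="laplace (\<lambda>y. norm y * norm (g y)) \<theta>"])
    show "L (x + y) = L x + L y" for x y
      unfolding L_def lap using int[OF gh] by (simp add: inner_add_left scaleR_add_left scaleR_add_right)
    show "L (r *\<^sub>R x) = r *\<^sub>R L x" for r x
    proof -
      have "w \<theta> y *\<^sub>R (r *\<^sub>R x \<bullet> y) *\<^sub>R g y = r *\<^sub>R (w \<theta> y *\<^sub>R (x \<bullet> y) *\<^sub>R g y)" for y by simp
      then show ?thesis unfolding L_def lap by (simp only: integral_scaleR_right)
    qed
    have gn: "exp_bounded (\<lambda>y. norm y * norm (g y))"
    proof -
      have "exp_bounded (\<lambda>y. norm (g y))" "exp_bounded (\<lambda>y::'a. norm y)"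
        using g by (auto simp: exp_bounded_def intro!: exI[of _ 1] norm_le_exp)
      then show ?thesis by simp
    qed
    show "norm (L x) \<le> norm x * laplace (\<lambda>y. norm y * norm (g y)) \<theta>" for x
    proof -
      have "norm (L x) \<le> (\<integral>y. norm x * (w \<theta> y *\<^sub>R (norm y * norm (g y))) \<partial>\<nu>)"
        unfolding L_def lap
      proof (rule Bochner_Integration.integral_norm_bound_integral)
        show "integrable \<nu> (\<lambda>y. w \<theta> y *\<^sub>R (x \<bullet> y) *\<^sub>R g y)" by (rule int[OF gh])
        show "integrable \<nu> (\<lambda>y. norm x * w \<theta> y *\<^sub>R (norm y * norm (g y)))" using int[OF gn] by simp
        show "norm (w \<theta> y *\<^sub>R (x \<bullet> y) *\<^sub>R g y) \<le> norm x * w \<theta> y *\<^sub>R (norm y * norm (g y))" for y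
        proof -
          have "\<bar>x \<bullet> y\<bar> * (w \<theta> y * norm (g y)) \<le> (norm x * norm y) * (w \<theta> y * norm (g y))"
            by (intro mult_right_mono Cauchy_Schwarz_ineq2) (simp add: w_def)
          then show ?thesis by (simp add: w_def abs_mult algebra_simps)
        qed
      qed
      also have "\<dots> = norm x * laplace (\<lambda>y. norm y * norm (g y)) \<theta>"
        by (simp add: lap)
      finally show ?thesis .
    qed
  qed
  from has_derivative_of_quadratic_remainder[OF this rem] show ?thesis
    unfolding L_def by simp
qed

text \<open>
  For s and b the values of the coefficients at time t, post g x is the conditional expectation
  of g applied to the end point given that the interpolant is at x, and mass is the density of
  the interpolant up to a constant factor.
\<close>

definition kernel :: "'a \<Rightarrow> 'a \<Rightarrow> real" where
  "kernel x y = exp (- (norm (x - b *\<^sub>R y))\<^sup>2 / (2 * s\<^sup>2))"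

definition kint :: "('a \<Rightarrow> 'b::{banach,second_countable_topology}) \<Rightarrow> 'a \<Rightarrow> 'b" where
  "kint g x = (\<integral>y. kernel x y *\<^sub>R g y \<partial>\<nu>)"

definition mass :: "'a \<Rightarrow> real" where
  "mass x = kint (\<lambda>_. 1) x"

definition post :: "('a \<Rightarrow> 'b::{banach,second_countable_topology}) \<Rightarrow> 'a \<Rightarrow> 'b" where
  "post g x = kint g x /\<^sub>R mass x"

text \<open>Tweedie's formula, taken as the definition; \<open>ln_mass_has_derivative\<close>
  identifies it as the gradient of \<open>ln (mass x)\<close>.\<close>

definition score :: "'a \<Rightarrow> 'a" where
  "score x = (b / s\<^sup>2) *\<^sub>R post (\<lambda>y. y) x - x /\<^sub>R s\<^sup>2"

text \<open>The derivative of the score as a linear map in \<open>h\<close>, with the posterior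
  covariance written out. Matrices appear only when the Jacobian of the velocity is formed.\<close>

definition hess :: "'a \<Rightarrow> 'a \<Rightarrow> 'a" where
  "hess x h = (b / s\<^sup>2)\<^sup>2 *\<^sub>R (post (\<lambda>y. (h \<bullet> y) *\<^sub>R y) x - (h \<bullet> post (\<lambda>y. y) x) *\<^sub>R post (\<lambda>y. y) x)
    - h /\<^sub>R s\<^sup>2"

lemma kernel_pos [simp]: "0 < kernel x y" by (simp add: kernel_def)

lemma kernel_measurable [measurable]:
  "case_prod kernel \<in> borel_measurable (borel \<Otimes>\<^sub>M borel)"
  "kernel x \<in> borel_measurable borel" "(\<lambda>x. kernel x y) \<in> borel_measurable borel"
  unfolding kernel_def[abs_def] by measurable

text \<open>Separates a factor in \<open>x\<close> alone from the Laplace weight at \<theta> = (b /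
  s^2) x, so that posterior averages become quotients of Laplace transforms.\<close>

lemma kernel_eq:
  "kernel x y = exp (- (norm x)\<^sup>2 / (2 * s\<^sup>2)) * exp (((b / s\<^sup>2) *\<^sub>R x) \<bullet> y - (b / s)\<^sup>2 / 2 * (norm y)\<^sup>2)"
proof -
  have eq: "(norm (x - b *\<^sub>R y))\<^sup>2 = (norm x)\<^sup>2 - 2 * b * (x \<bullet> y) + b\<^sup>2 * (norm y)\<^sup>2"
    by (simp only: power2_norm_eq_inner) (simp add: algebra_simps inner_commute power2_eq_square)
  show ?thesis unfolding kernel_def exp_add[symmetric] eq inner_scaleR_left
    using s_pos by (intro arg_cong[where f=exp]) (simp add: power_divide field_simps)
qed

lemma integrable_kernel:
  assumes "exp_bounded g" shows "integrable \<nu> (\<lambda>y. kernel x y *\<^sub>R g y)"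
  using integrable_laplace[OF assms, of "(b / s\<^sup>2) *\<^sub>R x"]
  unfolding kernel_eq scaleR_scaleR[symmetric] by (rule integrable_scaleR_right)

lemma kint_eq: "kint g x = exp (- (norm x)\<^sup>2 / (2 * s\<^sup>2)) *\<^sub>R laplace g ((b / s\<^sup>2) *\<^sub>R x)"
  unfolding kint_def kernel_eq scaleR_scaleR[symmetric] laplace_def by (rule integral_scaleR_right)

lemma mass_pos: "0 < mass x"
proof -
  have int: "integrable \<nu> (\<lambda>y. kernel x y)" using integrable_kernel[of "\<lambda>_. 1::real"] by simp
  have "(\<integral>y. kernel x y \<partial>\<nu>) \<noteq> 0"
  proof
    assume "(\<integral>y. kernel x y \<partial>\<nu>) = 0"
    then have "AE y in \<nu>. kernel x y = 0"
      using int by (subst (asm) integral_nonneg_eq_0_iff_AE) (auto simp: less_imp_le)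
    then have "AE y in \<nu>. False" by (auto elim!: eventually_mono simp: less_imp_neq[OF kernel_pos, symmetric])
    then show False by simp
  qed
  moreover have "0 \<le> (\<integral>y. kernel x y \<partial>\<nu>)" by (simp add: less_imp_le)
  ultimately have "0 < (\<integral>y. kernel x y \<partial>\<nu>)" by simp
  then show ?thesis by (simp add: mass_def kint_def)
qed

lemma post_eq_laplace:
  "post g x = laplace g ((b / s\<^sup>2) *\<^sub>R x) /\<^sub>R laplace (\<lambda>_. 1) ((b / s\<^sup>2) *\<^sub>R x)"
  unfolding post_def mass_def kint_eq by simp

lemma laplace_1_pos: "0 < laplace (\<lambda>_. 1 :: real) ((b / s\<^sup>2) *\<^sub>R x)"
  using mass_pos[of x] unfolding mass_def kint_eq by (simp add: zero_less_mult_iff)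

lemma post_add: "exp_bounded f \<Longrightarrow> exp_bounded g \<Longrightarrow> post (\<lambda>y. f y + g y) x = post f x + post g x"
  using integrable_kernel[of f x] integrable_kernel[of g x]
  by (simp add: post_def kint_def scaleR_add_right)

lemma post_diff: "exp_bounded f \<Longrightarrow> exp_bounded g \<Longrightarrow> post (\<lambda>y. f y - g y) x = post f x - post g x"
  using integrable_kernel[of f x] integrable_kernel[of g x]
  by (simp add: post_def kint_def scaleR_diff_right)

lemma post_cmult: "post (\<lambda>y. c * f y) x = c * post f x" for f :: "'a \<Rightarrow> real"
proof -
  have "kint (\<lambda>y. c * f y) x = c * kint f x"
    unfolding kint_def by (simp add: mult.left_commute)
  then show ?thesis by (simp add: post_def)
qed

lemma post_const: "post (\<lambda>y. c) x = (c :: real)"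
  using post_cmult[of c "\<lambda>_. 1" x] mass_pos[of x] by (simp add: post_def mass_def[symmetric])

lemma post_inner:
  fixes g :: "'a \<Rightarrow> 'c::euclidean_space"
  shows "exp_bounded g \<Longrightarrow> post (\<lambda>y. u \<bullet> g y) x = u \<bullet> post g x"
  using integral_inner_right[of u \<nu> "\<lambda>y. kernel x y *\<^sub>R g y"] integrable_kernel[of g x]
  by (simp add: post_def kint_def)

lemma post_mono:
  assumes "exp_bounded f" "exp_bounded g" "AE y in \<nu>. f y \<le> (g y :: real)"
  shows "post f x \<le> post g x"
proof -
  have "kint f x \<le> kint g x"
    unfolding kint_def using assms
    by (intro integral_mono_AE integrable_kernel) (auto elim!: eventually_mono simp: less_imp_le[OF kernel_pos])
  then show ?thesis using mass_pos[of x] by (simp add: post_def divide_right_mono)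
qed

text \<open>Quotient rule for two Laplace transforms; the outcome is the posterior covariance of
  \<open>h \<bullet> y\<close> and \<open>g y\<close>.\<close>

lemma post_has_derivative:
  assumes g: "exp_bounded g"
  shows "(post g has_derivative
    (\<lambda>h. (b / s\<^sup>2) *\<^sub>R (post (\<lambda>y. (h \<bullet> y) *\<^sub>R g y) x - post (\<lambda>y. h \<bullet> y) x *\<^sub>R post g x))) (at x)"
proof -
  define c where "c = b / s\<^sup>2"
  define L1 where "L1 = laplace (\<lambda>_. 1::real) (c *\<^sub>R x)"
  have L1: "L1 > 0" using laplace_1_pos by (simp add: L1_def c_def)
  have chain: "((\<lambda>x. laplace k (c *\<^sub>R x)) has_derivative (\<lambda>h. c *\<^sub>R laplace (\<lambda>y. (h \<bullet> y) *\<^sub>R k y) (c *\<^sub>R x))) (at x)"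
    if k: "exp_bounded k" for k :: "'a \<Rightarrow> 'c::{banach,second_countable_topology}"
  proof -
    have lin: "laplace (\<lambda>y. ((c *\<^sub>R h) \<bullet> y) *\<^sub>R k y) \<theta> = c *\<^sub>R laplace (\<lambda>y. (h \<bullet> y) *\<^sub>R k y) \<theta>" for h \<theta>
    proof -
      have "exp r *\<^sub>R (c *\<^sub>R h \<bullet> y) *\<^sub>R k y = c *\<^sub>R (exp r *\<^sub>R (h \<bullet> y) *\<^sub>R k y)" for y and r :: real by simp
      then show ?thesis unfolding laplace_def by (simp only: integral_scaleR_right)
    qed
    have "((\<lambda>x. c *\<^sub>R x) has_derivative (\<lambda>h. c *\<^sub>R h)) (at x)" by (auto intro!: derivative_eq_intros)
    from has_derivative_compose[OF this laplace_has_derivative[OF k]] show ?thesis unfolding lin .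
  qed
  have "((\<lambda>x. inverse (laplace (\<lambda>_. 1::real) (c *\<^sub>R x)) *\<^sub>R laplace g (c *\<^sub>R x)) has_derivative
    (\<lambda>h. inverse L1 *\<^sub>R (c *\<^sub>R laplace (\<lambda>y. (h \<bullet> y) *\<^sub>R g y) (c *\<^sub>R x))
       + (- (inverse L1 * (c *\<^sub>R laplace (\<lambda>y. (h \<bullet> y) *\<^sub>R 1) (c *\<^sub>R x)) * inverse L1)) *\<^sub>R laplace g (c *\<^sub>R x))) (at x)"
    unfolding L1_def
    by (rule has_derivative_scaleR[OF Deriv.has_derivative_inverse[OF _ chain] chain[OF g]])
      (use L1 in \<open>auto simp: L1_def\<close>)
  then show ?thesis
    unfolding post_eq_laplace[abs_def] c_def[symmetric] L1_def[symmetric]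
    by (rule has_derivative_eq_rhs) (auto simp: fun_eq_iff algebra_simps)
qed

lemma ln_mass_has_derivative: "((\<lambda>x. ln (mass x)) has_derivative (\<lambda>h. score x \<bullet> h)) (at x)"
proof -
  define c where "c = b / s\<^sup>2"
  have "((\<lambda>x. c *\<^sub>R x) has_derivative (\<lambda>h. c *\<^sub>R h)) (at x)" by (auto intro!: derivative_eq_intros)
  from has_derivative_compose[OF this laplace_has_derivative[of "\<lambda>_. 1::real"]]
  have 1: "((\<lambda>x. laplace (\<lambda>_. 1::real) (c *\<^sub>R x)) has_derivative
      (\<lambda>h. laplace (\<lambda>y. (c *\<^sub>R h) \<bullet> y) (c *\<^sub>R x))) (at x)" by simp
  have "((\<lambda>x. ln (laplace (\<lambda>_. 1::real) (c *\<^sub>R x)) - (x \<bullet> x) / (2 * s\<^sup>2)) has_derivative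
      (\<lambda>h. inverse (laplace (\<lambda>_. 1) (c *\<^sub>R x)) * laplace (\<lambda>y. (c *\<^sub>R h) \<bullet> y) (c *\<^sub>R x)
         - (x \<bullet> h) / s\<^sup>2)) (at x)"
    using s_pos
    by (intro has_derivative_eq_rhs[OF has_derivative_diff[OF has_derivative_ln[OF _ 1]
        has_derivative_divide'[OF has_derivative_inner[OF has_derivative_ident has_derivative_ident]]]])
      (auto simp: c_def fun_eq_iff field_simps inner_commute laplace_1_pos)
  moreover have "ln (mass x) = ln (laplace (\<lambda>_. 1::real) (c *\<^sub>R x)) - (x \<bullet> x) / (2 * s\<^sup>2)" for x
    using laplace_1_pos[of x] by (simp add: mass_def kint_eq ln_mult c_def power2_norm_eq_inner)
  moreover have "inverse (laplace (\<lambda>_. 1) (c *\<^sub>R x)) * laplace (\<lambda>y. (c *\<^sub>R h) \<bullet> y) (c *\<^sub>R x)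
         - (x \<bullet> h) / s\<^sup>2 = score x \<bullet> h" for h
  proof -
    have "inverse (laplace (\<lambda>_. 1) (c *\<^sub>R x)) * laplace (\<lambda>y. (c *\<^sub>R h) \<bullet> y) (c *\<^sub>R x)
        = (c *\<^sub>R h) \<bullet> post (\<lambda>y. y) x"
      using post_inner[OF exp_bounded_ident, of "c *\<^sub>R h" x]
      by (simp only: post_eq_laplace[of "\<lambda>y. (c *\<^sub>R h) \<bullet> y"] c_def[symmetric] real_scaleR_def)
    then show ?thesis
      unfolding score_def c_def[symmetric] by (simp add: inner_diff_left inner_diff_right inner_commute divide_inverse)
  qed
  ultimately show ?thesis by simp
qed

lemma score_has_derivative: "(score has_derivative hess x) (at x)"
  unfolding score_def[abs_def]
  by (rule has_derivative_eq_rhs, rule has_derivative_diff[OF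
    has_derivative_scaleR_right[OF post_has_derivative] has_derivative_scaleR_right[OF has_derivative_ident]])
    (simp_all add: hess_def fun_eq_iff power2_eq_square post_inner)

lemma inner_hess:
  "u \<bullet> hess x h = (b / s\<^sup>2)\<^sup>2 * (post (\<lambda>y. (u \<bullet> y) * (h \<bullet> y)) x - (u \<bullet> post (\<lambda>y. y) x) * (h \<bullet> post (\<lambda>y. y) x))
    - (u \<bullet> h) / s\<^sup>2"
  using post_inner[of "\<lambda>y. (h \<bullet> y) *\<^sub>R y" u x]
  by (simp add: hess_def inner_diff_right mult.commute divide_inverse)

lemma hess_sym: "u \<bullet> hess x h = h \<bullet> hess x u"
  by (simp add: inner_hess mult.commute inner_commute)

lemma post_centered:
  "post (\<lambda>y. (u \<bullet> y - c)\<^sup>2) x = post (\<lambda>y. (u \<bullet> y)\<^sup>2) x - 2 * c * (u \<bullet> post (\<lambda>y. y) x) + c\<^sup>2"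
proof -
  have "(u \<bullet> y - c)\<^sup>2 = ((u \<bullet> y)\<^sup>2 - (2 * c) * (u \<bullet> y)) + c\<^sup>2" for y
    by (simp add: power2_eq_square algebra_simps)
  then show ?thesis
    by (simp add: post_add post_diff post_cmult post_const post_inner)
qed

text \<open>A variance may be computed about any centre \<open>c\<close>, which is kept free: the
  lower bound takes the posterior mean, the bounds by the size of the support take the middle of an
  interval or of a ball, and the log-Lipschitz case takes the mean of a Gaussian posterior.\<close>

lemma hess_diag:
  "u \<bullet> hess x u = (b / s\<^sup>2)\<^sup>2 * (post (\<lambda>y. (u \<bullet> y - c)\<^sup>2) x - (u \<bullet> post (\<lambda>y. y) x - c)\<^sup>2) - (u \<bullet> u) / s\<^sup>2"
proof -
  have "post (\<lambda>y. (u \<bullet> y - c)\<^sup>2) x - (u \<bullet> post (\<lambda>y. y) x - c)\<^sup>2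
      = post (\<lambda>y. (u \<bullet> y) * (u \<bullet> y)) x - (u \<bullet> post (\<lambda>y. y) x) * (u \<bullet> post (\<lambda>y. y) x)"
    unfolding post_centered by (simp add: power2_eq_square algebra_simps)
  then show ?thesis by (simp only: inner_hess)
qed

lemma hess_ge: "- (u \<bullet> u) / s\<^sup>2 \<le> u \<bullet> hess x u"
proof -
  have "post (\<lambda>_. 0) x \<le> post (\<lambda>y. (u \<bullet> y - u \<bullet> post (\<lambda>y. y) x)\<^sup>2) x"
    by (rule post_mono) auto
  then show ?thesis
    using hess_diag[of u x "u \<bullet> post (\<lambda>y. y) x"] by (simp add: post_const)
qed

text \<open>The variance is at most the second moment about \<open>c\<close>, and that is at most
  K^2.\<close>

lemma hess_le:
  assumes "AE y in \<nu>. \<bar>u \<bullet> y - c\<bar> \<le> K"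
  shows "u \<bullet> hess x u \<le> (b / s\<^sup>2)\<^sup>2 * K\<^sup>2 - (u \<bullet> u) / s\<^sup>2"
proof -
  have "post (\<lambda>y. (u \<bullet> y - c)\<^sup>2) x \<le> post (\<lambda>_. K\<^sup>2) x"
    by (rule post_mono) (use assms in \<open>auto elim!: eventually_mono simp: abs_le_square_iff[symmetric]\<close>)
  then have "post (\<lambda>y. (u \<bullet> y - c)\<^sup>2) x - (u \<bullet> post (\<lambda>y. y) x - c)\<^sup>2 \<le> K\<^sup>2"
    by (simp add: post_const) (smt (verit) zero_le_power2)
  then show ?thesis
    unfolding hess_diag[of u x c] by (intro diff_right_mono mult_left_mono) auto
qed

end

section \<open>Conditional expectation given a Gaussian mixture\<close>

text \<open>The product of the one-dimensional normal densities in terms of the norm, the form in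
  which squares can be completed.\<close>

definition gauss_density :: "real \<Rightarrow> real^'n \<Rightarrow> real" where
  "gauss_density \<sigma> z = (1 / sqrt (2 * pi * \<sigma>\<^sup>2)) ^ CARD('n) * exp (- (norm z)\<^sup>2 / (2 * \<sigma>\<^sup>2))"

lemma prod_normal_density_0:
  fixes y :: "real^'n"
  shows "(\<Prod>i\<in>UNIV. normal_density 0 \<sigma> (y $ i)) = gauss_density \<sigma> y"
proof -
  have "(\<Prod>i\<in>UNIV. exp (- ((y $ i)\<^sup>2 / (2 * \<sigma>\<^sup>2)))) = exp (- (norm y)\<^sup>2 / (2 * \<sigma>\<^sup>2))"
    by (simp add: exp_sum[symmetric] norm_vec_def L2_set_def sum_nonneg sum_negf sum_divide_distrib)
  then show ?thesis
    by (simp add: normal_density_def gauss_density_def prod.distrib prod_dividef power_one_over power_divide)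
qed

lemma gauss_density_nonneg [simp]: "0 \<le> gauss_density \<sigma> z"
  by (simp add: gauss_density_def)

lemma gauss_density_measurable [measurable]: "gauss_density \<sigma> \<in> borel_measurable borel"
  unfolding gauss_density_def[abs_def] by measurable

lemma gaussian_eq: "gaussian \<sigma> = density lborel (\<lambda>x. ennreal (gauss_density \<sigma> x))"
  by (simp add: gaussian_def prod_normal_density_0)

lemma sets_gaussian [measurable_cong, simp]: "sets (gaussian \<sigma>) = sets borel"
  by (simp add: gaussian_def)

lemma space_gaussian [simp]: "space (gaussian \<sigma>) = UNIV"
  by (simp add: gaussian_def)

lemma nn_integral_gauss_density:
  assumes "\<sigma> > 0"
  shows "(\<integral>\<^sup>+z. gauss_density \<sigma> (z :: real^'n) \<partial>lborel) = 1"
proof -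
  have B: "Basis = range (\<lambda>i::'n. axis i (1::real))" "inj (\<lambda>i::'n. axis i (1::real))"
    by (auto simp: Basis_vec_def inj_def axis_eq_axis)
  have "gauss_density \<sigma> z = (\<Prod>b\<in>Basis. normal_density 0 \<sigma> (z \<bullet> b))" for z :: "real^'n"
    unfolding B(1) by (subst prod.reindex[OF B(2)]) (simp add: inner_axis prod_normal_density_0)
  then have "(\<integral>\<^sup>+z. gauss_density \<sigma> (z :: real^'n) \<partial>lborel)
      = (\<integral>\<^sup>+z. (\<Prod>b\<in>Basis. ennreal (normal_density 0 \<sigma> ((z :: real^'n) \<bullet> b))) \<partial>lborel)"
    by (simp add: prod_ennreal)
  also have "\<dots> = (\<Prod>b\<in>(Basis :: (real^'n) set). (\<integral>\<^sup>+x. normal_density 0 \<sigma> x \<partial>lborel))"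
    by (rule nn_integral_lborel_prod) auto
  also have "(\<integral>\<^sup>+x. normal_density 0 \<sigma> x \<partial>lborel) = 1"
    using assms by (subst nn_integral_eq_integral) auto
  finally show ?thesis by simp
qed

lemma prob_space_gaussian: "\<sigma> > 0 \<Longrightarrow> prob_space (gaussian \<sigma> :: (real^'n) measure)"
  by (rule prob_spaceI) (simp add: gaussian_eq emeasure_density nn_integral_gauss_density)

lemma nn_integral_lborel_affine:
  fixes t :: "'a::euclidean_space"
  assumes [measurable]: "f \<in> borel_measurable borel" and "c > 0"
  shows "(\<integral>\<^sup>+x. f x \<partial>lborel) = ennreal (c ^ DIM('a)) * (\<integral>\<^sup>+x. f (t + c *\<^sub>R x) \<partial>lborel)"
  using \<open>c > 0\<close>
  by (subst lborel_affine[of c t]) (simp_all add: nn_integral_density nn_integral_distr nn_integral_cmult)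

lemma nn_integral_lborel_translate:
  fixes t :: "'a::euclidean_space"
  assumes "f \<in> borel_measurable borel"
  shows "(\<integral>\<^sup>+x. f (x + t) \<partial>lborel) = (\<integral>\<^sup>+x. f x \<partial>lborel)"
  using nn_integral_lborel_affine[OF assms, of 1 t] by (simp add: add.commute)

lemma gauss_density_scale:
  fixes z :: "real^'n"
  assumes "s > 0"
  shows "s ^ CARD('n) * gauss_density s (s *\<^sub>R z) = gauss_density 1 z"
proof -
  have "s * (1 / sqrt (2 * pi * s\<^sup>2)) = 1 / sqrt (2 * pi * 1\<^sup>2)"
    using assms by (simp add: real_sqrt_mult)
  then have "(s * (1 / sqrt (2 * pi * s\<^sup>2))) ^ CARD('n) = (1 / sqrt (2 * pi * 1\<^sup>2)) ^ CARD('n)"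
    by (rule arg_cong)
  then have "s ^ CARD('n) * (1 / sqrt (2 * pi * s\<^sup>2)) ^ CARD('n) = (1 / sqrt (2 * pi * 1\<^sup>2)) ^ CARD('n)"
    by (simp only: power_mult_distrib)
  moreover have "- (norm (s *\<^sub>R z))\<^sup>2 / (2 * s\<^sup>2) = - (norm z)\<^sup>2 / (2 * 1\<^sup>2)"
    using assms by (simp add: power_mult_distrib)
  ultimately show ?thesis
    unfolding gauss_density_def by (simp only: mult.assoc[symmetric])
qed

text \<open>For fixed y the substitution x = b y + s z turns the standard Gaussian into the law of
  the interpolant, and Tonelli exchanges x and y. Hence the pair (interpolant, end point) has
  density \<open>gauss_density s (x - b *\<^sub>R y)\<close> with respect to Lebesgue measure times
  \<nu>.\<close>

lemma nn_integral_gaussian_pair: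
  fixes F :: "(real^'n) \<times> (real^'n) \<Rightarrow> ennreal"
  assumes [measurable]: "F \<in> borel_measurable (borel \<Otimes>\<^sub>M borel)"
    and "prob_space \<nu>" and [measurable_cong]: "sets \<nu> = sets borel" and "s > 0"
  shows "(\<integral>\<^sup>+\<omega>. F (s *\<^sub>R fst \<omega> + b *\<^sub>R snd \<omega>, snd \<omega>) \<partial>(gaussian 1 \<Otimes>\<^sub>M \<nu>))
    = (\<integral>\<^sup>+x. (\<integral>\<^sup>+y. F (x, y) * gauss_density s (x - b *\<^sub>R y) \<partial>\<nu>) \<partial>lborel)"
proof -
  interpret N: prob_space \<nu> by fact
  interpret G: prob_space "gaussian 1 :: (real^'n) measure" by (rule prob_space_gaussian) simp
  interpret P: pair_prob_space "gaussian 1 :: (real^'n) measure" \<nu> ..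
  interpret Q: pair_sigma_finite "lborel :: (real^'n) measure" \<nu> ..
  have "(\<integral>\<^sup>+\<omega>. F (s *\<^sub>R fst \<omega> + b *\<^sub>R snd \<omega>, snd \<omega>) \<partial>(gaussian 1 \<Otimes>\<^sub>M \<nu>))
      = (\<integral>\<^sup>+y. (\<integral>\<^sup>+z. F (s *\<^sub>R z + b *\<^sub>R y, y) \<partial>gaussian 1) \<partial>\<nu>)"
    by (subst P.nn_integral_snd[symmetric]) auto
  also have "\<dots> = (\<integral>\<^sup>+y. (\<integral>\<^sup>+x. F (x, y) * gauss_density s (x - b *\<^sub>R y) \<partial>lborel) \<partial>\<nu>)"
  proof (rule nn_integral_cong)
    fix y
    have "(\<integral>\<^sup>+x. F (x, y) * gauss_density s (x - b *\<^sub>R y) \<partial>lborel)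
      = ennreal (s ^ CARD('n)) * (\<integral>\<^sup>+z. F (b *\<^sub>R y + s *\<^sub>R z, y) * gauss_density s (s *\<^sub>R z) \<partial>lborel)"
      by (subst nn_integral_lborel_affine[OF _ \<open>s > 0\<close>, where t="b *\<^sub>R y"]) simp_all
    also have "\<dots> = (\<integral>\<^sup>+z. ennreal (s ^ CARD('n)) * (F (b *\<^sub>R y + s *\<^sub>R z, y) * gauss_density s (s *\<^sub>R z)) \<partial>lborel)"
      by (rule nn_integral_cmult[symmetric]) simp
    also have "\<dots> = (\<integral>\<^sup>+z. ennreal (gauss_density 1 z) * F (s *\<^sub>R z + b *\<^sub>R y, y) \<partial>lborel)"
      using \<open>s > 0\<close>
      by (intro nn_integral_cong)
        (simp add: gauss_density_scale[symmetric] ennreal_mult ac_simps del: ennreal_power)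
    also have "\<dots> = (\<integral>\<^sup>+z. F (s *\<^sub>R z + b *\<^sub>R y, y) \<partial>gaussian 1)"
      unfolding gaussian_eq by (subst nn_integral_density) auto
    finally show "(\<integral>\<^sup>+z. F (s *\<^sub>R z + b *\<^sub>R y, y) \<partial>gaussian 1)
      = (\<integral>\<^sup>+x. F (x, y) * gauss_density s (x - b *\<^sub>R y) \<partial>lborel)" by simp
  qed
  also have "\<dots> = (\<integral>\<^sup>+x. (\<integral>\<^sup>+y. F (x, y) * gauss_density s (x - b *\<^sub>R y) \<partial>\<nu>) \<partial>lborel)"
    by (rule Q.Fubini') simp
  finally show ?thesis .
qed

text \<open>Specialised to \<open>real^'n\<close> because \<open>gaussian\<close> and the
  componentwise conditional expectations live there.\<close>

locale gauss_mixture_vec = gauss_mixture \<nu> s b for \<nu> :: "(real^'n) measure" and s b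
begin

definition pair :: "((real^'n) \<times> (real^'n)) measure" where
  "pair = gaussian 1 \<Otimes>\<^sub>M \<nu>"

definition interp :: "(real^'n) \<times> (real^'n) \<Rightarrow> real^'n" where
  "interp = (\<lambda>(z, y). s *\<^sub>R z + b *\<^sub>R y)"

lemma sets_pair [measurable_cong]: "sets pair = sets (borel \<Otimes>\<^sub>M borel)"
  unfolding pair_def by (intro sets_pair_measure_cong) (simp_all add: sets_eq)

lemma space_pair [simp]: "space pair = UNIV"
  using sets_eq_imp_space_eq[OF sets_pair] by (simp add: space_pair_measure)

lemma prob_space_pair: "prob_space pair"
proof -
  interpret G: prob_space "gaussian 1 :: (real^'n) measure" by (rule prob_space_gaussian) simp
  interpret P: pair_prob_space "gaussian 1 :: (real^'n) measure" \<nu> ..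
  show ?thesis unfolding pair_def by (rule P.prob_space_axioms)
qed

lemma interp_measurable [measurable]: "interp \<in> measurable (borel \<Otimes>\<^sub>M borel) borel"
  unfolding interp_def by measurable

lemma subalgebra_pair: "finite_measure_subalgebra pair (vimage_algebra (space pair) interp borel)"
proof -
  interpret P: prob_space pair by (rule prob_space_pair)
  have "interp \<in> measurable pair borel" by simp
  then have "subalgebra pair (vimage_algebra (space pair) interp borel)"
    by (simp add: subalgebra_def measurable_iff_sets)
  then show ?thesis by unfold_locales
qed

definition K :: real where "K = (1 / sqrt (2 * pi * s\<^sup>2)) ^ CARD('n)"

lemma K_pos: "K > 0" using s_pos by (simp add: K_def)

lemma nn_integral_pair:
  fixes F :: "(real^'n) \<times> (real^'n) \<Rightarrow> ennreal"
  assumes [measurable]: "F \<in> borel_measurable (borel \<Otimes>\<^sub>M borel)"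
  shows "(\<integral>\<^sup>+\<omega>. F (interp \<omega>, snd \<omega>) \<partial>pair)
    = ennreal K * (\<integral>\<^sup>+x. (\<integral>\<^sup>+y. F (x, y) * kernel x y \<partial>\<nu>) \<partial>lborel)"
proof -
  have "(\<integral>\<^sup>+\<omega>. F (interp \<omega>, snd \<omega>) \<partial>pair)
      = (\<integral>\<^sup>+x. (\<integral>\<^sup>+y. F (x, y) * gauss_density s (x - b *\<^sub>R y) \<partial>\<nu>) \<partial>lborel)"
    using nn_integral_gaussian_pair[OF assms prob_space_axioms sets_eq s_pos, of b]
    by (simp add: interp_def pair_def case_prod_beta)
  also have "\<dots> = (\<integral>\<^sup>+x. (\<integral>\<^sup>+y. ennreal K * (F (x, y) * kernel x y) \<partial>\<nu>) \<partial>lborel)"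
  proof (intro nn_integral_cong)
    fix x y
    have "gauss_density s (x - b *\<^sub>R y) = K * kernel x y"
      by (simp add: gauss_density_def K_def kernel_def)
    then show "F (x, y) * gauss_density s (x - b *\<^sub>R y) = ennreal K * (F (x, y) * kernel x y)"
      using K_pos by (simp add: ennreal_mult ac_simps less_imp_le)
  qed
  also have "\<dots> = ennreal K * (\<integral>\<^sup>+x. (\<integral>\<^sup>+y. F (x, y) * kernel x y \<partial>\<nu>) \<partial>lborel)"
    by (simp add: nn_integral_cmult)
  finally show ?thesis .
qed

lemma nn_integral_kernel: "(\<integral>\<^sup>+y. kernel x y \<partial>\<nu>) = ennreal (mass x)"
  using integrable_kernel[of "\<lambda>_. 1::real" x]
  by (subst nn_integral_eq_integral) (auto simp: mass_def kint_def less_imp_le)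

lemma mass_measurable [measurable]: "mass \<in> borel_measurable borel"
  unfolding mass_def[abs_def] kint_def by measurable

text \<open>Bayes' formula. Tested on the preimage of a Borel set B, both sides reduce through the
  joint density to the integral of the numerator over B.\<close>

lemma nn_cond_exp_interp:
  fixes F :: "(real^'n) \<times> (real^'n) \<Rightarrow> ennreal"
  assumes [measurable]: "F \<in> borel_measurable (borel \<Otimes>\<^sub>M borel)"
  shows "AE \<omega> in pair. (\<integral>\<^sup>+y. F (interp \<omega>, y) * kernel (interp \<omega>) y \<partial>\<nu>) / ennreal (mass (interp \<omega>))
    = nn_cond_exp pair (vimage_algebra (space pair) interp borel) (\<lambda>\<omega>. F (interp \<omega>, snd \<omega>)) \<omega>"
proof -
  interpret S: finite_measure_subalgebra pair "vimage_algebra (space pair) interp borel"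
    by (rule subalgebra_pair)
  define N where "N x = (\<integral>\<^sup>+y. F (x, y) * kernel x y \<partial>\<nu>)" for x
  have N [measurable]: "N \<in> borel_measurable borel" unfolding N_def by measurable
  let ?V = "vimage_algebra (space pair) interp borel"
  define f where "f \<omega> = F (interp \<omega>, snd \<omega>)" for \<omega>
  define g where "g \<omega> = N (interp \<omega>) / ennreal (mass (interp \<omega>))" for \<omega>
  have f: "f \<in> borel_measurable pair" unfolding f_def by measurable
  have "interp \<in> measurable ?V borel"
    by (rule measurable_vimage_algebra1) simp
  then have g: "g \<in> borel_measurable ?V"
    unfolding g_def by (rule measurable_compose) measurable
  have fg: "(\<integral>\<^sup>+\<omega>\<in>A. f \<omega> \<partial>pair) = (\<integral>\<^sup>+\<omega>\<in>A. g \<omega> \<partial>pair)" if "A \<in> sets ?V" for A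
  proof -
    obtain B where B [measurable]: "B \<in> sets borel" and A: "A = interp -` B"
      using \<open>A \<in> sets ?V\<close> by (auto simp: sets_vimage_algebra2)
    have "(\<integral>\<^sup>+\<omega>\<in>A. f \<omega> \<partial>pair)
        = ennreal K * (\<integral>\<^sup>+x. (\<integral>\<^sup>+y. (F (x, y) * indicator B x) * kernel x y \<partial>\<nu>) \<partial>lborel)"
      using nn_integral_pair[of "\<lambda>(x, y). F (x, y) * indicator B x"]
      by (simp add: A f_def indicator_def vimage_def)
    also have "\<dots> = ennreal K * (\<integral>\<^sup>+x. (\<integral>\<^sup>+y. (N x / ennreal (mass x) * indicator B x) * kernel x y \<partial>\<nu>) \<partial>lborel)"
    proof (rule arg_cong2[where f="(*)", OF refl], rule nn_integral_cong)
      fix x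
      have "(\<integral>\<^sup>+y. N x / ennreal (mass x) * kernel x y \<partial>\<nu>) = N x / ennreal (mass x) * ennreal (mass x)"
        by (simp add: nn_integral_cmult nn_integral_kernel)
      also have "\<dots> = N x"
        using mass_pos[of x] by (simp add: ennreal_divide_times ennreal_times_divide[symmetric] ennreal_divide_self)
      finally show "(\<integral>\<^sup>+y. F (x, y) * indicator B x * kernel x y \<partial>\<nu>)
          = (\<integral>\<^sup>+y. N x / ennreal (mass x) * indicator B x * kernel x y \<partial>\<nu>)"
        by (simp add: indicator_def N_def)
    qed
    also have "\<dots> = (\<integral>\<^sup>+\<omega>\<in>A. g \<omega> \<partial>pair)"
      using nn_integral_pair[of "\<lambda>(x, y). N x / ennreal (mass x) * indicator B x"]
      by (simp add: A g_def indicator_def vimage_def)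
    finally show ?thesis .
  qed
  show ?thesis
    using S.nn_cond_exp_charact[OF fg f g] unfolding f_def g_def N_def by simp
qed

text \<open>\<open>real_cond_exp\<close> is a difference of two conditional expectations of
  nonnegative functions. For an \<open>exp_bounded\<close> integrand both quotients are finite,
  whatever the moments of \<nu>, and their difference is the posterior average.\<close>

lemma enn2real_nn_integral_divide:
  fixes r :: "real^'n \<Rightarrow> real"
  assumes "exp_bounded r"
  shows "enn2real ((\<integral>\<^sup>+y. ennreal (r y) * kernel x y \<partial>\<nu>) / ennreal (mass x))
    - enn2real ((\<integral>\<^sup>+y. ennreal (- r y) * kernel x y \<partial>\<nu>) / ennreal (mass x)) = post r x"
proof -
  have int: "integrable \<nu> (\<lambda>y. kernel x y * r y)"
    using integrable_kernel[OF assms, of x] by simp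
  have e: "enn2real (u / ennreal (mass x)) = enn2real u / mass x" for u
    using mass_pos[of x] by (simp add: divide_ennreal_def enn2real_mult inverse_ennreal divide_inverse)
  have "post r x = (\<integral>y. kernel x y * r y \<partial>\<nu>) / mass x" by (simp add: post_def kint_def divide_inverse_commute)
  also have "(\<integral>y. kernel x y * r y \<partial>\<nu>) = enn2real (\<integral>\<^sup>+y. ennreal (kernel x y * r y) \<partial>\<nu>)
      - enn2real (\<integral>\<^sup>+y. ennreal (- (kernel x y * r y)) \<partial>\<nu>)"
    by (rule real_lebesgue_integral_def[OF int])
  also have "(\<lambda>y. ennreal (kernel x y * r y)) = (\<lambda>y. ennreal (r y) * kernel x y)"
    using less_imp_le[OF kernel_pos] by (auto simp: fun_eq_iff ennreal_mult'' mult.commute)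
  also have "(\<lambda>y. ennreal (- (kernel x y * r y))) = (\<lambda>y. ennreal (- r y) * kernel x y)"
    using less_imp_le[OF kernel_pos] by (auto simp: fun_eq_iff ennreal_mult''[symmetric] mult.commute)
  finally show ?thesis by (simp add: e diff_divide_distrib)
qed

lemma continuous_post: "exp_bounded g \<Longrightarrow> continuous_on UNIV (post g)"
  by (auto intro!: continuous_at_imp_continuous_on has_derivative_continuous[OF post_has_derivative])

text \<open>The interpolant has the everywhere positive Lebesgue density \<open>K * mass x\<close>,
  so the open set on which two versions differ would have positive probability if it were
  nonempty.\<close>

lemma continuous_version_unique:
  assumes "continuous_on UNIV g" "continuous_on UNIV h" "AE \<omega> in pair. g (interp \<omega>) = h (interp \<omega>)"
  shows "g = (h :: real^'n \<Rightarrow> real^'n)"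
proof (rule ccontr)
  assume "g \<noteq> h"
  define S where "S = {x. g x \<noteq> h x}"
  have "open S" unfolding S_def using assms(1,2)
    by (intro open_Collect_neq) (auto simp: continuous_on_eq_continuous_at)
  then have [measurable]: "S \<in> sets borel" by simp
  have ne: "S \<noteq> {}" using \<open>g \<noteq> h\<close> by (auto simp: S_def fun_eq_iff)
  have "AE \<omega> in pair. indicator S (interp \<omega>) = (0::ennreal)"
    using assms(3) by (auto elim!: eventually_mono simp: S_def)
  then have "(\<integral>\<^sup>+\<omega>. indicator S (interp \<omega>) \<partial>pair) = 0"
    using nn_integral_0_iff_AE[of "\<lambda>\<omega>. indicator S (interp \<omega>)" pair] by simp
  moreover have "(\<integral>\<^sup>+\<omega>. indicator S (interp \<omega>) \<partial>pair) = ennreal K * (\<integral>\<^sup>+x. (\<integral>\<^sup>+y. indicator S x * ennreal (kernel x y) \<partial>\<nu>) \<partial>lborel)"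
    using nn_integral_pair[of "\<lambda>(x, y). indicator S x"] by simp
  moreover have "ennreal K * (\<integral>\<^sup>+x. (\<integral>\<^sup>+y. indicator S x * ennreal (kernel x y) \<partial>\<nu>) \<partial>lborel)
      = ennreal K * (\<integral>\<^sup>+x. indicator S x * ennreal (mass x) \<partial>lborel)"
    by (simp add: nn_integral_cmult nn_integral_kernel)
  ultimately have "(\<integral>\<^sup>+x. indicator S x * ennreal (mass x) \<partial>lborel) = 0"
    using K_pos by simp
  then have "AE x in lborel. indicator S x * ennreal (mass x) = 0"
    using nn_integral_0_iff_AE[of "\<lambda>x. indicator S x * ennreal (mass x)" lborel] by simp
  then have "AE x in lborel. x \<notin> S"
  proof eventually_elim
    case (elim x)
    then show ?case using mass_pos[of x] by (simp add: indicator_def split: if_splits)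
  qed
  then have "emeasure lborel S = 0"
    by (subst (asm) AE_iff_measurable[of S]) auto
  then show False using open_not_negligible[OF \<open>open S\<close> ne]
    by (auto simp: negligible_iff_null_sets intro: null_sets_completionI)
qed

text \<open>Given that the interpolant is at x, the Gaussian component equals (x - b y) / s, so the
  conditioned vector is affine in y and only the posterior mean enters. Uniqueness of the continuous
  version gives the converse implication.\<close>

lemma continuous_cond_exp_iff:
  "continuous_cond_exp pair (\<lambda>(z, y). \<alpha> *\<^sub>R z + \<beta> *\<^sub>R y) interp g
    \<longleftrightarrow> g = (\<lambda>x. (\<alpha> / s) *\<^sub>R x + (\<beta> - \<alpha> * b / s) *\<^sub>R post (\<lambda>y. y) x)"
proof -
  define v where "v = (\<lambda>x. (\<alpha> / s) *\<^sub>R x + (\<beta> - \<alpha> * b / s) *\<^sub>R post (\<lambda>y. y) x)"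
  have cont: "continuous_on UNIV v"
    unfolding v_def by (intro continuous_intros continuous_post) auto
  have AE: "AE \<omega> in pair. v (interp \<omega>) $ i =
      real_cond_exp pair (vimage_algebra (space pair) interp borel) (\<lambda>\<omega>. (case \<omega> of (z, y) \<Rightarrow> \<alpha> *\<^sub>R z + \<beta> *\<^sub>R y) $ i) \<omega>" for i
  proof -
    define r where "r x y = (\<alpha> / s) * (x $ i) + (\<beta> - \<alpha> * b / s) * (axis i 1 \<bullet> y)" for x y :: "real^'n"
    have r: "(case \<omega> of (z, y) \<Rightarrow> \<alpha> *\<^sub>R z + \<beta> *\<^sub>R y) $ i = r (interp \<omega>) (snd \<omega>)" for \<omega>
      using s_pos by (cases \<omega>) (simp add: r_def interp_def inner_axis' field_simps)
    have [measurable]: "(\<lambda>p. r (fst p) (snd p)) \<in> borel_measurable (borel \<Otimes>\<^sub>M borel)"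
      unfolding r_def borel_prod by (intro borel_measurable_continuous_onI continuous_intros)
    have eb: "exp_bounded (r x)" for x unfolding r_def by simp
    have post_r: "post (r x) x = v x $ i" for x
    proof -
      have "post (r x) x = (\<alpha> / s) * (x $ i) + (\<beta> - \<alpha> * b / s) * (axis i 1 \<bullet> post (\<lambda>y. y) x)"
        unfolding r_def by (simp add: post_add post_const post_cmult post_inner)
      then show ?thesis by (simp add: v_def inner_axis')
    qed
    have "AE \<omega> in pair. (\<integral>\<^sup>+y. ennreal (r (interp \<omega>) y) * kernel (interp \<omega>) y \<partial>\<nu>) / ennreal (mass (interp \<omega>))
      = nn_cond_exp pair (vimage_algebra (space pair) interp borel) (\<lambda>\<omega>. ennreal (r (interp \<omega>) (snd \<omega>))) \<omega>"
      using nn_cond_exp_interp[of "\<lambda>p. ennreal (r (fst p) (snd p))"] by simp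
    moreover have "AE \<omega> in pair. (\<integral>\<^sup>+y. ennreal (- r (interp \<omega>) y) * kernel (interp \<omega>) y \<partial>\<nu>) / ennreal (mass (interp \<omega>))
      = nn_cond_exp pair (vimage_algebra (space pair) interp borel) (\<lambda>\<omega>. ennreal (- r (interp \<omega>) (snd \<omega>))) \<omega>"
      using nn_cond_exp_interp[of "\<lambda>p. ennreal (- r (fst p) (snd p))"] by simp
    ultimately show ?thesis
      unfolding r real_cond_exp_def
    proof eventually_elim
      case (elim \<omega>)
      show ?case unfolding elim[symmetric] using enn2real_nn_integral_divide[OF eb, of "interp \<omega>" "interp \<omega>"]
        by (simp add: post_r)
    qed
  qed
  have "continuous_cond_exp pair (\<lambda>(z, y). \<alpha> *\<^sub>R z + \<beta> *\<^sub>R y) interp v"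
    unfolding continuous_cond_exp_def using cont AE by simp
  moreover have "g = v" if "continuous_cond_exp pair (\<lambda>(z, y). \<alpha> *\<^sub>R z + \<beta> *\<^sub>R y) interp g"
  proof (rule continuous_version_unique[OF _ cont])
    show "continuous_on UNIV g" using that by (simp add: continuous_cond_exp_def)
    have "AE \<omega> in pair. g (interp \<omega>) $ i = v (interp \<omega>) $ i" for i
      using AE[of i] that[unfolded continuous_cond_exp_def, THEN conjunct2, rule_format, of i]
      by eventually_elim simp
    then have "AE \<omega> in pair. \<forall>i. g (interp \<omega>) $ i = v (interp \<omega>) $ i"
      by (subst AE_all_countable) auto
    then show "AE \<omega> in pair. g (interp \<omega>) = v (interp \<omega>)"
      by eventually_elim (simp add: vec_eq_iff)
  qed
  ultimately show ?thesis unfolding v_def[symmetric] by blast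
qed

end

section \<open>Second derivatives and midpoint inequalities\<close>

lemma matrix_mat_mult_vec: "(mat c :: real^'n^'n) *v u = c *\<^sub>R u"
proof -
  have "(mat c :: real^'n^'n) = c *\<^sub>R mat 1" by (simp add: mat_def vec_eq_iff)
  then show ?thesis by (simp flip: scaleR_matrix_vector_assoc)
qed

lemma pos_semidef_diff_iff:
  fixes A B :: "real^'n^'n"
  assumes "transpose A = A" "transpose B = B"
  shows "A \<preceq> B \<longleftrightarrow> (\<forall>u. u \<bullet> (A *v u) \<le> u \<bullet> (B *v u))"
  using assms
  by (simp add: loewner_le_def pos_semidef_def transpose_def vec_eq_iff matrix_vector_mult_diff_rdistrib
      inner_diff_right)

lemma transpose_mat [simp]: "transpose (mat c :: real^'n^'n) = mat c"
  by (auto simp: transpose_def mat_def vec_eq_iff)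

lemma symmetric_matrix_inner:
  fixes H :: "real^'n^'n"
  assumes "transpose H = H"
  shows "u \<bullet> (H *v v) = v \<bullet> (H *v u)"
  by (metis assms dot_lmul_matrix inner_commute vector_transpose_matrix)

text \<open>The order \<open>\<preceq>\<close> includes symmetry of the difference, so bounds on
  quadratic forms have to be accompanied by symmetry of the Jacobian.\<close>

lemma jacobian_symmetric:
  fixes f :: "real^'n \<Rightarrow> real^'n"
  assumes D: "(f has_derivative D) (at x)" and sym: "\<And>u v. u \<bullet> D v = v \<bullet> D u"
  shows "jacobian f (at x) *v u = D u" "transpose (jacobian f (at x)) = jacobian f (at x)"
proof -
  have J: "jacobian f (at x) = matrix D"
    by (simp add: jacobian_def frechet_derivative_at[OF D, symmetric])
  have lin: "linear D" using D by (rule has_derivative_linear)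
  show "jacobian f (at x) *v u = D u" by (simp add: J matrix_works lin)
  have "D (axis j 1) $ i = D (axis i 1) $ j" for i j
    using sym[of "axis i 1" "axis j 1"] by (simp add: inner_axis')
  then show "transpose (jacobian f (at x)) = jacobian f (at x)"
    by (simp add: J matrix_def transpose_def vec_eq_iff)
qed

lemma
  fixes f :: "real^'n \<Rightarrow> real^'n"
  assumes D: "(f has_derivative D) (at x)" and sym: "\<And>u v. u \<bullet> D v = v \<bullet> D u"
  shows mat_le_jacobian: "(\<And>u. c * (u \<bullet> u) \<le> u \<bullet> D u) \<Longrightarrow> mat c \<preceq> jacobian f (at x)"
    and jacobian_le_mat: "(\<And>u. u \<bullet> D u \<le> c * (u \<bullet> u)) \<Longrightarrow> jacobian f (at x) \<preceq> mat c"
  by (simp_all add: pos_semidef_diff_iff jacobian_symmetric[OF D sym] matrix_mat_mult_vec)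

text \<open>The symmetrised function \<psi> along the line has \<psi>'(0) = 0. If the asserted bound
  failed, \<psi>' would be negative just to the right of 0, and by the mean value theorem \<psi>
  would drop below \<psi>(0), against the midpoint inequality. This works with a gradient that is
  differentiable at the one point \<open>x\<close>.\<close>

lemma second_derivative_ge_of_midpoint:
  fixes F :: "'a::euclidean_space \<Rightarrow> real"
  assumes F: "\<And>x. (F has_derivative (\<lambda>h. g x \<bullet> h)) (at x)" and g: "(g has_derivative H) (at x)"
    and mid: "\<And>v. 2 * F x \<le> F (x + v) + F (x - v) + c * (v \<bullet> v)"
  shows "- c * (u \<bullet> u) \<le> u \<bullet> H u"
proof (rule ccontr)
  assume neg: "\<not> - c * (u \<bullet> u) \<le> u \<bullet> H u"
  define \<psi> where "\<psi> t = F (x + t *\<^sub>R u) + F (x + (- t) *\<^sub>R u) + c * (t\<^sup>2 * (u \<bullet> u))" for t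
  define \<psi>' where "\<psi>' t = (g (x + t *\<^sub>R u) - g (x + (- t) *\<^sub>R u)) \<bullet> u + 2 * c * t * (u \<bullet> u)" for t
  have line: "((\<lambda>t. F (x + (k * t) *\<^sub>R u)) has_real_derivative k * (g (x + (k * t) *\<^sub>R u) \<bullet> u)) (at t)" for k t
  proof -
    have "((\<lambda>t. x + (k * t) *\<^sub>R u) has_derivative (\<lambda>h. (k * h) *\<^sub>R u)) (at t)"
      by (auto intro!: derivative_eq_intros)
    from has_derivative_compose[OF this F] show ?thesis
      by (rule has_derivative_imp_has_field_derivative) (simp add: mult_ac)
  qed
  have d1: "(\<psi> has_real_derivative \<psi>' t) (at t)" for t
    unfolding \<psi>_def[abs_def] \<psi>'_def
    using line[of 1 t] line[of "-1" t]
    by (auto intro!: derivative_eq_intros simp: inner_diff_left algebra_simps)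
  have lineg: "((\<lambda>t. g (x + (k * t) *\<^sub>R u) \<bullet> u) has_real_derivative k * (H u \<bullet> u)) (at 0)" for k
  proof -
    have 1: "((\<lambda>t. x + (k * t) *\<^sub>R u) has_derivative (\<lambda>h. (k * h) *\<^sub>R u)) (at 0)"
      by (auto intro!: derivative_eq_intros)
    have "(g has_derivative H) (at (x + (k * 0) *\<^sub>R u))" using g by simp
    from has_derivative_inner_left[OF has_derivative_compose[OF 1 this], of u]
    show ?thesis
      by (rule has_derivative_imp_has_field_derivative)
        (simp add: linear_scale[OF has_derivative_linear[OF g]] mult_ac)
  qed
  have "(\<psi>' has_real_derivative (2 * (u \<bullet> H u + c * (u \<bullet> u)))) (at 0)"
    unfolding \<psi>'_def[abs_def] inner_diff_left
    using lineg[of 1] lineg[of "-1"]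
    by (auto intro!: derivative_eq_intros simp: inner_commute algebra_simps)
  moreover have "2 * (u \<bullet> H u + c * (u \<bullet> u)) < 0" using neg by simp
  ultimately obtain d where d: "d > 0" "\<And>h. 0 < h \<Longrightarrow> h < d \<Longrightarrow> \<psi>' h < \<psi>' 0"
    using has_real_derivative_neg_dec_right[of \<psi>' _ 0 UNIV] by auto
  have "\<psi>' 0 = 0" by (simp add: \<psi>'_def)
  obtain \<xi> where \<xi>: "0 < \<xi>" "\<xi> < d / 2" "\<psi> (d / 2) - \<psi> 0 = (d / 2) * \<psi>' \<xi>"
    using MVT2[of 0 "d / 2" \<psi> \<psi>'] d(1) d1 by auto
  have "\<psi>' \<xi> < 0" using d(2)[of \<xi>] \<xi> \<open>\<psi>' 0 = 0\<close> by simp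
  then have "\<psi> (d / 2) < \<psi> 0" using \<xi>(3) d(1) mult_pos_neg[of "d / 2" "\<psi>' \<xi>"] by simp
  moreover have "\<psi> 0 \<le> \<psi> (d / 2)"
    using mid[of "(d / 2) *\<^sub>R u"] by (simp add: \<psi>_def power2_eq_square algebra_simps)
  ultimately show False by simp
qed

lemma second_derivative_le_of_midpoint:
  fixes F :: "'a::euclidean_space \<Rightarrow> real"
  assumes F: "\<And>x. (F has_derivative (\<lambda>h. g x \<bullet> h)) (at x)" and g: "(g has_derivative H) (at x)"
    and mid: "\<And>v. F (x + v) + F (x - v) + c * (v \<bullet> v) \<le> 2 * F x"
  shows "u \<bullet> H u \<le> - c * (u \<bullet> u)"
proof -
  have "- (- c) * (u \<bullet> u) \<le> u \<bullet> (- H u)"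
  proof (rule second_derivative_ge_of_midpoint[where F="\<lambda>x. - F x" and g="\<lambda>x. - g x"])
    show "((\<lambda>x. - F x) has_derivative (\<lambda>h. - g x \<bullet> h)) (at x)" for x
      using has_derivative_minus[OF F] by simp
    show "((\<lambda>x. - g x) has_derivative (\<lambda>x. - H x)) (at x)"
      by (rule has_derivative_minus[OF g])
    show "2 * - F x \<le> - F (x + v) + - F (x - v) + - c * (v \<bullet> v)" for v
      using mid[of v] by simp
  qed
  then show ?thesis by simp
qed

text \<open>After adding c/2 times the squared distance the function is convex along each line,
  hence lies above its tangent.\<close>

lemma gradient_inequality_semiconvex:
  fixes F :: "'a::euclidean_space \<Rightarrow> real"
  assumes F: "\<And>x. (F has_derivative (\<lambda>h. g x \<bullet> h)) (at x)" and g: "\<And>x. (g has_derivative H x) (at x)"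
    and H: "\<And>x u. - c * (u \<bullet> u) \<le> u \<bullet> H x u"
  shows "g x \<bullet> d - c / 2 * (d \<bullet> d) \<le> F (x + d) - F x"
proof -
  define \<phi> where "\<phi> t = F (x + t *\<^sub>R d) + c / 2 * (t\<^sup>2 * (d \<bullet> d)) - t * (g x \<bullet> d)" for t
  define \<phi>' where "\<phi>' t = g (x + t *\<^sub>R d) \<bullet> d + c * t * (d \<bullet> d) - g x \<bullet> d" for t
  have l: "((\<lambda>t. x + t *\<^sub>R d) has_derivative (\<lambda>h. h *\<^sub>R d)) (at t)" for t
    by (auto intro!: derivative_eq_intros)
  have "((\<lambda>t. F (x + t *\<^sub>R d)) has_real_derivative (g (x + t *\<^sub>R d) \<bullet> d)) (at t)" for t
    by (rule has_derivative_imp_has_field_derivative[OF has_derivative_compose[OF l F]]) simp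
  then have d1: "(\<phi> has_real_derivative \<phi>' t) (at t)" for t
    unfolding \<phi>_def[abs_def] \<phi>'_def
    by (auto intro!: derivative_eq_intros simp: algebra_simps)
  have "((\<lambda>t. g (x + t *\<^sub>R d) \<bullet> d) has_real_derivative (d \<bullet> H (x + t *\<^sub>R d) d)) (at t)" for t
    by (rule has_derivative_imp_has_field_derivative[OF has_derivative_inner_left[OF has_derivative_compose[OF l g]]])
      (simp add: linear_scale[OF has_derivative_linear[OF g]] inner_commute)
  then have d2: "(\<phi>' has_real_derivative (d \<bullet> H (x + t *\<^sub>R d) d + c * (d \<bullet> d))) (at t)" for t
    unfolding \<phi>'_def[abs_def] by (auto intro!: derivative_eq_intros)
  have nn: "0 \<le> d \<bullet> H (x + t *\<^sub>R d) d + c * (d \<bullet> d)" for t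
    using H[of d "x + t *\<^sub>R d"] by (simp add: add.commute)
  have "\<phi>' 0 \<le> \<phi>' t" if "0 \<le> t" for t
    using d2 nn by (intro DERIV_nonneg_imp_nondecreasing[OF that]) blast
  then have nn': "0 \<le> \<phi>' t" if "0 \<le> t" for t using that by (simp add: \<phi>'_def)
  have "\<phi> 0 \<le> \<phi> 1"
  proof (rule DERIV_nonneg_imp_nondecreasing[of 0 1 \<phi>])
    show "\<exists>y. (\<phi> has_real_derivative y) (at t) \<and> 0 \<le> y" if "0 \<le> t" "t \<le> 1" for t
      using d1[of t] nn'[OF that(1)] by blast
  qed simp
  then show ?thesis by (simp add: \<phi>_def)
qed

lemma has_derivative_directional_bound:
  assumes "(f has_derivative (\<lambda>h. G \<bullet> h)) (at x)" and "0 < r" "0 < e"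
  shows "\<exists>h>0. h < r \<and> f (x + h *\<^sub>R d) - f x < h * (G \<bullet> d + e)"
proof -
  have "((\<lambda>t. x + t *\<^sub>R d) has_derivative (\<lambda>h. h *\<^sub>R d)) (at 0)"
    by (auto intro!: derivative_eq_intros)
  moreover have "(f has_derivative (\<lambda>h. G \<bullet> h)) (at (x + 0 *\<^sub>R d))" using assms by simp
  ultimately have "((\<lambda>t. f (x + t *\<^sub>R d)) has_derivative (\<lambda>h. G \<bullet> (h *\<^sub>R d))) (at 0)"
    by (rule has_derivative_compose)
  then have "((\<lambda>t. f (x + t *\<^sub>R d)) has_real_derivative (G \<bullet> d)) (at 0)"
    by (rule has_derivative_imp_has_field_derivative) simp
  then have "((\<lambda>t. f (x + t *\<^sub>R d) - t * (G \<bullet> d + e)) has_real_derivative (- e)) (at 0)"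
    by (auto intro!: derivative_eq_intros)
  then obtain k where k: "k > 0" "\<And>h. 0 < h \<Longrightarrow> h < k \<Longrightarrow> f (x + h *\<^sub>R d) - h * (G \<bullet> d + e) < f x"
    using has_real_derivative_neg_dec_right[of "\<lambda>t. f (x + t *\<^sub>R d) - t * (G \<bullet> d + e)" "- e" 0 UNIV] \<open>0 < e\<close>
    by auto
  show ?thesis
    using k(1) k(2)[of "min k r / 2"] \<open>0 < r\<close> by (intro exI[of _ "min k r / 2"]) (auto simp: min_def)
qed

text \<open>Pointwise convergence of convex functions forces convergence of their gradients where
  the limit is differentiable; this is the semiconvex form. The tangent inequality bounds
  \<open>g t \<bullet> d\<close> by a difference quotient with a fixed step, and that quotient
  converges. Only differences of \<open>F t\<close> occur, so additive constants depending on t are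
  harmless.\<close>

lemma tendsto_gradient_semiconvex:
  fixes F :: "'t \<Rightarrow> 'a::euclidean_space \<Rightarrow> real"
  assumes ineq: "\<forall>\<^sub>F t in T. \<forall>d. g t \<bullet> d - C * (d \<bullet> d) \<le> F t (x + d) - F t x"
    and "0 < r" and lim: "\<And>y. dist y x < r \<Longrightarrow> ((\<lambda>t. F t y - F t x) \<longlongrightarrow> \<phi> y - \<phi> x) T"
    and \<phi>: "(\<phi> has_derivative (\<lambda>h. G \<bullet> h)) (at x)"
  shows "(g \<longlongrightarrow> G) T"
proof -
  have upper: "\<forall>\<^sub>F t in T. g t \<bullet> d < G \<bullet> d + e" if "0 < e" and d: "norm d = 1" for d e
  proof -
    \<comment> \<open>The step has to stay in the ball of convergence and be so short that the
      semiconvexity error \<open>C * h\<close> is below \<open>e / 3\<close>. The other two thirds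
      of \<open>e\<close> pay for the difference quotient of \<phi> and for the convergence.\<close>
    define R where "R = min r (e / (3 * (\<bar>C\<bar> + 1)))"
    have "R > 0" using \<open>0 < r\<close> \<open>0 < e\<close> by (simp add: R_def)
    then obtain h where h: "0 < h" "h < R" "\<phi> (x + h *\<^sub>R d) - \<phi> x < h * (G \<bullet> d + e / 3)"
      using has_derivative_directional_bound[OF \<phi>, of R "e/3" d] \<open>0 < e\<close> by auto
    have "h * (3 * (\<bar>C\<bar> + 1)) < e"
      using h(2) by (simp add: R_def field_simps)
    moreover have "C * h \<le> (\<bar>C\<bar> + 1) * h" using h(1) by (intro mult_right_mono) auto
    ultimately have Ch: "C * h < e / 3" by (simp add: algebra_simps)
    have "dist (x + h *\<^sub>R d) x < r" using h d by (simp add: dist_norm R_def)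
    then have "\<forall>\<^sub>F t in T. F t (x + h *\<^sub>R d) - F t x < \<phi> (x + h *\<^sub>R d) - \<phi> x + h * (e / 3)"
      using lim h(1) \<open>0 < e\<close> by (intro order_tendstoD) auto
    with ineq show ?thesis
    proof eventually_elim
      case (elim t)
      have "h * (g t \<bullet> d) - C * (h * h) \<le> F t (x + h *\<^sub>R d) - F t x"
        using elim(1)[rule_format, of "h *\<^sub>R d"] d by (simp add: norm_eq_1)
      then have "h * (g t \<bullet> d) < h * (G \<bullet> d + e / 3) + h * (e / 3) + h * (C * h)"
        using elim(2) h(3) by (simp add: mult_ac)
      then have "h * (g t \<bullet> d) < h * (G \<bullet> d + e / 3 + e / 3 + C * h)" by (simp add: algebra_simps)
      then show ?case using h(1) Ch by simp
    qed
  qed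
  have "((\<lambda>t. g t \<bullet> i) \<longlongrightarrow> G \<bullet> i) T" if i: "i \<in> Basis" for i
  proof (rule tendstoI)
    fix e :: real assume e: "0 < e"
    \<comment> \<open>Upper bounds in the opposite directions \<open>i\<close> and
      \<open>- i\<close> together give two-sided control.\<close>
    have "\<forall>\<^sub>F t in T. g t \<bullet> (- i) < G \<bullet> (- i) + e" "\<forall>\<^sub>F t in T. g t \<bullet> i < G \<bullet> i + e"
      using e i upper[of e "- i"] upper[of e i] by (auto simp del: inner_minus_right)
    then show "\<forall>\<^sub>F t in T. dist (g t \<bullet> i) (G \<bullet> i) < e"
      by eventually_elim (auto simp: dist_real_def)
  qed
  then show ?thesis by (subst tendsto_componentwise_iff) auto
qed

text \<open>Derivatives are taken within the closed interval because a segment in \<Omega> may end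
  on the boundary. The mean value theorem is applied to \<phi> on each half and then to \<phi>'
  between the two intermediate points.\<close>

lemma midpoint_le_of_second_derivative:
  fixes \<phi> :: "real \<Rightarrow> real"
  assumes 1: "\<And>t. t \<in> {0..1} \<Longrightarrow> (\<phi> has_real_derivative \<phi>' t) (at t within {0..1})"
    and 2: "\<And>t. t \<in> {0..1} \<Longrightarrow> (\<phi>' has_real_derivative \<phi>'' t) (at t within {0..1})"
    and nn: "\<And>t. t \<in> {0..1} \<Longrightarrow> 0 \<le> \<phi>'' t"
  shows "2 * \<phi> (1/2) \<le> \<phi> 0 + \<phi> 1"
proof -
  have at: "at t within {0..1} = at t" if "0 < t" "t < 1" for t :: real
    using that by (intro at_within_interior) auto
  have cont: "continuous_on {0..1} \<phi>" "continuous_on {0..1} \<phi>'"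
    unfolding continuous_on_eq_continuous_within using DERIV_continuous[OF 1] DERIV_continuous[OF 2] by auto
  have "\<exists>\<xi>. a < \<xi> \<and> \<xi> < b \<and> f b - f a = (b - a) * f' \<xi>"
    if "0 \<le> a" "a < b" "b \<le> 1" "continuous_on {0..1} f"
      and "\<And>t. t \<in> {0..1} \<Longrightarrow> (f has_real_derivative f' t) (at t within {0..1})" for a b f f'
  proof -
    have "continuous_on {a..b} f" using that by (auto elim: continuous_on_subset)
    moreover have "(f has_derivative (\<lambda>h. f' t * h)) (at t)" if "a < t" "t < b" for t
    proof -
      have "(f has_real_derivative f' t) (at t within {0..1})" using that \<open>0 \<le> a\<close> \<open>b \<le> 1\<close>
        by (intro \<open>\<And>t. t \<in> {0..1} \<Longrightarrow> (f has_real_derivative f' t) (at t within {0..1})\<close>) auto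
      then show ?thesis using that \<open>0 \<le> a\<close> \<open>b \<le> 1\<close> by (simp add: at has_field_derivative_def)
    qed
    ultimately show ?thesis
      using mvt[OF \<open>a < b\<close>, of f "\<lambda>t h. f' t * h"] by (metis mult.commute)
  qed note MV = this
  obtain s t where s: "0 < s" "s < 1/2" "\<phi> (1/2) - \<phi> 0 = (1/2) * \<phi>' s"
    and t: "1/2 < t" "t < 1" "\<phi> 1 - \<phi> (1/2) = (1/2) * \<phi>' t"
    using MV[of 0 "1/2" \<phi> \<phi>'] MV[of "1/2" 1 \<phi> \<phi>'] cont 1 by auto
  obtain r where r: "s < r" "r < t" "\<phi>' t - \<phi>' s = (t - s) * \<phi>'' r"
    using MV[of s t \<phi>' \<phi>''] cont 2 s t by auto
  have "0 \<le> \<phi>'' r" using nn[of r] r s t by auto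
  moreover have "0 \<le> t - s" using r by simp
  ultimately have "0 \<le> (t - s) * \<phi>'' r" by (intro mult_nonneg_nonneg)
  then have "\<phi>' s \<le> \<phi>' t" using r(3) by linarith
  then show ?thesis using s t by simp
qed

lemma midpoint_le_of_hessian_ge:
  fixes U :: "real^'n \<Rightarrow> real"
  assumes "convex \<Omega>" and C2: "C2_with_hessian \<Omega> U H"
    and H: "\<And>x u. x \<in> \<Omega> \<Longrightarrow> c * (u \<bullet> u) \<le> u \<bullet> (H x *v u)"
    and xw: "m + w \<in> \<Omega>" "m - w \<in> \<Omega>"
  shows "2 * U m + c * (w \<bullet> w) \<le> U (m + w) + U (m - w)"
proof -
  obtain G where G: "\<And>x. x \<in> \<Omega> \<Longrightarrow> (U has_derivative (\<lambda>h. G x \<bullet> h)) (at x within \<Omega>)"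
    "\<And>x. x \<in> \<Omega> \<Longrightarrow> (G has_derivative (\<lambda>h. H x *v h)) (at x within \<Omega>)"
    using C2 unfolding C2_with_hessian_def by blast
  \<comment> \<open>The whole segment from \<open>m - w\<close> to \<open>m + w\<close> is run
    through in unit time, so the quadratic correction contributes c/4 |d|^2 = c |w|^2.\<close>
  define d where "d = 2 *\<^sub>R w"
  define \<gamma> where "\<gamma> t = m - w + t *\<^sub>R d" for t
  have \<gamma>: "\<gamma> t \<in> \<Omega>" if "t \<in> {0..1}" for t
  proof -
    have "\<gamma> t = (1 - t) *\<^sub>R (m - w) + t *\<^sub>R (m + w)"
      by (simp add: \<gamma>_def d_def algebra_simps flip: scaleR_add_left)
    then show ?thesis using convexD_alt[OF \<open>convex \<Omega>\<close> xw(2,1)] that by simp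
  qed
  have d\<gamma>: "(\<gamma> has_derivative (\<lambda>h. h *\<^sub>R d)) (at t within {0..1})" for t
    unfolding \<gamma>_def[abs_def] by (auto intro!: derivative_eq_intros)
  define \<phi> where "\<phi> t = U (\<gamma> t) - c / 2 * (t\<^sup>2 * (d \<bullet> d))" for t
  have 1: "(\<phi> has_real_derivative G (\<gamma> t) \<bullet> d - c * t * (d \<bullet> d)) (at t within {0..1})"
    if "t \<in> {0..1}" for t
  proof -
    have "((\<lambda>t. U (\<gamma> t)) has_derivative (\<lambda>h. G (\<gamma> t) \<bullet> (h *\<^sub>R d))) (at t within {0..1})"
      using \<gamma> that by (intro has_derivative_in_compose2[OF G(1) _ _ d\<gamma>]) auto
    then have "((\<lambda>t. U (\<gamma> t)) has_real_derivative G (\<gamma> t) \<bullet> d) (at t within {0..1})"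
      by (rule has_derivative_imp_has_field_derivative) simp
    then show ?thesis unfolding \<phi>_def[abs_def]
      by (auto intro!: derivative_eq_intros simp: algebra_simps)
  qed
  have 2: "((\<lambda>t. G (\<gamma> t) \<bullet> d - c * t * (d \<bullet> d)) has_real_derivative
      d \<bullet> (H (\<gamma> t) *v d) - c * (d \<bullet> d)) (at t within {0..1})"
    if "t \<in> {0..1}" for t
  proof -
    have "((\<lambda>t. G (\<gamma> t)) has_derivative (\<lambda>h. H (\<gamma> t) *v (h *\<^sub>R d))) (at t within {0..1})"
      using \<gamma> that by (intro has_derivative_in_compose2[OF G(2) _ _ d\<gamma>]) auto
    from has_derivative_inner_left[OF this, of d]
    have "((\<lambda>t. G (\<gamma> t) \<bullet> d) has_real_derivative d \<bullet> (H (\<gamma> t) *v d)) (at t within {0..1})"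
      by (rule has_derivative_imp_has_field_derivative) (simp add: inner_commute matrix_vector_mult_scaleR)
    then show ?thesis by (auto intro!: derivative_eq_intros)
  qed
  have "2 * \<phi> (1/2) \<le> \<phi> 0 + \<phi> 1"
    using H \<gamma> by (intro midpoint_le_of_second_derivative[OF 1 2]) auto
  moreover have "\<gamma> (1/2) = m" "\<gamma> 0 = m - w" "\<gamma> 1 = m + w"
    by (simp_all add: \<gamma>_def d_def scaleR_2)
  ultimately show ?thesis
    by (simp add: \<phi>_def d_def power2_eq_square)
qed

section \<open>Log-concave and log-convex mixing densities\<close>

context gauss_mixture
begin

lemma norm_shift_identity:
  fixes x v m w :: 'a
  shows "(norm (x + v - b *\<^sub>R (m + w)))\<^sup>2 + (norm (x - v - b *\<^sub>R (m - w)))\<^sup>2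
    = 2 * (norm (x - b *\<^sub>R m))\<^sup>2 + 2 * (norm (v - b *\<^sub>R w))\<^sup>2"
  by (simp only: power2_norm_eq_inner)
    (simp add: inner_diff_left inner_diff_right inner_add_left inner_add_right inner_commute algebra_simps)

text \<open>By the parallelogram law, the product at two symmetric points is the squared kernel at
  the midpoint times a defect that depends only on v and w.\<close>

lemma kernel_shift:
  "kernel (x + v) (m + w) * kernel (x - v) (m - w)
    = (kernel x m)\<^sup>2 * exp (- (norm (v - b *\<^sub>R w))\<^sup>2 / s\<^sup>2)"
proof -
  have "- (norm (x + v - b *\<^sub>R (m + w)))\<^sup>2 / (2 * s\<^sup>2) + - (norm (x - v - b *\<^sub>R (m - w)))\<^sup>2 / (2 * s\<^sup>2)
      = - ((norm (x + v - b *\<^sub>R (m + w)))\<^sup>2 + (norm (x - v - b *\<^sub>R (m - w)))\<^sup>2) / (2 * s\<^sup>2)"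
    by (simp add: add_divide_distrib diff_divide_distrib)
  also have "\<dots> = 2 * (- (norm (x - b *\<^sub>R m))\<^sup>2 / (2 * s\<^sup>2)) + - (norm (v - b *\<^sub>R w))\<^sup>2 / s\<^sup>2"
    unfolding norm_shift_identity using s_pos by (simp add: field_simps)
  finally show ?thesis
    unfolding kernel_def by (simp only: exp_add[symmetric] power2_eq_square mult_2)
qed

text \<open>Minimisation over w: if \<kappa> s^2 + b^2 is positive, the last square is nonnegative
  and vanishes at w = b v / (\<kappa> s^2 + b^2), so the first term is the minimum. With \<kappa> =
  1 / \<sigma>^2 the identity also factorises a product of two Gaussians.\<close>

lemma complete_square:
  fixes v w :: 'a
  assumes "\<kappa> * s\<^sup>2 + b\<^sup>2 \<noteq> 0"
  shows "(norm (v - b *\<^sub>R w))\<^sup>2 / s\<^sup>2 + \<kappa> * (norm w)\<^sup>2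
    = \<kappa> / (\<kappa> * s\<^sup>2 + b\<^sup>2) * (norm v)\<^sup>2
      + (\<kappa> * s\<^sup>2 + b\<^sup>2) / s\<^sup>2 * (norm (w - (b / (\<kappa> * s\<^sup>2 + b\<^sup>2)) *\<^sub>R v))\<^sup>2"
proof -
  define q where "q = \<kappa> * s\<^sup>2 + b\<^sup>2"
  have \<kappa>: "\<kappa> = (q - b\<^sup>2) / s\<^sup>2" using s_pos by (simp add: q_def)
  have q: "q \<noteq> 0" using assms by (simp add: q_def)
  have s: "s\<^sup>2 \<noteq> 0" using s_pos by simp
  define V W P where "V = v \<bullet> v" "W = w \<bullet> w" "P = v \<bullet> w"
  have 1: "(norm (v - b *\<^sub>R w))\<^sup>2 = V - 2 * b * P + b\<^sup>2 * W"
    by (simp only: power2_norm_eq_inner)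
      (simp add: V_W_P_def inner_commute algebra_simps power2_eq_square)
  have 2: "(norm (w - (b / q) *\<^sub>R v))\<^sup>2 = W - 2 * (b / q) * P + (b / q)\<^sup>2 * V"
    by (simp only: power2_norm_eq_inner)
      (simp add: V_W_P_def inner_commute algebra_simps power2_eq_square)
  have "((V - 2 * b * P + b\<^sup>2 * W) / s\<^sup>2 + \<kappa> * W)
      = \<kappa> / q * V + q / s\<^sup>2 * (W - 2 * (b / q) * P + (b / q)\<^sup>2 * V)"
    unfolding \<kappa> using q s by (simp add: field_simps power2_eq_square)
  then show ?thesis
    unfolding q_def[symmetric] 1 2 by (simp add: V_W_P_def power2_norm_eq_inner)
qed

end

lemma power2_le_mult_ennreal:
  fixes A B C :: real
  assumes "ennreal A * ennreal B \<le> (ennreal C)\<^sup>2" "0 \<le> A" "0 \<le> B" "0 \<le> C"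
  shows "A * B \<le> C\<^sup>2"
  using assms by (simp add: ennreal_mult[symmetric] ennreal_power)

locale density_mixture = gauss_mixture_vec \<nu> s b for \<nu> :: "(real^'n) measure" and s b +
  fixes p :: "real^'n \<Rightarrow> real"
  assumes p_meas [measurable]: "p \<in> borel_measurable borel" and p_nonneg: "0 \<le> p x"
    and nu_eq: "\<nu> = density lborel (\<lambda>x. ennreal (p x))"
begin

lemma nn_integral_kernel_density: "(\<integral>\<^sup>+y. ennreal (kernel x y * p y) \<partial>lborel) = ennreal (mass x)"
proof -
  have "ennreal (mass x) = (\<integral>\<^sup>+y. ennreal (p y) * ennreal (kernel x y) \<partial>lborel)"
    unfolding nn_integral_kernel[symmetric] by (subst nu_eq, subst nn_integral_density) auto
  then show ?thesis by (simp add: ennreal_mult p_nonneg less_imp_le mult.commute)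
qed

text \<open>Prekopa-Leindler applied to the integrands of the mass at \<open>x + v\<close>,
  \<open>x - v\<close> and \<open>x\<close>. Its pointwise hypothesis combines
  \<open>kernel_shift\<close> with the midpoint inequality for \<open>p\<close>.\<close>

lemma mass_midpoint_log_concave:
  assumes q: "0 < \<kappa> * s\<^sup>2 + b\<^sup>2"
    and p: "\<And>m w. p (m + w) * p (m - w) * exp (\<kappa> * (norm w)\<^sup>2) \<le> (p m)\<^sup>2"
  shows "mass (x + v) * mass (x - v) * exp (\<kappa> / (\<kappa> * s\<^sup>2 + b\<^sup>2) * (norm v)\<^sup>2) \<le> (mass x)\<^sup>2"
proof -
  define c where "c = \<kappa> / (\<kappa> * s\<^sup>2 + b\<^sup>2) * (norm v)\<^sup>2"
  have pt: "(exp c * (kernel (x + v) y * p y)) * (kernel (x - v) z * p z)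
      \<le> (kernel x ((1/2) *\<^sub>R (y + z)) * p ((1/2) *\<^sub>R (y + z)))\<^sup>2" for y z
  proof -
    define m w where "m = (1/2) *\<^sub>R (y + z)" and "w = (1/2) *\<^sub>R (y - z)"
    have yz: "y = m + w" "z = m - w"
      by (simp_all add: m_def w_def algebra_simps flip: scaleR_add_left)
    \<comment> \<open>This is where the minimisation over w enters: the points y and z are
      arbitrary, so the bound must hold for every w.\<close>
    have "c \<le> (norm (v - b *\<^sub>R w))\<^sup>2 / s\<^sup>2 + \<kappa> * (norm w)\<^sup>2"
      using q s_pos by (subst complete_square) (auto simp: c_def)
    then have "exp c * exp (- (norm (v - b *\<^sub>R w))\<^sup>2 / s\<^sup>2) \<le> exp (\<kappa> * (norm w)\<^sup>2)"
      by (simp flip: exp_add)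
    then have "(kernel x m)\<^sup>2 * (p y * p z) * (exp c * exp (- (norm (v - b *\<^sub>R w))\<^sup>2 / s\<^sup>2))
        \<le> (kernel x m)\<^sup>2 * (p y * p z) * exp (\<kappa> * (norm w)\<^sup>2)"
      by (intro mult_left_mono mult_nonneg_nonneg p_nonneg) auto
    also have "\<dots> \<le> (kernel x m)\<^sup>2 * (p m)\<^sup>2"
      using mult_left_mono[OF p[of m w], of "(kernel x m)\<^sup>2"] by (simp add: yz mult_ac)
    finally have "(p y * p z) * exp c * ((kernel x m)\<^sup>2 * exp (- (norm (v - b *\<^sub>R w))\<^sup>2 / s\<^sup>2))
        \<le> (kernel x m * p m)\<^sup>2"
      by (simp add: power_mult_distrib mult_ac)
    then show ?thesis
      unfolding kernel_shift[symmetric] yz[symmetric] by (simp add: m_def mult_ac)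
  qed
  have "(\<integral>\<^sup>+y. ennreal (exp c * (kernel (x + v) y * p y)) \<partial>lborel) * (\<integral>\<^sup>+y. ennreal (kernel (x - v) y * p y) \<partial>lborel)
      \<le> (\<integral>\<^sup>+y. ennreal (kernel x y * p y) \<partial>lborel)\<^sup>2"
  \<comment> \<open>The constant gain \<open>exp c\<close> is absorbed into the first of the three
    functions.\<close>
  proof (rule prekopa_leindler)
    show "ennreal (exp c * (kernel (x + v) y * p y)) * ennreal (kernel (x - v) z * p z)
        \<le> (ennreal (kernel x ((1/2) *\<^sub>R (y + z)) * p ((1/2) *\<^sub>R (y + z))))\<^sup>2" for y z
    proof -
      have "ennreal ((exp c * (kernel (x + v) y * p y)) * (kernel (x - v) z * p z))
        \<le> ennreal ((kernel x ((1/2) *\<^sub>R (y + z)) * p ((1/2) *\<^sub>R (y + z)))\<^sup>2)"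
        by (rule ennreal_leI[OF pt])
      then show ?thesis
        by (subst ennreal_mult[symmetric], simp_all add: p_nonneg less_imp_le,
            subst ennreal_power) (simp_all add: p_nonneg less_imp_le)
    qed
  qed auto
  moreover have "(\<integral>\<^sup>+y. ennreal (exp c * (kernel (x + v) y * p y)) \<partial>lborel) = ennreal (exp c * mass (x + v))"
  proof -
    have "(\<integral>\<^sup>+y. ennreal (exp c * (kernel (x + v) y * p y)) \<partial>lborel)
        = (\<integral>\<^sup>+y. ennreal (exp c) * ennreal (kernel (x + v) y * p y) \<partial>lborel)"
      by (intro nn_integral_cong ennreal_mult') simp
    also have "\<dots> = ennreal (exp c) * ennreal (mass (x + v))"
      by (subst nn_integral_cmult) (auto simp: nn_integral_kernel_density)
    finally show ?thesis by (simp add: ennreal_mult')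
  qed
  ultimately have "(exp c * mass (x + v)) * mass (x - v) \<le> (mass x)\<^sup>2"
    unfolding nn_integral_kernel_density using mass_pos
    by (intro power2_le_mult_ennreal) (auto simp: less_imp_le)
  then show ?thesis by (simp add: c_def mult_ac)
qed

text \<open>
  The shift w below is the minimiser of the exponent in v and w, which makes the
  Cauchy-Schwarz inequality lossless.
\<close>

lemma mass_midpoint_log_convex:
  assumes q: "0 < \<beta> * s\<^sup>2 + b\<^sup>2"
    and p: "\<And>m w. (p m)\<^sup>2 \<le> p (m + w) * p (m - w) * exp (\<beta> * (norm w)\<^sup>2)"
  shows "(mass x)\<^sup>2 \<le> mass (x + v) * mass (x - v) * exp (\<beta> / (\<beta> * s\<^sup>2 + b\<^sup>2) * (norm v)\<^sup>2)"
proof -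
  define c where "c = \<beta> / (\<beta> * s\<^sup>2 + b\<^sup>2) * (norm v)\<^sup>2"
  define w where "w = (b / (\<beta> * s\<^sup>2 + b\<^sup>2)) *\<^sub>R v"
  \<comment> \<open>Translating the two integrands by w and -w leaves their integrals unchanged, and
    makes the integrand at \<open>x\<close> at most exp(c/2) times the geometric mean of the
    translates.\<close>
  define A B where "A y = kernel (x + v) (y + w) * p (y + w)" and "B y = kernel (x - v) (y - w) * p (y - w)" for y
  have [measurable]: "A \<in> borel_measurable borel" "B \<in> borel_measurable borel"
    unfolding A_def B_def by measurable
  have nn: "0 \<le> A y" "0 \<le> B y" for y by (simp_all add: A_def B_def p_nonneg less_imp_le)
  have c: "c = (norm (v - b *\<^sub>R w))\<^sup>2 / s\<^sup>2 + \<beta> * (norm w)\<^sup>2"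
    using q by (subst complete_square) (auto simp: c_def w_def)
  have pt: "kernel x y * p y \<le> exp (c / 2) * (sqrt (A y) * sqrt (B y))" for y
  proof -
    have "(kernel x y * p y)\<^sup>2 \<le> (kernel x y)\<^sup>2 * (p (y + w) * p (y - w) * exp (\<beta> * (norm w)\<^sup>2))"
      using mult_left_mono[OF p[of y w], of "(kernel x y)\<^sup>2"] by (simp add: power_mult_distrib)
    also have "\<dots> = ((kernel x y)\<^sup>2 * exp (- (norm (v - b *\<^sub>R w))\<^sup>2 / s\<^sup>2)) * (p (y + w) * p (y - w)) * exp c"
      by (simp add: c exp_add exp_minus mult_ac flip: exp_minus_inverse)
    also have "\<dots> = A y * B y * exp c"
      unfolding kernel_shift[symmetric] by (simp add: A_def B_def)
    also have "\<dots> = (exp (c / 2) * (sqrt (A y) * sqrt (B y)))\<^sup>2"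
      using nn by (simp add: power_mult_distrib exp_double[symmetric] mult_ac)
    finally show ?thesis
      by (rule power2_le_imp_le) (simp add: nn)
  qed
  have tr: "(\<integral>\<^sup>+y. ennreal (A y) \<partial>lborel) = ennreal (mass (x + v))"
    "(\<integral>\<^sup>+y. ennreal (B y) \<partial>lborel) = ennreal (mass (x - v))"
    using nn_integral_lborel_translate[of "\<lambda>y. ennreal (kernel (x + v) y * p y)" w]
      nn_integral_lborel_translate[of "\<lambda>y. ennreal (kernel (x - v) y * p y)" "- w"]
    by (simp_all add: A_def B_def nn_integral_kernel_density)
  have "ennreal (mass x) \<le> (\<integral>\<^sup>+y. ennreal (exp (c / 2)) * (ennreal (sqrt (A y)) * ennreal (sqrt (B y))) \<partial>lborel)"
    unfolding nn_integral_kernel_density[symmetric] using pt nn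
    by (intro nn_integral_mono) (simp add: ennreal_mult[symmetric] ennreal_leI)
  also have "\<dots> = ennreal (exp (c / 2)) * (\<integral>\<^sup>+y. ennreal (sqrt (A y)) * ennreal (sqrt (B y)) \<partial>lborel)"
    by (rule nn_integral_cmult) simp
  finally have "(ennreal (mass x))\<^sup>2 \<le> (ennreal (exp (c / 2)))\<^sup>2 * (\<integral>\<^sup>+y. ennreal (sqrt (A y)) * ennreal (sqrt (B y)) \<partial>lborel)\<^sup>2"
    unfolding power_mult_distrib[symmetric] by (rule power_mono) simp
  also have "\<dots> \<le> (ennreal (exp (c / 2)))\<^sup>2 * ((\<integral>\<^sup>+y. (ennreal (sqrt (A y)))\<^sup>2 \<partial>lborel) * (\<integral>\<^sup>+y. (ennreal (sqrt (B y)))\<^sup>2 \<partial>lborel))"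
    by (intro mult_left_mono Cauchy_Schwarz_nn_integral) auto
  also have "\<dots> = (ennreal (exp (c / 2)))\<^sup>2 * (ennreal (mass (x + v)) * ennreal (mass (x - v)))"
    using nn by (simp add: ennreal_power tr)
  also have "\<dots> = ennreal (exp c * (mass (x + v) * mass (x - v)))"
    using mass_pos by (simp add: ennreal_power ennreal_mult less_imp_le exp_double[symmetric])
  finally have "ennreal ((mass x)\<^sup>2) \<le> ennreal (exp c * (mass (x + v) * mass (x - v)))"
    using mass_pos by (simp add: ennreal_power less_imp_le)
  then have "(mass x)\<^sup>2 \<le> exp c * (mass (x + v) * mass (x - v))"
    using mass_pos by (subst (asm) ennreal_le_iff) (auto simp: less_imp_le)
  then show ?thesis by (simp add: c_def mult_ac)
qed

end

section \<open>Gaussian convolutions and log-Lipschitz densities\<close>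

text \<open>The right-hand side has slope \<open>K * c\<close> at h = 0. This converts the
  multiplicative increment bounds coming from the log-Lipschitz hypothesis into bounds on
  derivatives.\<close>

lemma directional_derivative_le_exp:
  fixes f :: "'a::real_normed_vector \<Rightarrow> real"
  assumes D: "(f has_derivative D) (at x)"
    and le: "\<And>h. 0 < h \<Longrightarrow> f (x + h *\<^sub>R u) - f x \<le> K * (exp (c * h) - 1)"
  shows "D u \<le> K * c"
proof (rule ccontr)
  assume "\<not> D u \<le> K * c"
  have "((\<lambda>h. x + h *\<^sub>R u) has_derivative (\<lambda>h. h *\<^sub>R u)) (at 0)"
    by (auto intro!: derivative_eq_intros)
  moreover have "(f has_derivative D) (at (x + 0 *\<^sub>R u))" using D by simp
  ultimately have "((\<lambda>h. f (x + h *\<^sub>R u)) has_derivative (\<lambda>h. D (h *\<^sub>R u))) (at 0)"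
    by (rule has_derivative_compose)
  then have "((\<lambda>h. f (x + h *\<^sub>R u)) has_real_derivative D u) (at 0)"
    by (rule has_derivative_imp_has_field_derivative) (simp add: linear_scale[OF has_derivative_linear[OF D]])
  then have "((\<lambda>h. f (x + h *\<^sub>R u) - f x - K * (exp (c * h) - 1)) has_real_derivative (D u - K * c)) (at 0)"
    by (auto intro!: derivative_eq_intros)
  from has_real_derivative_pos_inc_right[OF this] \<open>\<not> D u \<le> K * c\<close>
  obtain d where "d > 0" "\<And>h. 0 < h \<Longrightarrow> h < d \<Longrightarrow> 0 < f (x + h *\<^sub>R u) - f x - K * (exp (c * h) - 1)"
    by auto
  from this(2)[of "d/2"] this(1) le[of "d/2"] show False by auto
qed

lemma exp_bounded_abs [simp]: "exp_bounded f \<Longrightarrow> exp_bounded (\<lambda>y. \<bar>f y :: real\<bar>)"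
  unfolding exp_bounded_def by auto

context gauss_mixture
begin

text \<open>Used when two masses differ by a constant factor, so that their logarithms have the same
  gradient.\<close>

lemma score_unique:
  assumes "\<And>x. ((\<lambda>x. ln (mass x)) has_derivative (\<lambda>h. g x \<bullet> h)) (at x)"
  shows "score x = g x"
proof -
  have "(\<lambda>h. score x \<bullet> h) = (\<lambda>h. g x \<bullet> h)"
    by (rule has_derivative_unique[OF ln_mass_has_derivative assms])
  then show ?thesis by (metis inner_commute vector_eq_rdot)
qed

text \<open>Jensen's inequality, read off from the nonnegative posterior variance of |f|.\<close>

lemma post_abs_power2_le:
  fixes f :: "'a \<Rightarrow> real"
  assumes "exp_bounded f"
  shows "(post (\<lambda>y. \<bar>f y\<bar>) x)\<^sup>2 \<le> post (\<lambda>y. (f y)\<^sup>2) x"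
proof -
  define M where "M = post (\<lambda>y. \<bar>f y\<bar>) x"
  have "post (\<lambda>_. 0) x \<le> post (\<lambda>y. (\<bar>f y\<bar> - M)\<^sup>2) x"
    using assms by (intro post_mono) auto
  also have "(\<lambda>y. (\<bar>f y\<bar> - M)\<^sup>2) = (\<lambda>y. ((f y)\<^sup>2 - (2 * M) * \<bar>f y\<bar>) + M\<^sup>2)"
    by (simp add: power2_diff fun_eq_iff)
  also have "post \<dots> x = post (\<lambda>y. (f y)\<^sup>2) x - M\<^sup>2"
    using assms by (simp add: post_add post_diff post_cmult post_const M_def power2_eq_square)
  finally show ?thesis by (simp add: post_const M_def)
qed

end

context gauss_mixture_vec
begin

text \<open>Completing the square in \<open>z\<close> with \<kappa> = 1 / \<sigma>^2 splits the
  product into a Gaussian of variance \<open>S\<close> in x - b w and a normalised Gaussian in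
  \<open>z\<close>. It serves the convolution, and with \<sigma> = 1 and w = 0 the log-Lipschitz
  case.\<close>

lemma kernel_gauss_density:
  assumes "\<sigma> > 0"
  defines "S \<equiv> s\<^sup>2 + \<sigma>\<^sup>2 * b\<^sup>2"
  shows "kernel x (w + z) * gauss_density \<sigma> z = (s / sqrt S) ^ CARD('n)
    * exp (- (norm (x - b *\<^sub>R w))\<^sup>2 / (2 * S))
    * gauss_density (s * \<sigma> / sqrt S) (z - (\<sigma>\<^sup>2 * b / S) *\<^sub>R (x - b *\<^sub>R w))"
proof -
  have S: "S > 0" unfolding S_def using s_pos by (simp add: add_pos_nonneg)
  define v where "v = x - b *\<^sub>R w"
  define \<kappa> where "\<kappa> = 1 / \<sigma>\<^sup>2"
  have q: "\<kappa> * s\<^sup>2 + b\<^sup>2 = S / \<sigma>\<^sup>2" using assms by (simp add: \<kappa>_def S_def field_simps)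
  have "(norm (v - b *\<^sub>R z))\<^sup>2 / s\<^sup>2 + (norm z)\<^sup>2 / \<sigma>\<^sup>2
      = (norm v)\<^sup>2 / S + S / (\<sigma>\<^sup>2 * s\<^sup>2) * (norm (z - (\<sigma>\<^sup>2 * b / S) *\<^sub>R v))\<^sup>2"
    using complete_square[of \<kappa> v z] S assms(1)
    by (simp add: q) (simp add: \<kappa>_def mult_ac)
  then have "- (norm (v - b *\<^sub>R z))\<^sup>2 / (2 * s\<^sup>2) + - (norm z)\<^sup>2 / (2 * \<sigma>\<^sup>2)
      = - (norm v)\<^sup>2 / (2 * S) + - (norm (z - (\<sigma>\<^sup>2 * b / S) *\<^sub>R v))\<^sup>2 / (2 * (\<sigma>\<^sup>2 * s\<^sup>2 / S))"
    by (simp add: divide_divide_eq_right) argo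
  then have e: "exp (- (norm (v - b *\<^sub>R z))\<^sup>2 / (2 * s\<^sup>2)) * exp (- (norm z)\<^sup>2 / (2 * \<sigma>\<^sup>2))
      = exp (- (norm v)\<^sup>2 / (2 * S)) * exp (- (norm (z - (\<sigma>\<^sup>2 * b / S) *\<^sub>R v))\<^sup>2 / (2 * (\<sigma>\<^sup>2 * s\<^sup>2 / S)))"
    by (simp only: exp_add[symmetric])
  have t: "(s * \<sigma> / sqrt S)\<^sup>2 = \<sigma>\<^sup>2 * s\<^sup>2 / S"
    using S by (simp add: power_divide power_mult_distrib mult.commute)
  have "(s / sqrt S) * (1 / sqrt (2 * pi * (s * \<sigma> / sqrt S)\<^sup>2)) = 1 / sqrt (2 * pi * \<sigma>\<^sup>2)"
    using s_pos assms(1) S by (simp add: real_sqrt_mult)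
  then have c: "(s / sqrt S) ^ CARD('n) * (1 / sqrt (2 * pi * (s * \<sigma> / sqrt S)\<^sup>2)) ^ CARD('n) = (1 / sqrt (2 * pi * \<sigma>\<^sup>2)) ^ CARD('n)"
    by (metis power_mult_distrib)
  have k: "kernel x (w + z) = exp (- (norm (v - b *\<^sub>R z))\<^sup>2 / (2 * s\<^sup>2))"
    by (simp add: kernel_def v_def algebra_simps)
  show ?thesis
    unfolding k gauss_density_def v_def[symmetric] c[symmetric] t[symmetric] using e[folded t] by simp
qed

end

section \<open>Convolution of a Gaussian with a probability measure\<close>

lemma prob_space_gaussian_convolution:
  fixes \<rho> :: "(real^'n) measure"
  assumes "prob_space \<rho>" and [measurable_cong]: "sets \<rho> = sets borel" and "\<sigma> > 0"
  shows "prob_space (gaussian \<sigma> \<star> \<rho>)"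
proof -
  interpret R: prob_space \<rho> by fact
  interpret G: prob_space "gaussian \<sigma> :: (real^'n) measure" by (rule prob_space_gaussian) fact
  interpret P: pair_prob_space "gaussian \<sigma> :: (real^'n) measure" \<rho> ..
  show ?thesis unfolding convolution_def by (rule P.prob_space_distr) measurable
qed

locale gauss_convolution = R: prob_space \<rho> for \<rho> :: "(real^'n) measure" +
  fixes s b \<sigma> :: real
  assumes sets_\<rho> [measurable_cong]: "sets \<rho> = sets borel"
    and s_pos: "0 < s" and b_pos: "0 < b" and \<sigma>_pos: "0 < \<sigma>"
begin

definition S :: real where "S = s\<^sup>2 + \<sigma>\<^sup>2 * b\<^sup>2"

lemma S_pos: "S > 0" unfolding S_def using s_pos by (simp add: add_pos_nonneg)

sublocale C: gauss_mixture_vec "gaussian \<sigma> \<star> \<rho>" s b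
proof -
  interpret prob_space "gaussian \<sigma> \<star> \<rho>"
    by (rule prob_space_gaussian_convolution) (fact R.prob_space_axioms sets_\<rho> \<sigma>_pos)+
  show "gauss_mixture_vec (gaussian \<sigma> \<star> \<rho>) s b"
    by unfold_locales (auto simp: s_pos b_pos)
qed

sublocale M: gauss_mixture_vec \<rho> "sqrt S" b
  by unfold_locales (auto simp: sets_\<rho> S_pos b_pos)

text \<open>Integrating out the Gaussian summand enlarges the variance from s^2 to \<open>S\<close>
  and leaves a factor independent of \<open>x\<close>, so the two mixtures share score and
  Hessian.\<close>

lemma C_mass: "C.mass x = (s / sqrt S) ^ CARD('n) * M.mass x"
proof -
  interpret G: prob_space "gaussian \<sigma> :: (real^'n) measure" by (rule prob_space_gaussian) (rule \<sigma>_pos)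
  interpret Q: pair_sigma_finite "gaussian \<sigma> :: (real^'n) measure" \<rho> ..
  define k where "k = (s / sqrt S) ^ CARD('n)"
  have k: "k \<ge> 0" using s_pos S_pos by (simp add: k_def)
  have \<tau>: "s * \<sigma> / sqrt S > 0" using s_pos \<sigma>_pos S_pos by simp
  have "ennreal (C.mass x) = (\<integral>\<^sup>+z. \<integral>\<^sup>+w. C.kernel x (z + w) \<partial>\<rho> \<partial>gaussian \<sigma>)"
    unfolding C.nn_integral_kernel[symmetric]
    by (rule nn_integral_convolution) (auto simp: sets_\<rho> G.finite_measure_axioms R.finite_measure_axioms)
  also have "\<dots> = (\<integral>\<^sup>+w. \<integral>\<^sup>+z. C.kernel x (z + w) \<partial>gaussian \<sigma> \<partial>\<rho>)"
    by (rule Q.Fubini'[symmetric]) measurable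
  also have "\<dots> = (\<integral>\<^sup>+w. ennreal k * M.kernel x w \<partial>\<rho>)"
  proof (rule nn_integral_cong)
    fix w
    have "(\<integral>\<^sup>+z. C.kernel x (z + w) \<partial>gaussian \<sigma>)
        = (\<integral>\<^sup>+z. ennreal (gauss_density \<sigma> z) * ennreal (C.kernel x (z + w)) \<partial>lborel)"
      unfolding gaussian_eq by (subst nn_integral_density) auto
    also have "\<dots> = (\<integral>\<^sup>+z. ennreal (k * M.kernel x w)
        * gauss_density (s * \<sigma> / sqrt S) (z + (- (\<sigma>\<^sup>2 * b / S) *\<^sub>R (x - b *\<^sub>R w))) \<partial>lborel)"
    proof (rule nn_integral_cong)
      fix z
      have "gauss_density \<sigma> z * C.kernel x (z + w) = k * M.kernel x w
        * gauss_density (s * \<sigma> / sqrt S) (z + (- (\<sigma>\<^sup>2 * b / S) *\<^sub>R (x - b *\<^sub>R w)))"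
        using C.kernel_gauss_density[OF \<sigma>_pos, of x w z] S_pos
        by (simp add: k_def S_def[symmetric] M.kernel_def add.commute mult.commute)
      then show "ennreal (gauss_density \<sigma> z) * ennreal (C.kernel x (z + w)) = ennreal (k * M.kernel x w)
        * gauss_density (s * \<sigma> / sqrt S) (z + (- (\<sigma>\<^sup>2 * b / S) *\<^sub>R (x - b *\<^sub>R w)))"
        using k by (subst (1 2) ennreal_mult[symmetric]) (auto simp: less_imp_le)
    qed
    also have "\<dots> = ennreal (k * M.kernel x w) * (\<integral>\<^sup>+z. gauss_density (s * \<sigma> / sqrt S) (z + (- (\<sigma>\<^sup>2 * b / S) *\<^sub>R (x - b *\<^sub>R w))) \<partial>lborel)"
      by (rule nn_integral_cmult) measurable
    also have "\<dots> = ennreal (k * M.kernel x w)"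
      by (subst nn_integral_lborel_translate[of "\<lambda>z. ennreal (gauss_density (s * \<sigma> / sqrt S) z)"])
        (auto simp: nn_integral_gauss_density[OF \<tau>])
    finally show "(\<integral>\<^sup>+z. C.kernel x (z + w) \<partial>gaussian \<sigma>) = ennreal k * M.kernel x w"
      using k by (simp add: ennreal_mult less_imp_le)
  qed
  also have "\<dots> = ennreal (k * M.mass x)"
    using k by (subst nn_integral_cmult) (auto simp: M.nn_integral_kernel ennreal_mult')
  finally show ?thesis
    using k M.mass_pos[of x] C.mass_pos[of x] by (simp add: k_def less_imp_le)
qed

lemma C_score: "C.score x = M.score x"
proof (rule C.score_unique)
  fix x
  have "ln (C.mass x) = ln ((s / sqrt S) ^ CARD('n)) + ln (M.mass x)" for x
    unfolding C_mass using s_pos S_pos M.mass_pos[of x] by (subst ln_mult) auto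
  then show "((\<lambda>x. ln (C.mass x)) has_derivative (\<lambda>h. M.score x \<bullet> h)) (at x)"
    using has_derivative_add[OF has_derivative_const M.ln_mass_has_derivative[of x]] by simp
qed

lemma C_hess: "C.hess x = M.hess x"
proof -
  have "C.score = M.score" by (rule ext) (rule C_score)
  then show ?thesis using has_derivative_unique[OF C.score_has_derivative[of x]] M.score_has_derivative[of x] by simp
qed

lemma hess_convolution_ge: "- (u \<bullet> u) / S \<le> u \<bullet> C.hess x u"
  using M.hess_ge[of u x] S_pos by (simp add: C_hess)

lemma hess_convolution_le:
  assumes "AE y in \<rho>. y \<in> cball c R"
  shows "u \<bullet> C.hess x u \<le> (b\<^sup>2 * R\<^sup>2 / S\<^sup>2 - 1 / S) * (u \<bullet> u)"
proof -
  have "AE y in \<rho>. \<bar>u \<bullet> y - u \<bullet> c\<bar> \<le> R * norm u"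
    using assms
  proof eventually_elim
    case (elim y)
    have "\<bar>u \<bullet> (y - c)\<bar> \<le> norm u * norm (y - c)" by (rule Cauchy_Schwarz_ineq2)
    also have "\<dots> \<le> norm u * R" using elim by (intro mult_left_mono) (auto simp: dist_norm norm_minus_commute)
    finally show ?case by (simp add: inner_diff_right mult.commute)
  qed
  from M.hess_le[OF this, of x] show ?thesis
    using S_pos by (simp add: C_hess power_divide power_mult_distrib power2_norm_eq_inner algebra_simps)
qed

end

section \<open>Log-Lipschitz densities with respect to the standard Gaussian\<close>

locale log_lipschitz_mixture = gauss_mixture_vec \<nu> s b for \<nu> :: "(real^'n) measure" and s b +
  fixes L :: real and f :: "real^'n \<Rightarrow> real"
  assumes nu_eq: "\<nu> = density (gaussian 1) (\<lambda>x. ennreal (f x))" and f: "log_lipschitz L f" and L: "0 \<le> L"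
begin

text \<open>
  Up to a constant, q is the density of the interpolant relative to the centred Gaussian of
  variance r2, which is the law of the interpolant when f is constant; J is its score.
\<close>

definition r2 :: real where "r2 = s\<^sup>2 + b\<^sup>2"
text \<open>Regression coefficient: for constant \<open>f\<close> the posterior is Gaussian with
  mean \<open>m *\<^sub>R x\<close>.\<close>

definition m :: real where "m = b / r2"
definition q :: "real^'n \<Rightarrow> real" where
  "q x = mass x * exp ((norm x)\<^sup>2 / (2 * r2)) / (s / sqrt r2) ^ CARD('n)"
definition J :: "real^'n \<Rightarrow> real^'n" where "J x = score x + x /\<^sub>R r2"

lemma r2_pos: "r2 > 0" unfolding r2_def using s_pos by (simp add: add_pos_nonneg)

lemma m_pos: "m > 0" using b_pos r2_pos by (simp add: m_def)

lemma f_pos: "0 < f x" using f by (simp add: log_lipschitz_def)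

lemma f_meas [measurable]: "f \<in> borel_measurable borel"
proof -
  have "continuous_on UNIV (\<lambda>x. exp (ln (f x)))"
    using f by (intro continuous_on_exp lipschitz_on_continuous_on) (auto simp: log_lipschitz_def)
  then have "continuous_on UNIV f" using f_pos by simp
  then show ?thesis by (rule borel_measurable_continuous_onI)
qed

lemma f_le: "f y \<le> exp (L * norm (y - x)) * f x"
proof -
  have "dist (ln (f y)) (ln (f x)) \<le> L * dist y x"
    using f by (auto simp: log_lipschitz_def lipschitz_on_def)
  then have "ln (f y) \<le> L * norm (y - x) + ln (f x)" by (simp add: dist_norm)
  then have "exp (ln (f y)) \<le> exp (L * norm (y - x) + ln (f x))" by simp
  then show ?thesis using f_pos by (simp add: exp_add)
qed

lemma q_pos: "q x > 0"
  using mass_pos s_pos r2_pos by (simp add: q_def)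

text \<open>After the substitution y = z + m x, the kernel times the Gaussian weight is a factor in
  x times a Gaussian in z that no longer involves x. What remains of x is the argument of f, so
  increments in x are governed by the Lipschitz bound.\<close>

lemma q_post:
  fixes g :: "real^'n \<Rightarrow> real"
  assumes g: "exp_bounded (\<lambda>y. g (y - m *\<^sub>R x))"
  shows "integrable lborel (\<lambda>z. g z * f (z + m *\<^sub>R x) * gauss_density (s / sqrt r2) z)"
    and "q x * post (\<lambda>y. g (y - m *\<^sub>R x)) x = (\<integral>z. g z * f (z + m *\<^sub>R x) * gauss_density (s / sqrt r2) z \<partial>lborel)"
proof -
  define k where "k = (s / sqrt r2) ^ CARD('n) * exp (- (norm x)\<^sup>2 / (2 * r2))"
  have k: "k > 0" using s_pos r2_pos by (simp add: k_def)
  have [measurable]: "(\<lambda>y. g (y - m *\<^sub>R x)) \<in> borel_measurable borel" using g by (simp add: exp_bounded_def)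
  then have "(\<lambda>y. g (y + m *\<^sub>R x - m *\<^sub>R x)) \<in> borel_measurable borel"
    by (rule measurable_compose[rotated]) measurable
  then have [measurable]: "g \<in> borel_measurable borel" by simp
  have nu: "\<nu> = density lborel (\<lambda>y. ennreal (gauss_density 1 y * f y))"
    unfolding nu_eq gaussian_eq
    by (subst density_density_eq) (auto intro!: arg_cong[where f="density lborel"] simp: ennreal_mult f_pos less_imp_le)
  have nn: "0 \<le> gauss_density 1 y * f y" for y using f_pos[of y] by simp
  have K: "(gauss_density 1 y * f y) * (kernel x y * g (y - m *\<^sub>R x))
      = k * (g (y - m *\<^sub>R x) * f y * gauss_density (s / sqrt r2) (y - m *\<^sub>R x))" for y
    using kernel_gauss_density[of 1 x 0 y] by (simp add: r2_def[symmetric] m_def k_def mult_ac)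
  define h where "h y = g (y - m *\<^sub>R x) * f y * gauss_density (s / sqrt r2) (y - m *\<^sub>R x)" for y
  have [measurable]: "h \<in> borel_measurable borel" unfolding h_def by measurable
  have "integrable \<nu> (\<lambda>y. kernel x y * g (y - m *\<^sub>R x))"
    using integrable_kernel[OF g, of x] by simp
  then have "integrable lborel (\<lambda>y. (gauss_density 1 y * f y) * (kernel x y * g (y - m *\<^sub>R x)))"
    unfolding nu using nn by (subst (asm) integrable_real_density) auto
  then have ih: "integrable lborel h"
    unfolding K h_def[symmetric] using k by simp
  have "kint (\<lambda>y. g (y - m *\<^sub>R x)) x = (\<integral>y. (gauss_density 1 y * f y) * (kernel x y * g (y - m *\<^sub>R x)) \<partial>lborel)"
    unfolding kint_def by (subst nu, subst integral_real_density) (auto simp: nn)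
  then have kh: "kint (\<lambda>y. g (y - m *\<^sub>R x)) x = k * (\<integral>y. h y \<partial>lborel)"
    unfolding K h_def[symmetric] by simp
  have shift: "(\<lambda>z. g z * f (z + m *\<^sub>R x) * gauss_density (s / sqrt r2) z) = (\<lambda>z. h (m *\<^sub>R x + z))"
    by (simp add: h_def add.commute)
  have "integrable (distr lborel borel ((+) (m *\<^sub>R x))) h" using ih by (simp add: lborel_distr_plus)
  then show "integrable lborel (\<lambda>z. g z * f (z + m *\<^sub>R x) * gauss_density (s / sqrt r2) z)"
    unfolding shift by (subst (asm) integrable_distr_eq) auto
  have "(\<integral>y. h y \<partial>lborel) = (\<integral>y. h y \<partial>distr lborel borel ((+) (m *\<^sub>R x)))" by (simp add: lborel_distr_plus)
  also have "\<dots> = (\<integral>z. h (m *\<^sub>R x + z) \<partial>lborel)" by (rule integral_distr) auto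
  finally have "kint (\<lambda>y. g (y - m *\<^sub>R x)) x = k * (\<integral>z. g z * f (z + m *\<^sub>R x) * gauss_density (s / sqrt r2) z \<partial>lborel)"
    unfolding kh shift by simp
  moreover have "q x * post (\<lambda>y. g (y - m *\<^sub>R x)) x = kint (\<lambda>y. g (y - m *\<^sub>R x)) x / k"
    using mass_pos[of x] by (simp add: q_def post_def k_def exp_minus field_simps)
  ultimately show "q x * post (\<lambda>y. g (y - m *\<^sub>R x)) x
      = (\<integral>z. g z * f (z + m *\<^sub>R x) * gauss_density (s / sqrt r2) z \<partial>lborel)"
    using k by simp
qed

lemma exp_bounded_shift [simp]: "exp_bounded (\<lambda>y. u \<bullet> (y - c))"
  unfolding inner_diff_right by simp

lemma ln_q_has_derivative: "((\<lambda>x. ln (q x)) has_derivative (\<lambda>h. J x \<bullet> h)) (at x)"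
proof -
  have "ln (q x) = ln (mass x) + (x \<bullet> x) / (2 * r2) - ln ((s / sqrt r2) ^ CARD('n))" for x
    unfolding q_def using mass_pos[of x] s_pos r2_pos
    by (subst ln_div) (auto simp: ln_mult power2_norm_eq_inner)
  moreover have "((\<lambda>x. ln (mass x) + (x \<bullet> x) / (2 * r2) - ln ((s / sqrt r2) ^ CARD('n))) has_derivative
     (\<lambda>h. score x \<bullet> h + (x \<bullet> h + h \<bullet> x) / (2 * r2) - 0)) (at x)"
    unfolding divide_inverse
    by (intro has_derivative_add has_derivative_diff has_derivative_const ln_mass_has_derivative
      has_derivative_mult_left has_derivative_inner has_derivative_ident)
  moreover have "score x \<bullet> h + (x \<bullet> h + h \<bullet> x) / (2 * r2) - 0 = J x \<bullet> h" for h
    using r2_pos by (simp add: J_def inner_add_left inner_commute[of h x] field_simps)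
  ultimately show ?thesis by simp
qed

text \<open>Expresses the relative score by the deviation of the posterior mean from its value for
  constant \<open>f\<close>.\<close>

lemma J_eq: "J x = (b / s\<^sup>2) *\<^sub>R (post (\<lambda>y. y) x - m *\<^sub>R x)"
proof -
  have "1 / r2 - 1 / s\<^sup>2 = - (b / s\<^sup>2) * m"
  proof -
    have "1 / r2 - 1 / s\<^sup>2 = (s\<^sup>2 - r2) / (r2 * s\<^sup>2)" using s_pos r2_pos by (simp add: field_simps)
    also have "s\<^sup>2 - r2 = - (b * b)" by (simp add: r2_def power2_eq_square)
    finally show ?thesis by (simp add: m_def mult.commute)
  qed
  then have "x /\<^sub>R r2 - x /\<^sub>R s\<^sup>2 = (- (b / s\<^sup>2) * m) *\<^sub>R x"
    by (metis inverse_eq_divide scaleR_left.diff)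
  then show ?thesis by (simp add: J_def score_def algebra_simps)
qed

text \<open>\<open>q\<close> is an average of translates of \<open>f\<close> by m x, hence
  log-Lipschitz with the constant scaled by \<open>m\<close>.\<close>

lemma q_le: "q (x + h) \<le> exp (L * m * norm h) * q x"
proof -
  have 1: "q x = (\<integral>z. 1 * f (z + m *\<^sub>R x) * gauss_density (s / sqrt r2) z \<partial>lborel)" for x
    using q_post(2)[of "\<lambda>_. 1" x] by (simp add: post_const)
  have "q (x + h) \<le> (\<integral>z. exp (L * m * norm h) * (1 * f (z + m *\<^sub>R x) * gauss_density (s / sqrt r2) z) \<partial>lborel)"
    unfolding 1[of "x + h"]
  proof (rule integral_mono)
    fix z
    have "f (z + m *\<^sub>R (x + h)) \<le> exp (L * m * norm h) * f (z + m *\<^sub>R x)"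
      using f_le[of "z + m *\<^sub>R (x + h)" "z + m *\<^sub>R x"] m_pos by (simp add: algebra_simps)
    then show "1 * f (z + m *\<^sub>R (x + h)) * gauss_density (s / sqrt r2) z
      \<le> exp (L * m * norm h) * (1 * f (z + m *\<^sub>R x) * gauss_density (s / sqrt r2) z)"
      by (simp add: mult_right_mono mult.assoc[symmetric])
  qed (use q_post(1)[of "\<lambda>_. 1"] in auto)
  also have "\<dots> = exp (L * m * norm h) * q x" by (simp add: 1)
  finally show ?thesis .
qed

lemma J_le: "\<bar>u \<bullet> J x\<bar> \<le> L * m * norm u"
proof -
  have "J x \<bullet> u \<le> L * m * norm u" for u
  proof -
    have "ln (q (x + h *\<^sub>R u)) - ln (q x) \<le> 1 * (exp (L * m * norm u * h) - 1)" if h: "0 < h" for h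
    proof -
      have "ln (q (x + h *\<^sub>R u)) \<le> ln (exp (L * m * norm (h *\<^sub>R u)) * q x)"
        using q_le[of x "h *\<^sub>R u"] q_pos by (subst ln_le_cancel_iff) (auto simp del: norm_scaleR)
      also have "\<dots> = L * m * norm u * h + ln (q x)"
        using q_pos[of x] h by (simp add: ln_mult)
      finally have "ln (q (x + h *\<^sub>R u)) - ln (q x) \<le> L * m * norm u * h" by simp
      also have "\<dots> \<le> 1 * (exp (L * m * norm u * h) - 1)"
        by (simp only: mult_1 le_diff_eq add.commute[of _ 1] exp_ge_add_one_self)
      finally show ?thesis .
    qed
    from directional_derivative_le_exp[OF ln_q_has_derivative this] show ?thesis by simp
  qed
  from this[of u] this[of "- u"] show ?thesis by (simp add: inner_commute abs_le_iff)
qed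

text \<open>On the left stands the second derivative of \<open>q\<close> in direction u divided by
  \<open>q\<close>, which explains the squared term. Up to the factor s^2 / b, the function
  \<open>T\<close> is the first directional derivative of \<open>q\<close>, and its integrand
  depends on x only through a translate of \<open>f\<close>; bounding increments of \<open>T\<close>
  bounds the second derivative.\<close>

lemma hess_q_le_abs:
  "\<bar>u \<bullet> hess x u + (u \<bullet> u) / r2 + (u \<bullet> J x)\<^sup>2\<bar>
    \<le> (b / s\<^sup>2) * (L * m * norm u) * post (\<lambda>y. \<bar>u \<bullet> (y - m *\<^sub>R x)\<bar>) x"
proof -
  define A where "A = q x * post (\<lambda>y. \<bar>u \<bullet> (y - m *\<^sub>R x)\<bar>) x"
  define T where "T x = (\<integral>z. (u \<bullet> z) * f (z + m *\<^sub>R x) * gauss_density (s / sqrt r2) z \<partial>lborel)" for x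
  have uJ: "u \<bullet> J x = (b / s\<^sup>2) * post (\<lambda>y. u \<bullet> (y - m *\<^sub>R x)) x" for x
    unfolding inner_diff_right by (simp add: J_eq post_diff post_const post_inner inner_diff_right algebra_simps)
  have T_eq: "T x = (s\<^sup>2 / b) * (q x * (u \<bullet> J x))" for x
    using q_post(2)[of "\<lambda>z. u \<bullet> z" x] b_pos s_pos by (simp add: T_def uJ)
  have T_le: "\<bar>T (x + h) - T x\<bar> \<le> A * (exp (L * m * norm h) - 1)" for h
  proof -
    have int: "integrable lborel (\<lambda>z. (u \<bullet> z) * f (z + m *\<^sub>R x) * gauss_density (s / sqrt r2) z)" for x
      using q_post(1)[of "\<lambda>z. u \<bullet> z" x] by simp
    have intA: "integrable lborel (\<lambda>z. \<bar>u \<bullet> z\<bar> * f (z + m *\<^sub>R x) * gauss_density (s / sqrt r2) z)"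
      using q_post(1)[of "\<lambda>z. \<bar>u \<bullet> z\<bar>" x] by simp
    have "\<bar>T (x + h) - T x\<bar> = norm (\<integral>z. (u \<bullet> z) * f (z + m *\<^sub>R (x + h)) * gauss_density (s / sqrt r2) z
        - (u \<bullet> z) * f (z + m *\<^sub>R x) * gauss_density (s / sqrt r2) z \<partial>lborel)"
      unfolding T_def using int[of "x + h"] int[of x] by (subst Bochner_Integration.integral_diff) auto
    also have "\<dots> \<le> (\<integral>z. (exp (L * m * norm h) - 1) * (\<bar>u \<bullet> z\<bar> * f (z + m *\<^sub>R x) * gauss_density (s / sqrt r2) z) \<partial>lborel)"
    proof (rule Bochner_Integration.integral_norm_bound_integral)
      show "integrable lborel (\<lambda>z. (u \<bullet> z) * f (z + m *\<^sub>R (x + h)) * gauss_density (s / sqrt r2) z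
        - (u \<bullet> z) * f (z + m *\<^sub>R x) * gauss_density (s / sqrt r2) z)"
        using int[of "x + h"] int[of x] by auto
      show "integrable lborel (\<lambda>z. (exp (L * m * norm h) - 1) * (\<bar>u \<bullet> z\<bar> * f (z + m *\<^sub>R x) * gauss_density (s / sqrt r2) z))"
        using intA by auto
      fix z
      define E where "E = exp (L * m * norm h)"
      have E: "E \<ge> 1" using L m_pos by (simp add: E_def)
      define y1 y2 where "y1 = f (z + m *\<^sub>R (x + h))" and "y2 = f (z + m *\<^sub>R x)"
      have y: "y1 \<le> E * y2" "y2 \<le> E * y1" "0 < y1" "0 < y2"
        using f_le[of "z + m *\<^sub>R (x + h)" "z + m *\<^sub>R x"] f_le[of "z + m *\<^sub>R x" "z + m *\<^sub>R (x + h)"] m_pos f_pos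
        by (simp_all add: E_def y1_def y2_def algebra_simps)
      \<comment> \<open>For two positive numbers within a factor \<open>E\<close> of each other, the
        difference is at most E - 1 times the smaller, hence times y2 in either order.\<close>
      have "y2 - y1 \<le> (E - 1) * y2"
      proof (cases "y2 \<le> y1")
        case True
        then show ?thesis using E y(4) by (smt (verit) mult_nonneg_nonneg)
      next
        case False
        then have "(E - 1) * y1 \<le> (E - 1) * y2" using E by (intro mult_left_mono) auto
        then show ?thesis using y(2) by (simp add: algebra_simps)
      qed
      then have "\<bar>y1 - y2\<bar> \<le> (E - 1) * y2" using y(1) by (auto simp: abs_le_iff algebra_simps)
      then have "(\<bar>u \<bullet> z\<bar> * gauss_density (s / sqrt r2) z) * \<bar>y1 - y2\<bar> \<le> (\<bar>u \<bullet> z\<bar> * gauss_density (s / sqrt r2) z) * ((E - 1) * y2)"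
        by (intro mult_left_mono) auto
      moreover have "norm ((u \<bullet> z) * y1 * gauss_density (s / sqrt r2) z - (u \<bullet> z) * y2 * gauss_density (s / sqrt r2) z)
          = (\<bar>u \<bullet> z\<bar> * gauss_density (s / sqrt r2) z) * \<bar>y1 - y2\<bar>"
      proof -
        have "(u \<bullet> z) * y1 * gauss_density (s / sqrt r2) z - (u \<bullet> z) * y2 * gauss_density (s / sqrt r2) z
          = (u \<bullet> z) * gauss_density (s / sqrt r2) z * (y1 - y2)" by (simp add: algebra_simps)
        then show ?thesis by (simp add: abs_mult)
      qed
      ultimately show "norm ((u \<bullet> z) * f (z + m *\<^sub>R (x + h)) * gauss_density (s / sqrt r2) z
        - (u \<bullet> z) * f (z + m *\<^sub>R x) * gauss_density (s / sqrt r2) z)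
        \<le> (exp (L * m * norm h) - 1) * (\<bar>u \<bullet> z\<bar> * f (z + m *\<^sub>R x) * gauss_density (s / sqrt r2) z)"
        unfolding y1_def[symmetric] y2_def[symmetric] E_def[symmetric] by (simp add: mult_ac)
    qed
    also have "\<dots> = A * (exp (L * m * norm h) - 1)"
      using q_post(2)[of "\<lambda>z. \<bar>u \<bullet> z\<bar>" x] by (simp add: A_def)
    finally show ?thesis .
  qed
  have q_der: "(q has_derivative (\<lambda>h. q x * (J x \<bullet> h))) (at x)"
  proof -
    have "((\<lambda>x. exp (ln (q x))) has_derivative (\<lambda>h. (J x \<bullet> h) * exp (ln (q x)))) (at x)"
      by (rule has_derivative_exp[OF ln_q_has_derivative])
    then show ?thesis using q_pos by (simp add: mult.commute)
  qed
  have J_der: "(J has_derivative (\<lambda>h. hess x h + h /\<^sub>R r2)) (at x)"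
    unfolding J_def[abs_def] by (intro has_derivative_add score_has_derivative has_derivative_scaleR_right has_derivative_ident)
  have T_der: "(T has_derivative (\<lambda>h. (s\<^sup>2 / b) * (q x * (u \<bullet> (hess x h + h /\<^sub>R r2)) + q x * (J x \<bullet> h) * (u \<bullet> J x)))) (at x)"
    unfolding T_eq[abs_def]
    by (intro has_derivative_mult_right has_derivative_mult q_der has_derivative_inner_right J_der)
  define X where "X = u \<bullet> hess x u + (u \<bullet> u) / r2 + (u \<bullet> J x)\<^sup>2"
  have X: "(s\<^sup>2 / b) * (q x * (u \<bullet> (hess x u + u /\<^sub>R r2)) + q x * (J x \<bullet> u) * (u \<bullet> J x)) = (s\<^sup>2 / b) * q x * X"
    by (simp add: X_def inner_add_right inner_commute power2_eq_square algebra_simps divide_inverse)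
  have "(s\<^sup>2 / b) * q x * X \<le> A * (L * m * norm u)"
    unfolding X[symmetric]
  proof (rule directional_derivative_le_exp[OF T_der])
    show "T (x + h *\<^sub>R u) - T x \<le> A * (exp (L * m * norm u * h) - 1)" if "0 < h" for h
      using T_le[of "h *\<^sub>R u"] that by (simp add: mult_ac abs_le_iff)
  qed
  moreover have "- ((s\<^sup>2 / b) * q x * X) \<le> A * (L * m * norm u)"
    unfolding X[symmetric]
  proof (rule directional_derivative_le_exp[OF has_derivative_minus[OF T_der]])
    show "- T (x + h *\<^sub>R u) - - T x \<le> A * (exp (L * m * norm u * h) - 1)" if "0 < h" for h
      using T_le[of "h *\<^sub>R u"] that by (simp add: mult_ac abs_le_iff)
  qed
  ultimately have "\<bar>(s\<^sup>2 / b) * q x * X\<bar> \<le> A * (L * m * norm u)" by (simp add: abs_le_iff)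
  then have "(s\<^sup>2 / b) * q x * \<bar>X\<bar> \<le> A * (L * m * norm u)"
    using s_pos b_pos q_pos[of x] by (simp add: abs_mult)
  then have "q x * ((s\<^sup>2 / b) * \<bar>X\<bar>) \<le> q x * (post (\<lambda>y. \<bar>u \<bullet> (y - m *\<^sub>R x)\<bar>) x * (L * m * norm u))"
    by (simp add: A_def mult_ac)
  then have "(s\<^sup>2 / b) * \<bar>X\<bar> \<le> post (\<lambda>y. \<bar>u \<bullet> (y - m *\<^sub>R x)\<bar>) x * (L * m * norm u)"
    by (rule mult_left_le_imp_le) (rule q_pos)
  then show ?thesis
    unfolding X_def[symmetric] using s_pos b_pos by (simp add: field_simps)
qed

text \<open>The previous bound contains the first absolute moment \<alpha>, whose square is at most
  a second moment, and that moment is again expressed by the Hessian. The result is \<alpha>^2 \<le>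
  A \<alpha> + B^2, so \<alpha> \<le> A + B.\<close>

lemma hess_q_bound:
  "\<bar>u \<bullet> hess x u + (u \<bullet> u) / r2 + (u \<bullet> J x)\<^sup>2\<bar> \<le> L * m * (L * m + b / (s * sqrt r2)) * (u \<bullet> u)"
proof -
  define X where "X = u \<bullet> hess x u + (u \<bullet> u) / r2 + (u \<bullet> J x)\<^sup>2"
  define \<alpha> where "\<alpha> = (b / s\<^sup>2) * post (\<lambda>y. \<bar>u \<bullet> (y - m *\<^sub>R x)\<bar>) x"
  define N where "N = norm u"
  have X: "\<bar>X\<bar> \<le> L * m * N * \<alpha>"
    using hess_q_le_abs[of u x] by (simp add: X_def \<alpha>_def N_def mult_ac)
  have "post (\<lambda>_. 0) x \<le> post (\<lambda>y. \<bar>u \<bullet> (y - m *\<^sub>R x)\<bar>) x" by (rule post_mono) auto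
  then have \<alpha>0: "0 \<le> \<alpha>" using s_pos b_pos by (simp add: \<alpha>_def post_const)
  have "\<alpha>\<^sup>2 \<le> (b / s\<^sup>2)\<^sup>2 * post (\<lambda>y. (u \<bullet> (y - m *\<^sub>R x))\<^sup>2) x"
    unfolding \<alpha>_def power_mult_distrib by (intro mult_left_mono post_abs_power2_le) auto
  also have "\<dots> = u \<bullet> hess x u + (u \<bullet> u) / s\<^sup>2 + (u \<bullet> J x)\<^sup>2"
  proof -
    have "u \<bullet> J x = (b / s\<^sup>2) * (u \<bullet> post (\<lambda>y. y) x - u \<bullet> (m *\<^sub>R x))"
      by (simp add: J_eq inner_diff_right)
    then have "(u \<bullet> J x)\<^sup>2 = (b / s\<^sup>2)\<^sup>2 * (u \<bullet> post (\<lambda>y. y) x - u \<bullet> (m *\<^sub>R x))\<^sup>2"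
      by (simp only: power_mult_distrib)
    then show ?thesis
      using hess_diag[of u x "u \<bullet> (m *\<^sub>R x)"] unfolding inner_diff_right right_diff_distrib by linarith
  qed
  also have "\<dots> = X + (b / (s * sqrt r2))\<^sup>2 * N\<^sup>2"
  proof -
    \<comment> \<open>The variances s^2 and r2 differ by b^2; this is the gap between the Gaussian
      terms of \<open>hess_diag\<close> and of \<open>X\<close>.\<close>
    have "1 / s\<^sup>2 = 1 / r2 + (b / (s * sqrt r2))\<^sup>2"
      using s_pos r2_pos by (simp add: power_divide power_mult_distrib field_simps) (simp add: r2_def)
    then have "(u \<bullet> u) * (1 / s\<^sup>2) = (u \<bullet> u) * (1 / r2 + (b / (s * sqrt r2))\<^sup>2)" by simp
    then show ?thesis by (simp add: X_def N_def power2_norm_eq_inner algebra_simps)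
  qed
  also have "\<dots> \<le> L * m * N * \<alpha> + (b / (s * sqrt r2) * N)\<^sup>2"
    using X unfolding power_mult_distrib by linarith
  finally have \<alpha>2: "\<alpha>\<^sup>2 \<le> L * m * N * \<alpha> + (b / (s * sqrt r2) * N)\<^sup>2" .
  define B where "B = b / (s * sqrt r2) * N"
  define A where "A = L * m * N"
  have nn: "0 \<le> A" "0 \<le> B" using L m_pos b_pos s_pos r2_pos by (auto simp: A_def B_def N_def)
  have "\<alpha> \<le> A + B"
  proof (rule ccontr)
    assume "\<not> \<alpha> \<le> A + B"
    then have "A * \<alpha> + B * B < \<alpha> * \<alpha>"
    proof -
      have "B * B \<le> B * \<alpha>" using \<open>\<not> \<alpha> \<le> A + B\<close> nn by (intro mult_left_mono) auto
      moreover have "(A + B) * \<alpha> < \<alpha> * \<alpha>" using \<open>\<not> \<alpha> \<le> A + B\<close> nn by (intro mult_strict_right_mono) auto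
      ultimately show ?thesis by (simp add: algebra_simps)
    qed
    then show False using \<alpha>2 by (simp add: A_def B_def power2_eq_square)
  qed
  then have "L * m * N * \<alpha> \<le> L * m * N * (A + B)"
    using nn by (intro mult_left_mono) (auto simp: A_def)
  also have "\<dots> = L * m * (L * m + b / (s * sqrt r2)) * (N * N)"
    by (simp add: A_def B_def algebra_simps)
  also have "N * N = u \<bullet> u" by (simp add: N_def power2_norm_eq_inner[symmetric] power2_eq_square)
  finally show ?thesis using X unfolding X_def by linarith
qed

text \<open>With \<tau> = ln (r / b) one has 2 \<tau> = ln (1 + (s/b)^2) \<le> (s/b)^2, so b / s is
  at most \<tau> to the power -1/2; also b / r \<le> 1. The factor 5 is generous: the estimate
  already holds with 1 in its place.\<close>

lemma lipschitz_constant_le: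
  "L * m * (L * m + b / (s * sqrt r2))
    \<le> 5 * L * b * r2 powr (- 3 / 2) * (L + (ln (sqrt r2 / b)) powr (- 1 / 2))"
proof -
  define r where "r = sqrt r2"
  have r: "r > 0" "r2 = r\<^sup>2" using r2_pos by (auto simp: r_def)
  have "b\<^sup>2 < r\<^sup>2" using r(2) zero_less_power[OF s_pos, of 2] unfolding r2_def by linarith
  then have br: "b < r" using r b_pos by (simp add: power_less_imp_less_base)
  have p: "r2 powr (- 3 / 2) = 1 / r ^ 3"
  proof -
    have "r2 powr (- 3 / 2) = (r powr 2) powr (- 3 / 2)" using r by (simp add: powr_numeral)
    also have "\<dots> = r powr (- 3)" by (simp add: powr_powr)
    also have "\<dots> = 1 / r ^ 3" using r by (simp add: powr_minus powr_numeral divide_inverse)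
    finally show ?thesis .
  qed
  define \<tau> where "\<tau> = ln (r / b)"
  have \<tau>: "\<tau> > 0" using br b_pos by (simp add: \<tau>_def)
  have "2 * \<tau> = ln ((r / b)\<^sup>2)" using br b_pos r by (simp add: \<tau>_def ln_realpow)
  also have "(r / b)\<^sup>2 = 1 + (s / b)\<^sup>2"
    using b_pos by (simp add: power_divide r(2)[symmetric] r2_def add_divide_distrib)
  also have "ln (1 + (s / b)\<^sup>2) \<le> (s / b)\<^sup>2" by (rule ln_add_one_self_le_self) simp
  finally have "\<tau> \<le> (s / b)\<^sup>2" using \<tau> by linarith
  then have "sqrt \<tau> \<le> s / b" using s_pos b_pos real_sqrt_le_mono[of \<tau> "(s/b)\<^sup>2"] by simp
  then have "b / s \<le> 1 / sqrt \<tau>"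
    using \<tau> s_pos b_pos by (simp add: field_simps)
  also have "1 / sqrt \<tau> = \<tau> powr (- 1 / 2)"
    using \<tau> powr_minus[of \<tau> "1 / 2"] powr_half_sqrt[of \<tau>] by (simp add: inverse_eq_divide)
  finally have bs: "b / s \<le> \<tau> powr (- 1 / 2)" .
  have "L * (b / r) + b / s \<le> 5 * (L + \<tau> powr (- 1 / 2))"
  proof -
    have "b / r \<le> 1" using br r by simp
    then have "L * (b / r) \<le> L * 1" using L by (rule mult_left_mono)
    moreover have "0 \<le> \<tau> powr (- 1 / 2)" by (rule powr_ge_zero)
    moreover have "5 * (L + \<tau> powr (- 1 / 2)) = L * 1 + \<tau> powr (- 1 / 2) + (4 * L + 4 * \<tau> powr (- 1 / 2))"
      by simp
    ultimately show ?thesis using bs L by linarith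
  qed
  then have "L * b / r ^ 3 * (L * (b / r) + b / s) \<le> L * b / r ^ 3 * (5 * (L + \<tau> powr (- 1 / 2)))"
    by (rule mult_left_mono) (use L b_pos r in simp)
  moreover have "L * m * (L * m + b / (s * sqrt r2)) = L * b / r ^ 3 * (L * (b / r) + b / s)"
    using r s_pos by (simp add: m_def r_def[symmetric] r(2) field_simps power2_eq_square power3_eq_cube)
  ultimately show ?thesis unfolding p r_def[symmetric] \<tau>_def[symmetric] by (simp add: mult_ac)
qed

end

section \<open>The velocity field\<close>

text \<open>\<open>Ck_on\<close> asserts that some derivative exists, whereas
  \<open>time_deriv\<close> is a choice; uniqueness of one-sided derivatives on the closed interval
  identifies them, end points included.\<close>

lemma Ck_on_1D:
  assumes "Ck_on 1 {0..1} f"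
  shows "continuous_on {0..1} (time_deriv f)"
    and "t \<in> {0..1} \<Longrightarrow> (f has_real_derivative time_deriv f t) (at t within {0..1})"
proof -
  from assms have "\<exists>f'. (\<forall>t\<in>{0..1}. (f has_real_derivative f' t) (at t within {0..1})) \<and> continuous_on {0..1} f'"
    by simp
  then obtain f' where f': "\<And>t. t \<in> {0..1} \<Longrightarrow> (f has_real_derivative f' t) (at t within {0..1})"
      "continuous_on {0..1} f'"
    by blast
  have eq: "time_deriv f t = f' t" if "t \<in> {0..1}" for t
    unfolding time_deriv_def using f'(1)[OF that] that
    by (intro vector_derivative_within_closed_interval) (auto simp: has_real_derivative_iff_has_vector_derivative)
  show "continuous_on {0..1} (time_deriv f)" using f'(2) by (rule continuous_on_eq) (simp add: eq)
  show "t \<in> {0..1} \<Longrightarrow> (f has_real_derivative time_deriv f t) (at t within {0..1})"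
    using f'(1) eq by simp
qed

lemma time_deriv_at:
  assumes "(f has_real_derivative D) (at t)" "0 < t" "t < 1"
  shows "time_deriv f t = D"
proof -
  have "at t within {0..1} = at t" using assms by (intro at_within_interior) auto
  then show ?thesis
    using assms unfolding time_deriv_def
    by (simp add: vector_derivative_at has_real_derivative_iff_has_vector_derivative)
qed

lemma Ck_on_2D:
  assumes "Ck_on 2 {0..<1} f" "t \<in> {0<..<1}"
  shows "(f has_real_derivative time_deriv f t) (at t)"
proof -
  have "\<exists>f'. \<forall>t\<in>{0..<1}. (f has_real_derivative f' t) (at t within {0..<1})"
    using assms(1) by (auto simp: numeral_2_eq_2)
  moreover have "t \<in> {0..<1}" using assms(2) by simp
  ultimately obtain D where "(f has_real_derivative D) (at t within {0..<1})"
    by blast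
  moreover have "at t within {0..<1} = at t" using assms by (intro at_within_interior) auto
  ultimately show ?thesis using time_deriv_at[of f D t] assms(2) by auto
qed

locale interpolation =
  fixes a b :: "real \<Rightarrow> real"
  assumes coeffs: "interpolation_coeffs a b"
begin

abbreviation "a' \<equiv> time_deriv a"
abbreviation "b' \<equiv> time_deriv b"

text \<open>
  The coefficient of the score in the velocity field (not the convexity parameter of part (c)).
\<close>

definition \<kappa> :: "real \<Rightarrow> real" where "\<kappa> t = b' t / b t * (a t)\<^sup>2 - a t * a' t"

lemma a_pos: "t \<in> {0<..<1} \<Longrightarrow> 0 < a t" and b_pos: "t \<in> {0<..<1} \<Longrightarrow> 0 < b t"
  and a'_le: "t \<in> {0<..<1} \<Longrightarrow> a' t \<le> 0" and b'_ge: "t \<in> {0..1} \<Longrightarrow> 0 \<le> b' t"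
  and a_1: "a 1 = 0" and b_1: "b 1 = 1"
  using coeffs unfolding interpolation_coeffs_def by auto

lemma a_deriv: "t \<in> {0<..<1} \<Longrightarrow> (a has_real_derivative a' t) (at t)"
  and b_deriv: "t \<in> {0<..<1} \<Longrightarrow> (b has_real_derivative b' t) (at t)"
  using coeffs unfolding interpolation_coeffs_def by (auto intro: Ck_on_2D)

lemma \<kappa>_nonneg: "t \<in> {0<..<1} \<Longrightarrow> 0 \<le> \<kappa> t"
proof -
  assume t: "t \<in> {0<..<1}"
  have "0 \<le> b' t / b t * (a t)\<^sup>2"
    using b_pos[OF t] b'_ge[of t] t by (intro mult_nonneg_nonneg divide_nonneg_pos) auto
  moreover have "a t * a' t \<le> 0"
    using a_pos[OF t] a'_le[OF t] by (intro mult_nonneg_nonpos) auto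
  ultimately show ?thesis by (simp add: \<kappa>_def)
qed

lemma at_left_1: "at 1 within {0..1::real} = at_left 1"
  by (rule at_within_Icc_at_left) simp

lemma eventually_interior: "\<forall>\<^sub>F t in at_left 1. t \<in> {0<..<1::real}"
  unfolding eventually_at_left[of 0 1, OF zero_less_one] by (intro exI[of _ 0]) auto

lemma b_tendsto: "(b \<longlongrightarrow> 1) (at_left 1)" and b'_tendsto: "(b' \<longlongrightarrow> b' 1) (at_left 1)"
proof -
  have b: "Ck_on 1 {0..1} b" using coeffs by (simp add: interpolation_coeffs_def)
  have "(b has_real_derivative b' 1) (at 1 within {0..1})"
    by (rule Ck_on_1D(2)[OF b]) simp
  then have "continuous (at 1 within {0..1}) b" by (rule DERIV_continuous)
  then show "(b \<longlongrightarrow> 1) (at_left 1)" by (simp add: continuous_within at_left_1 b_1)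
  show "(b' \<longlongrightarrow> b' 1) (at_left 1)"
    using Ck_on_1D(1)[OF b] by (simp add: continuous_on_def at_left_1[symmetric])
qed

text \<open>At time 1 only the square of \<open>a\<close> is known to be differentiable. Its
  derivative is continuous there and equals 2 a a' at interior times, which gives the limit of a a'
  even if a' blows up.\<close>

lemma a_sq_tendsto: "((\<lambda>t. (a t)\<^sup>2) \<longlongrightarrow> 0) (at_left 1)"
  and a_adot_tendsto: "((\<lambda>t. a t * a' t) \<longlongrightarrow> a_adot a 1) (at_left 1)"
proof -
  have a: "Ck_on 1 {0..1} (\<lambda>t. (a t)\<^sup>2)" using coeffs by (simp add: interpolation_coeffs_def)
  have "((\<lambda>t. (a t)\<^sup>2) has_real_derivative time_deriv (\<lambda>t. (a t)\<^sup>2) 1) (at 1 within {0..1})"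
    by (rule Ck_on_1D(2)[OF a]) simp
  then have "continuous (at 1 within {0..1}) (\<lambda>t. (a t)\<^sup>2)" by (rule DERIV_continuous)
  then show "((\<lambda>t. (a t)\<^sup>2) \<longlongrightarrow> 0) (at_left 1)" by (simp add: continuous_within at_left_1 a_1)
  have "((\<lambda>t. time_deriv (\<lambda>s. (a s)\<^sup>2) t / 2) \<longlongrightarrow> a_adot a 1) (at_left 1)"
    using Ck_on_1D(1)[OF a] by (auto simp: continuous_on_def at_left_1[symmetric] a_adot_def intro!: tendsto_intros)
  moreover have "\<forall>\<^sub>F t in at_left 1. time_deriv (\<lambda>s. (a s)\<^sup>2) t / 2 = a t * a' t"
    using eventually_interior
  proof eventually_elim
    case (elim t)
    have "((\<lambda>s. (a s)\<^sup>2) has_real_derivative 2 * (a t * a' t)) (at t)"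
      using a_deriv[OF elim] by (auto intro!: derivative_eq_intros)
    from time_deriv_at[OF this] elim show ?case by simp
  qed
  ultimately show "((\<lambda>t. a t * a' t) \<longlongrightarrow> a_adot a 1) (at_left 1)"
    by (rule Lim_transform_eventually)
qed

lemma a_tendsto: "(a \<longlongrightarrow> 0) (at_left 1)"
proof -
  have "((\<lambda>t. sqrt ((a t)\<^sup>2)) \<longlongrightarrow> sqrt 0) (at_left 1)"
    by (intro tendsto_real_sqrt a_sq_tendsto)
  then show ?thesis by (simp add: tendsto_rabs_zero_iff)
qed

lemma \<kappa>_tendsto: "(\<kappa> \<longlongrightarrow> - a_adot a 1) (at_left 1)"
proof -
  have "((\<lambda>t. b' t / b t * (a t)\<^sup>2 - a t * a' t) \<longlongrightarrow> b' 1 / 1 * 0 - a_adot a 1) (at_left 1)"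
    by (intro tendsto_diff tendsto_mult tendsto_divide b'_tendsto b_tendsto a_sq_tendsto a_adot_tendsto) simp
  then show ?thesis by (simp add: \<kappa>_def[abs_def])
qed

lemma a_adot_1_le: "a_adot a 1 \<le> 0"
proof (rule tendsto_upperbound[OF a_adot_tendsto])
  show "\<forall>\<^sub>F t in at_left 1. a t * a' t \<le> 0"
    using eventually_interior
    by eventually_elim (use a_pos a'_le in \<open>auto intro!: mult_nonneg_nonpos simp: less_imp_le\<close>)
qed simp

text \<open>A lower bound -K near 1 would make \<open>ln (a t) + K * t\<close> nondecreasing and
  keep \<open>a\<close> above a positive constant, whereas \<open>a\<close> tends to 0.\<close>

lemma deriv_quotient_unbounded:
  "\<not> (\<forall>\<^sub>F t in at_left 1. - K \<le> a' t / a t)"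
proof
  assume "\<forall>\<^sub>F t in at_left 1. - K \<le> a' t / a t"
  then have "\<forall>\<^sub>F t in at_left 1. - K \<le> a' t / a t \<and> t \<in> {0<..<1}"
    using eventually_interior by (rule eventually_conj)
  then obtain t0 where t0: "t0 < 1" "\<And>t. t0 < t \<Longrightarrow> t < 1 \<Longrightarrow> - K \<le> a' t / a t \<and> t \<in> {0<..<1}"
    unfolding eventually_at_left[of 0 1, OF zero_less_one] by auto
  define t1 where "t1 = (t0 + 1) / 2"
  have t1: "t0 < t1" "t1 < 1" using t0(1) by (auto simp: t1_def)
  have mono: "ln (a t1) + K * t1 \<le> ln (a t) + K * t" if t: "t1 < t" "t < 1" for t
  proof (rule DERIV_nonneg_imp_nondecreasing[of t1 t "\<lambda>t. ln (a t) + K * t"])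
    fix s assume s: "t1 \<le> s" "s \<le> t"
    then have s': "- K \<le> a' s / a s" "s \<in> {0<..<1}" using t0(2)[of s] t t1 by auto
    have "((\<lambda>t. ln (a t) + K * t) has_real_derivative (a' s / a s + K)) (at s)"
      using a_deriv[OF s'(2)] a_pos[OF s'(2)] by (auto intro!: derivative_eq_intros simp: divide_inverse)
    then show "\<exists>y. ((\<lambda>t. ln (a t) + K * t) has_real_derivative y) (at s) \<and> 0 \<le> y"
      using s'(1) by (intro exI[of _ "a' s / a s + K"]) auto
  qed (use t in simp)
  define c where "c = exp (ln (a t1) - \<bar>K\<bar>)"
  have "\<forall>\<^sub>F t in at_left 1. c \<le> a t"
    unfolding eventually_at_left[of 0 1, OF zero_less_one]
  proof (intro bexI[of _ t1] exI[of _ t1] conjI allI impI)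
    fix t assume t: "t1 < t" "t < 1"
    have "K * (t1 - t) \<ge> - \<bar>K\<bar>"
    proof -
      have "\<bar>K * (t1 - t)\<bar> = \<bar>K\<bar> * (t - t1)" using t by (simp add: abs_mult)
      also have "\<dots> \<le> \<bar>K\<bar> * 1" using t t0(2)[of t1] t1 by (intro mult_left_mono) auto
      finally show ?thesis by (simp add: abs_le_iff)
    qed
    then have "ln (a t1) - \<bar>K\<bar> \<le> ln (a t)" using mono[OF t] by (simp add: algebra_simps)
    then have "c \<le> exp (ln (a t))" by (simp add: c_def)
    then show "c \<le> a t" using a_pos[of t] t0(2)[of t] t t1 by simp
  qed (use t1 in auto)
  then have "c \<le> 0" by (rule tendsto_lowerbound[OF a_tendsto]) simp
  then show False by (simp add: c_def)
qed

end

section \<open>The velocity field of a given measure\<close>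

locale interpolated_measure = interpolation a b for a b +
  fixes \<nu> :: "(real^'n) measure"
  assumes prob: "prob_space \<nu>" and sets_\<nu>: "sets \<nu> = sets borel"
begin

lemma mixture: "t \<in> {0<..<1} \<Longrightarrow> gauss_mixture_vec \<nu> (a t) (b t)"
  using a_pos[of t] b_pos[of t] prob sets_\<nu>
  by (auto simp: gauss_mixture_vec_def gauss_mixture_def gauss_mixture_axioms_def)

abbreviation "score t \<equiv> gauss_mixture.score \<nu> (a t) (b t)"
abbreviation "hess t \<equiv> gauss_mixture.hess \<nu> (a t) (b t)"
abbreviation "mass t \<equiv> gauss_mixture.mass \<nu> (a t) (b t)"
abbreviation "mean t \<equiv> gauss_mixture.post \<nu> (a t) (b t) (\<lambda>y. y)"

lemma interior_velocity_version_iff: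
  assumes t: "t \<in> {0<..<1}"
  shows "interior_velocity_version a b \<nu> t g
    \<longleftrightarrow> g = (\<lambda>x. (a' t / a t) *\<^sub>R x + (b' t - a' t * b t / a t) *\<^sub>R mean t x)"
proof -
  interpret M: gauss_mixture_vec \<nu> "a t" "b t" by (rule mixture[OF t])
  show ?thesis
    unfolding interior_velocity_version_def
    using M.continuous_cond_exp_iff[of "a' t" "b' t" g] by (simp add: M.pair_def M.interp_def)
qed

text \<open>Two forms of the velocity are kept: this one, with the posterior mean, for half-space
  estimates outside the support, and \<open>interior_velocity_eq\<close>, with the score, for
  Hessian bounds and for the limit at time 1.\<close>

lemma interior_velocity_eq_mean:
  assumes t: "t \<in> {0<..<1}"
  shows "interior_velocity a b \<nu> t x = (a' t / a t) *\<^sub>R x + (b' t - a' t * b t / a t) *\<^sub>R mean t x"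
  unfolding interior_velocity_def interior_velocity_version_iff[OF t] by simp

lemma velocity_exists_interior: "t \<in> {0<..<1} \<Longrightarrow> velocity_exists a b \<nu> t x"
  by (auto simp: velocity_exists_def interior_velocity_version_iff)

lemma interior_velocity_eq:
  assumes t: "t \<in> {0<..<1}"
  shows "interior_velocity a b \<nu> t x = (b' t / b t) *\<^sub>R x + \<kappa> t *\<^sub>R score t x"
proof -
  interpret M: gauss_mixture_vec \<nu> "a t" "b t" by (rule mixture[OF t])
  have 1: "a' t / a t = b' t / b t - \<kappa> t / (a t)\<^sup>2" "b' t - a' t * b t / a t = \<kappa> t * (b t / (a t)\<^sup>2)"
    using M.s_pos M.b_pos unfolding \<kappa>_def by (simp_all add: field_simps power2_eq_square)
  show ?thesis
    unfolding interior_velocity_eq_mean[OF t] 1 M.score_def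
    by (simp add: algebra_simps divide_inverse)
qed

lemma velocity_has_derivative:
  assumes t: "t \<in> {0<..<1}"
  shows "(velocity a b \<nu> t has_derivative (\<lambda>h. (b' t / b t) *\<^sub>R h + \<kappa> t *\<^sub>R hess t x h)) (at x)"
proof -
  interpret M: gauss_mixture_vec \<nu> "a t" "b t" by (rule mixture[OF t])
  have "velocity a b \<nu> t = (\<lambda>x. (b' t / b t) *\<^sub>R x + \<kappa> t *\<^sub>R score t x)"
    using t interior_velocity_eq[OF t] by (auto simp: velocity_def)
  then show ?thesis
    by (auto intro!: has_derivative_add has_derivative_scaleR_right M.score_has_derivative)
qed

lemma velocity_differentiable_interior:
  assumes t: "t \<in> {0<..<1}"
  shows "velocity_differentiable a b \<nu> t x"
  unfolding velocity_differentiable_def differentiable_def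
  using velocity_has_derivative[OF t] velocity_exists_interior[OF t] by (auto intro: always_eventually)

text \<open>The coefficient \<kappa> is nonnegative, so a bound on the Hessian keeps its direction.
  The scalar comparison with \<open>c\<close> is a separate premise, through which each part
  supplies its own closed form.\<close>

lemma velocity_grad_ge:
  assumes t: "t \<in> {0<..<1}" and l: "\<And>u. l * (u \<bullet> u) \<le> u \<bullet> hess t x u" and c: "c \<le> b' t / b t + \<kappa> t * l"
  shows "mat c \<preceq> velocity_grad a b \<nu> t x"
  unfolding velocity_grad_def
proof (rule mat_le_jacobian[OF velocity_has_derivative[OF t]])
  interpret M: gauss_mixture_vec \<nu> "a t" "b t" by (rule mixture[OF t])
  show "u \<bullet> ((b' t / b t) *\<^sub>R v + \<kappa> t *\<^sub>R hess t x v) = v \<bullet> ((b' t / b t) *\<^sub>R u + \<kappa> t *\<^sub>R hess t x u)" for u v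
    using M.hess_sym[of u x v] by (simp add: inner_add_right inner_commute)
  fix u :: "real^'n"
  have "c * (u \<bullet> u) \<le> (b' t / b t + \<kappa> t * l) * (u \<bullet> u)" using c by (intro mult_right_mono) auto
  also have "\<dots> = (b' t / b t) * (u \<bullet> u) + \<kappa> t * (l * (u \<bullet> u))" by (simp add: algebra_simps)
  also have "\<dots> \<le> (b' t / b t) * (u \<bullet> u) + \<kappa> t * (u \<bullet> hess t x u)"
    using l \<kappa>_nonneg[OF t] by (intro add_left_mono mult_left_mono)
  finally show "c * (u \<bullet> u) \<le> u \<bullet> ((b' t / b t) *\<^sub>R u + \<kappa> t *\<^sub>R hess t x u)"
    by (simp add: inner_add_right)
qed

lemma velocity_grad_le:
  assumes t: "t \<in> {0<..<1}" and l: "\<And>u. u \<bullet> hess t x u \<le> l * (u \<bullet> u)" and c: "b' t / b t + \<kappa> t * l \<le> c"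
  shows "velocity_grad a b \<nu> t x \<preceq> mat c"
  unfolding velocity_grad_def
proof (rule jacobian_le_mat[OF velocity_has_derivative[OF t]])
  interpret M: gauss_mixture_vec \<nu> "a t" "b t" by (rule mixture[OF t])
  show "u \<bullet> ((b' t / b t) *\<^sub>R v + \<kappa> t *\<^sub>R hess t x v) = v \<bullet> ((b' t / b t) *\<^sub>R u + \<kappa> t *\<^sub>R hess t x u)" for u v
    using M.hess_sym[of u x v] by (simp add: inner_add_right inner_commute)
  fix u :: "real^'n"
  have "(b' t / b t) * (u \<bullet> u) + \<kappa> t * (u \<bullet> hess t x u) \<le> (b' t / b t) * (u \<bullet> u) + \<kappa> t * (l * (u \<bullet> u))"
    using l \<kappa>_nonneg[OF t] by (intro add_left_mono mult_left_mono)
  also have "\<dots> = (b' t / b t + \<kappa> t * l) * (u \<bullet> u)" by (simp add: algebra_simps)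
  also have "\<dots> \<le> c * (u \<bullet> u)" using c by (intro mult_right_mono) auto
  finally show "u \<bullet> ((b' t / b t) *\<^sub>R u + \<kappa> t *\<^sub>R hess t x u) \<le> c * (u \<bullet> u)"
    by (simp add: inner_add_right)
qed

text \<open>
  Outside the support the velocity towards the support is a bounded quantity plus a positive
  multiple of the logarithmic derivative of a, which is unbounded below near time 1.
\<close>

lemma velocity_not_exists_1:
  assumes \<delta>: "\<delta> > 0" and sep: "AE w in \<nu>. u \<bullet> w \<le> u \<bullet> y - \<delta>"
  shows "\<not> velocity_exists a b \<nu> 1 y"
proof
  assume "velocity_exists a b \<nu> 1 y"
  then obtain l where l: "((\<lambda>t. interior_velocity a b \<nu> t y) \<longlongrightarrow> l) (at_left 1)"
    by (auto simp: velocity_exists_def)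
  define C where "C = (b' 1 + 1) * \<bar>u \<bullet> y - \<delta>\<bar>"
  have "((\<lambda>t. u \<bullet> interior_velocity a b \<nu> t y) \<longlongrightarrow> u \<bullet> l) (at_left 1)"
    by (intro tendsto_intros l)
  then have e1: "\<forall>\<^sub>F t in at_left 1. u \<bullet> l - 1 < u \<bullet> interior_velocity a b \<nu> t y"
    by (rule order_tendstoD) simp
  have "((\<lambda>t. u \<bullet> y - b t * (u \<bullet> y - \<delta>)) \<longlongrightarrow> u \<bullet> y - 1 * (u \<bullet> y - \<delta>)) (at_left 1)"
    by (intro tendsto_intros b_tendsto)
  then have e2: "\<forall>\<^sub>F t in at_left 1. \<delta> / 2 < u \<bullet> y - b t * (u \<bullet> y - \<delta>)"
    by (rule order_tendstoD) (use \<delta> in simp)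
  have e3: "\<forall>\<^sub>F t in at_left 1. b' t < b' 1 + 1"
    by (rule order_tendstoD[OF b'_tendsto]) simp
  have "\<forall>\<^sub>F t in at_left 1. - ((C - u \<bullet> l + 1) * 2 / \<delta>) \<le> a' t / a t"
    using eventually_interior e1 e2 e3
  proof eventually_elim
    case (elim t)
    interpret M: gauss_mixture_vec \<nu> "a t" "b t" by (rule mixture) (use elim in simp)
    define P where "P = u \<bullet> mean t y"
    \<comment> \<open>A half-space that carries \<nu> carries every posterior, hence contains the
      posterior mean.\<close>
    have "M.post (\<lambda>w. u \<bullet> w) y \<le> M.post (\<lambda>_. u \<bullet> y - \<delta>) y"
      using sep by (intro M.post_mono) auto
    then have P: "P \<le> u \<bullet> y - \<delta>" by (simp add: P_def M.post_inner M.post_const)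
    have neg: "a' t / a t \<le> 0" using a'_le[of t] M.s_pos elim by (simp add: divide_nonpos_pos)
    have bP: "b t * P \<le> b t * (u \<bullet> y - \<delta>)" using P M.b_pos by (intro mult_left_mono) auto
    have "u \<bullet> interior_velocity a b \<nu> t y = (a' t / a t) * (u \<bullet> y - b t * P) + b' t * P"
      unfolding interior_velocity_eq_mean[OF elim(1)] P_def by (simp add: inner_add_right algebra_simps)
    also have "\<dots> \<le> (a' t / a t) * (\<delta> / 2) + C"
    proof (rule add_mono)
      \<comment> \<open>The quotient a'/a is nonpositive, so replacing the gap by its lower bound
        \<delta> / 2 can only increase the product.\<close>
      show "(a' t / a t) * (u \<bullet> y - b t * P) \<le> (a' t / a t) * (\<delta> / 2)"
        using neg bP elim(3) by (intro mult_left_mono_neg) auto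
      have b': "0 \<le> b' t" using b'_ge[of t] elim by auto
      have "b' t * P \<le> b' t * \<bar>u \<bullet> y - \<delta>\<bar>" using P b' by (intro mult_left_mono) auto
      also have "\<dots> \<le> C" unfolding C_def using elim(4) by (intro mult_right_mono) auto
      finally show "b' t * P \<le> C" .
    qed
    finally have "u \<bullet> l - 1 - C \<le> (a' t / a t) * (\<delta> / 2)" using elim(2) by linarith
    then have "(u \<bullet> l - 1 - C) * 2 / \<delta> \<le> a' t / a t" using \<delta> by (simp add: field_simps)
    then show ?case by (simp add: algebra_simps minus_divide_left)
  qed
  then show False using deriv_quotient_unbounded by blast
qed

text \<open>The coefficient of the score tends to \<open>- a_adot a 1\<close>. With G the gradient
  of the potential, the limit of the score is -G, and the two signs cancel.\<close>

lemma velocity_1: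
  assumes "((\<lambda>t. score t x) \<longlongrightarrow> - G) (at_left 1)"
  shows "velocity_exists a b \<nu> 1 x" "velocity a b \<nu> 1 x = b' 1 *\<^sub>R x + a_adot a 1 *\<^sub>R G"
proof -
  have A: "((\<lambda>t. (b' t / b t) *\<^sub>R x + \<kappa> t *\<^sub>R score t x) \<longlongrightarrow> (b' 1 / 1) *\<^sub>R x + (- a_adot a 1) *\<^sub>R (- G)) (at_left 1)"
    by (intro tendsto_add tendsto_scaleR tendsto_divide tendsto_const b'_tendsto b_tendsto \<kappa>_tendsto assms) simp
  have B: "\<forall>\<^sub>F t in at_left 1. (b' t / b t) *\<^sub>R x + \<kappa> t *\<^sub>R score t x = interior_velocity a b \<nu> t x"
    using eventually_interior by eventually_elim (simp add: interior_velocity_eq)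
  have lim: "((\<lambda>t. interior_velocity a b \<nu> t x) \<longlongrightarrow> b' 1 *\<^sub>R x + a_adot a 1 *\<^sub>R G) (at_left 1)"
    using Lim_transform_eventually[OF A B] by simp
  then show "velocity_exists a b \<nu> 1 x" by (auto simp: velocity_exists_def)
  show "velocity a b \<nu> 1 x = b' 1 *\<^sub>R x + a_adot a 1 *\<^sub>R G"
    using tendsto_Lim[OF _ lim] by (simp add: velocity_def)
qed

text \<open>At time 1 the velocity is given by the formula only where the scores converge; an open
  set of such points makes it differentiable in the full sense.\<close>

lemma
  assumes "open S" "x \<in> S" and lim: "\<And>y. y \<in> S \<Longrightarrow> ((\<lambda>t. score t y) \<longlongrightarrow> - G y) (at_left 1)"
    and G: "(G has_derivative (\<lambda>h. H *v h)) (at x)"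
  shows velocity_differentiable_1: "velocity_differentiable a b \<nu> 1 x"
    and velocity_1_has_derivative:
      "(velocity a b \<nu> 1 has_derivative (\<lambda>h. b' 1 *\<^sub>R h + a_adot a 1 *\<^sub>R (H *v h))) (at x)"
proof -
  have "((\<lambda>x. b' 1 *\<^sub>R x + a_adot a 1 *\<^sub>R G x) has_derivative (\<lambda>h. b' 1 *\<^sub>R h + a_adot a 1 *\<^sub>R (H *v h))) (at x)"
    by (intro has_derivative_add has_derivative_scaleR_right has_derivative_ident G)
  then show D: "(velocity a b \<nu> 1 has_derivative (\<lambda>h. b' 1 *\<^sub>R h + a_adot a 1 *\<^sub>R (H *v h))) (at x)"
    by (rule has_derivative_transform_within_open[OF _ assms(1,2)]) (simp add: velocity_1(2)[OF lim])
  have "\<forall>\<^sub>F y in nhds x. velocity_exists a b \<nu> 1 y"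
    unfolding eventually_nhds using assms(1,2) velocity_1(1)[OF lim] by blast
  then show "velocity_differentiable a b \<nu> 1 x"
    unfolding velocity_differentiable_def differentiable_def using D by blast
qed

end

section \<open>Limits of the score at the final time\<close>

lemma integrable_gauss_density:
  "\<sigma> > 0 \<Longrightarrow> integrable lborel (gauss_density \<sigma> :: real^'n \<Rightarrow> real)"
  "\<sigma> > 0 \<Longrightarrow> (\<integral>z. gauss_density \<sigma> (z :: real^'n) \<partial>lborel) = 1"
proof -
  assume "\<sigma> > 0"
  then have 1: "(\<integral>\<^sup>+z. gauss_density \<sigma> (z :: real^'n) \<partial>lborel) = 1"
    by (rule nn_integral_gauss_density)
  then show "integrable lborel (gauss_density \<sigma> :: real^'n \<Rightarrow> real)"
    by (intro integrableI_nonneg) auto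
  show "(\<integral>z. gauss_density \<sigma> (z :: real^'n) \<partial>lborel) = 1"
    using 1 by (subst integral_eq_nn_integral) auto
qed

lemma integral_lborel_affine:
  fixes t :: "'a::euclidean_space" and f :: "'a \<Rightarrow> real"
  assumes [measurable]: "f \<in> borel_measurable borel" and "c \<noteq> 0"
  shows "(\<integral>x. f x \<partial>lborel) = \<bar>c\<bar> ^ DIM('a) * (\<integral>x. f (t + c *\<^sub>R x) \<partial>lborel)"
  using \<open>c \<noteq> 0\<close>
  by (subst lborel_affine[of c t]) (simp_all add: integral_real_density integral_distr)

text \<open>For s < 1 the normalisation, of order s^(-d), is enlarged to s^(-2d), a multiple of X^d
  with X = c / s^2; then X^d / exp X tends to 0.\<close>

lemma gauss_density_tail_tendsto_0:
  fixes s :: "nat \<Rightarrow> real"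
  assumes s: "\<And>n. 0 < s n" "s \<longlonglongrightarrow> 0" and c: "0 < c"
  shows "(\<lambda>n. (1 / sqrt (2 * pi * (s n)\<^sup>2)) ^ d * exp (- c / (s n)\<^sup>2)) \<longlonglongrightarrow> 0"
proof -
  define X where "X n = c * inverse ((s n)\<^sup>2)" for n
  have "((\<lambda>n. (s n)\<^sup>2) \<longlongrightarrow> 0\<^sup>2) sequentially" by (intro tendsto_power s)
  then have "filterlim (\<lambda>n. inverse ((s n)\<^sup>2)) at_top sequentially"
    using s(1) by (intro filterlim_inverse_at_top) (auto simp: zero_less_power2 less_imp_neq[symmetric])
  then have "filterlim X at_top sequentially"
    unfolding X_def by (rule filterlim_tendsto_pos_mult_at_top[OF tendsto_const c])
  then have "(\<lambda>n. (X n) ^ d / exp (X n)) \<longlonglongrightarrow> 0"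
    by (rule filterlim_compose[OF tendsto_power_div_exp_0])
  then have "(\<lambda>n. (1 / c) ^ d * ((X n) ^ d / exp (X n))) \<longlonglongrightarrow> (1 / c) ^ d * 0"
    by (rule tendsto_mult_left)
  then have lim: "(\<lambda>n. (1 / c) ^ d * ((X n) ^ d / exp (X n))) \<longlonglongrightarrow> 0" by simp
  have "\<forall>\<^sub>F n in sequentially. s n < 1" by (rule order_tendstoD[OF s(2)]) simp
  then have "\<forall>\<^sub>F n in sequentially. norm ((1 / sqrt (2 * pi * (s n)\<^sup>2)) ^ d * exp (- c / (s n)\<^sup>2))
      \<le> (1 / c) ^ d * ((X n) ^ d / exp (X n))"
  proof eventually_elim
    case (elim n)
    have sn: "0 < s n" by (rule s)
    have "(s n)\<^sup>2 \<le> s n * 1" unfolding power2_eq_square using elim sn by (intro mult_left_mono) auto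
    also have "\<dots> \<le> sqrt (2 * pi * (s n)\<^sup>2)"
    proof (rule real_le_rsqrt)
      have "1 * (s n)\<^sup>2 \<le> 2 * pi * (s n)\<^sup>2" using pi_ge_two by (intro mult_right_mono) auto
      then show "(s n * 1)\<^sup>2 \<le> 2 * pi * (s n)\<^sup>2" by simp
    qed
    finally have "1 / sqrt (2 * pi * (s n)\<^sup>2) \<le> 1 / (s n)\<^sup>2"
      using sn by (intro divide_left_mono) auto
    then have "(1 / sqrt (2 * pi * (s n)\<^sup>2)) ^ d * exp (- c / (s n)\<^sup>2) \<le> (1 / (s n)\<^sup>2) ^ d * exp (- c / (s n)\<^sup>2)"
      by (intro mult_right_mono power_mono) auto
    also have "(1 / (s n)\<^sup>2) ^ d = (1 / c) ^ d * (X n) ^ d"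
    proof -
      have "1 / (s n)\<^sup>2 = (1 / c) * X n" using c by (simp add: X_def divide_inverse)
      then show ?thesis by (simp only: power_mult_distrib)
    qed
    finally show ?case
      by (simp add: X_def exp_minus divide_inverse)
  qed
  then show ?thesis using lim by (rule Lim_null_comparison)
qed

text \<open>Away from \<open>x\<close> the function \<open>p\<close> may be unbounded and
  discontinuous, so the integral is split at a ball around \<open>x\<close>. Inside,
  \<open>p\<close> is at most p x + 1 and dominated convergence applies; outside, the Gaussian tail
  is multiplied by a finite integral.\<close>

lemma gauss_mollifier_tendsto:
  fixes p :: "real^'n \<Rightarrow> real" and s \<beta> :: "nat \<Rightarrow> real"
  assumes p [measurable]: "p \<in> borel_measurable borel" and nn: "\<And>y. 0 \<le> p y"
    and int: "integrable lborel p" and cont: "isCont p x"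
    and s: "\<And>n. 0 < s n" "s \<longlonglongrightarrow> 0" and \<beta>: "\<And>n. 0 < \<beta> n" "\<beta> \<longlonglongrightarrow> 1"
  shows "(\<lambda>n. \<beta> n ^ CARD('n) * (\<integral>y. gauss_density (s n) (x - \<beta> n *\<^sub>R y) * p y \<partial>lborel)) \<longlonglongrightarrow> p x"
proof -
  obtain \<delta> where \<delta>: "0 < \<delta>" "\<And>y. dist y x < \<delta> \<Longrightarrow> \<bar>p y - p x\<bar> < 1"
    using cont[unfolded continuous_at_eps_delta, rule_format, of 1] by (auto simp: dist_real_def)
  define B where "B = ball x \<delta>"
  define p1 p2 where "p1 y = p y * indicator B y" and "p2 y = p y * indicator (- B) y" for y
  have B [measurable]: "B \<in> sets borel" by (simp add: B_def)
  have [measurable]: "p1 \<in> borel_measurable borel" "p2 \<in> borel_measurable borel"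
    unfolding p1_def p2_def by measurable
  have i12: "integrable lborel p1" "integrable lborel p2"
    unfolding p1_def[abs_def] p2_def[abs_def] using int by (auto intro!: integrable_real_mult_indicator)
  define g where "g n y = gauss_density (s n) (x - \<beta> n *\<^sub>R y)" for n y
  have [measurable]: "g n \<in> borel_measurable borel" for n unfolding g_def by measurable
  have g_nn: "0 \<le> g n y" for n y by (simp add: g_def)
  have g_le: "g n y \<le> (1 / sqrt (2 * pi * (s n)\<^sup>2)) ^ CARD('n)" for n y
    unfolding g_def gauss_density_def by (rule mult_left_le) auto
  have gi: "integrable lborel (\<lambda>y. g n y * k y)" if k: "integrable lborel k" for n k
  proof (rule Bochner_Integration.integrable_bound)
    show "integrable lborel (\<lambda>y. (1 / sqrt (2 * pi * (s n)\<^sup>2)) ^ CARD('n) * k y)" using k by simp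
    show "(\<lambda>y. g n y * k y) \<in> borel_measurable lborel" using borel_measurable_integrable[OF k] by measurable
    show "AE y in lborel. norm (g n y * k y) \<le> norm ((1 / sqrt (2 * pi * (s n)\<^sup>2)) ^ CARD('n) * k y)"
      using g_nn g_le by (auto simp: abs_mult intro!: mult_right_mono order_trans[OF g_le])
  qed
  have "(\<lambda>n. \<beta> n ^ CARD('n) * (\<integral>y. g n y * p1 y \<partial>lborel)) \<longlonglongrightarrow> p x"
  proof -
    \<comment> \<open>Substitution y = (x - s z) / \<beta>: the Jacobian is (s / \<beta>)^d, whose
      denominator is cancelled by the prefactor.\<close>
    have sub: "\<beta> n ^ CARD('n) * (\<integral>y. g n y * p1 y \<partial>lborel)
        = (\<integral>z. gauss_density 1 z * p1 ((1 / \<beta> n) *\<^sub>R x + (- s n / \<beta> n) *\<^sub>R z) \<partial>lborel)" for n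
    proof -
      have gz: "g n ((1 / \<beta> n) *\<^sub>R x + (- s n / \<beta> n) *\<^sub>R z) = gauss_density (s n) (s n *\<^sub>R z)" for z
        using \<beta>(1)[of n] by (simp add: g_def scaleR_diff_right)
      have "(\<integral>y. g n y * p1 y \<partial>lborel) = \<bar>- s n / \<beta> n\<bar> ^ CARD('n) *
        (\<integral>z. g n ((1 / \<beta> n) *\<^sub>R x + (- s n / \<beta> n) *\<^sub>R z) * p1 ((1 / \<beta> n) *\<^sub>R x + (- s n / \<beta> n) *\<^sub>R z) \<partial>lborel)"
        using s(1)[of n] \<beta>(1)[of n]
        by (subst integral_lborel_affine[where c="- s n / \<beta> n" and t="(1 / \<beta> n) *\<^sub>R x"]) auto
      then have "\<beta> n ^ CARD('n) * (\<integral>y. g n y * p1 y \<partial>lborel) = (s n) ^ CARD('n)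
          * (\<integral>z. gauss_density (s n) (s n *\<^sub>R z) * p1 ((1 / \<beta> n) *\<^sub>R x + (- s n / \<beta> n) *\<^sub>R z) \<partial>lborel)"
        using s(1)[of n] \<beta>(1)[of n] unfolding gz by (simp add: power_divide)
      also have "\<dots> = (\<integral>z. (s n ^ CARD('n) * gauss_density (s n) (s n *\<^sub>R z)) * p1 ((1 / \<beta> n) *\<^sub>R x + (- s n / \<beta> n) *\<^sub>R z) \<partial>lborel)"
        by (simp add: mult.assoc)
      finally show ?thesis by (simp only: gauss_density_scale[OF s(1)])
    qed
    have "(\<lambda>n. \<integral>z. gauss_density 1 z * p1 ((1 / \<beta> n) *\<^sub>R x + (- s n / \<beta> n) *\<^sub>R z) \<partial>lborel)
        \<longlonglongrightarrow> (\<integral>z. gauss_density 1 (z :: real^'n) * p x \<partial>lborel)"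
    proof (rule integral_dominated_convergence[where w="\<lambda>z. gauss_density 1 z * (p x + 1)"])
      show "integrable lborel (\<lambda>z::real^'n. gauss_density 1 z * (p x + 1))"
        by (intro integrable_mult_left integrable_gauss_density) simp
      have "isCont p1 x"
      proof -
        have "\<forall>\<^sub>F y in nhds x. p1 y = p y"
          unfolding eventually_nhds by (rule exI[of _ B]) (auto simp: B_def p1_def \<delta>(1))
        then show ?thesis using cont by (simp add: isCont_cong)
      qed
      then have "(\<lambda>n. p1 ((1 / \<beta> n) *\<^sub>R x + (- s n / \<beta> n) *\<^sub>R z)) \<longlonglongrightarrow> p1 x" for z
      proof (rule isCont_tendsto_compose)
        have "(\<lambda>n. (1 / \<beta> n) *\<^sub>R x + (- s n / \<beta> n) *\<^sub>R z) \<longlonglongrightarrow> (1 / 1) *\<^sub>R x + (- 0 / 1) *\<^sub>R z"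
          by (intro tendsto_intros s \<beta>) simp_all
        then show "(\<lambda>n. (1 / \<beta> n) *\<^sub>R x + (- s n / \<beta> n) *\<^sub>R z) \<longlonglongrightarrow> x" by simp
      qed
      moreover have "p1 x = p x" by (simp add: p1_def B_def \<delta>(1))
      ultimately show "AE z in lborel. (\<lambda>n. gauss_density 1 z * p1 ((1 / \<beta> n) *\<^sub>R x + (- s n / \<beta> n) *\<^sub>R z)) \<longlonglongrightarrow> gauss_density 1 z * p x"
        by (auto intro!: tendsto_mult_left)
      have "norm (p1 y) \<le> p x + 1" for y
        using \<delta>(2)[of y] nn[of y] nn[of x] by (auto simp: p1_def B_def indicator_def dist_commute abs_if split: if_splits)
      then show "AE z in lborel. norm (gauss_density 1 z * p1 ((1 / \<beta> n) *\<^sub>R x + (- s n / \<beta> n) *\<^sub>R z)) \<le> gauss_density 1 z * (p x + 1)" for n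
        by (auto simp: abs_mult intro!: mult_left_mono)
    qed measurable
    then show ?thesis unfolding sub by (simp add: integrable_gauss_density)
  qed
  moreover have "(\<lambda>n. \<beta> n ^ CARD('n) * (\<integral>y. g n y * p2 y \<partial>lborel)) \<longlonglongrightarrow> 0"
  proof -
    \<comment> \<open>Outside the ball |x - \<beta> y| is at least \<beta> \<delta> - |1 - \<beta>|
      |x|, which eventually exceeds \<delta> / 2. The square of \<delta> / 2 over 2 s^2 is the
      exponent of \<open>T\<close>.\<close>
    define T where "T n = (1 / sqrt (2 * pi * (s n)\<^sup>2)) ^ CARD('n) * exp (- (\<delta>\<^sup>2 / 8) / (s n)\<^sup>2)" for n
    have "(\<lambda>n. \<beta> n * \<delta> - \<bar>1 - \<beta> n\<bar> * norm x) \<longlonglongrightarrow> 1 * \<delta> - \<bar>1 - 1\<bar> * norm x"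
      by (intro tendsto_intros \<beta>)
    then have "\<forall>\<^sub>F n in sequentially. \<delta> / 2 < \<beta> n * \<delta> - \<bar>1 - \<beta> n\<bar> * norm x"
      by (rule order_tendstoD) (use \<delta>(1) in simp)
    then have "\<forall>\<^sub>F n in sequentially. norm (\<beta> n ^ CARD('n) * (\<integral>y. g n y * p2 y \<partial>lborel))
        \<le> \<beta> n ^ CARD('n) * (T n * (\<integral>y. p2 y \<partial>lborel))"
    proof eventually_elim
      case (elim n)
      have pt: "g n y * p2 y \<le> T n * p2 y" for y
      proof (cases "y \<in> B")
        case False
        then have "\<delta> \<le> norm (x - y)" by (simp add: B_def dist_norm)
        then have "\<beta> n * \<delta> \<le> \<beta> n * norm (x - y)" using \<beta>(1)[of n] by (intro mult_left_mono) auto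
        also have "\<dots> = norm (\<beta> n *\<^sub>R (x - y))" using \<beta>(1)[of n] by simp
        also have "\<beta> n *\<^sub>R (x - y) = (x - \<beta> n *\<^sub>R y) - (1 - \<beta> n) *\<^sub>R x"
          by (simp add: algebra_simps)
        also have "norm \<dots> \<le> norm (x - \<beta> n *\<^sub>R y) + \<bar>1 - \<beta> n\<bar> * norm x"
          using norm_triangle_ineq4[of "x - \<beta> n *\<^sub>R y" "(1 - \<beta> n) *\<^sub>R x"] by simp
        finally have "\<delta> / 2 \<le> norm (x - \<beta> n *\<^sub>R y)" using elim by linarith
        then have "(\<delta> / 2)\<^sup>2 \<le> (norm (x - \<beta> n *\<^sub>R y))\<^sup>2" using \<delta>(1) by (intro power_mono) auto
        then have "- (norm (x - \<beta> n *\<^sub>R y))\<^sup>2 / (2 * (s n)\<^sup>2) \<le> - (\<delta>\<^sup>2 / 4) / (2 * (s n)\<^sup>2)"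
          by (intro divide_right_mono) (auto simp: power_divide)
        also have "\<dots> = - (\<delta>\<^sup>2 / 8) / (s n)\<^sup>2" by simp
        finally have "g n y \<le> T n"
          unfolding g_def gauss_density_def T_def by (intro mult_left_mono) auto
        then show ?thesis by (intro mult_right_mono) (auto simp: p2_def nn)
      qed (simp add: p2_def)
      have "(\<integral>y. g n y * p2 y \<partial>lborel) \<le> (\<integral>y. T n * p2 y \<partial>lborel)"
        using pt by (intro integral_mono gi i12) (simp_all add: i12)
      moreover have "0 \<le> (\<integral>y. g n y * p2 y \<partial>lborel)"
        by (intro integral_nonneg_AE) (auto simp: g_nn p2_def nn)
      ultimately show ?case using \<beta>(1)[of n] by (simp add: abs_mult)
    qed
    moreover have "(\<lambda>n. \<beta> n ^ CARD('n) * (T n * (\<integral>y. p2 y \<partial>lborel))) \<longlonglongrightarrow> 1 ^ CARD('n) * (0 * (\<integral>y. p2 y \<partial>lborel))"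
      unfolding T_def by (intro tendsto_intros \<beta> gauss_density_tail_tendsto_0 s) (use \<delta>(1) in simp)
    then have "(\<lambda>n. \<beta> n ^ CARD('n) * (T n * (\<integral>y. p2 y \<partial>lborel))) \<longlonglongrightarrow> 0" by simp
    ultimately show ?thesis by (rule Lim_null_comparison)
  qed
  ultimately have "(\<lambda>n. \<beta> n ^ CARD('n) * (\<integral>y. g n y * p1 y \<partial>lborel) + \<beta> n ^ CARD('n) * (\<integral>y. g n y * p2 y \<partial>lborel)) \<longlonglongrightarrow> p x + 0"
    by (rule tendsto_add)
  moreover have "\<beta> n ^ CARD('n) * (\<integral>y. g n y * p1 y \<partial>lborel) + \<beta> n ^ CARD('n) * (\<integral>y. g n y * p2 y \<partial>lborel)
      = \<beta> n ^ CARD('n) * (\<integral>y. g n y * p y \<partial>lborel)" for n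
  proof -
    have "(\<integral>y. g n y * p y \<partial>lborel) = (\<integral>y. g n y * p1 y + g n y * p2 y \<partial>lborel)"
      by (intro Bochner_Integration.integral_cong) (auto simp: p1_def p2_def indicator_def)
    also have "\<dots> = (\<integral>y. g n y * p1 y \<partial>lborel) + (\<integral>y. g n y * p2 y \<partial>lborel)"
      by (intro Bochner_Integration.integral_add gi i12)
    finally show ?thesis by (simp add: distrib_left)
  qed
  ultimately show ?thesis by (simp add: g_def)
qed

section \<open>Convergence of masses and scores for a measure with a density\<close>

locale interpolated_density = interpolated_measure a b \<nu> for a b and \<nu> :: "(real^'n) measure" +
  fixes p :: "real^'n \<Rightarrow> real"
  assumes p_meas [measurable]: "p \<in> borel_measurable borel" and p_nonneg: "\<And>x. 0 \<le> p x"
    and nu_eq: "\<nu> = density lborel (\<lambda>x. ennreal (p x))"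
begin

lemma density_mixture: "t \<in> {0<..<1} \<Longrightarrow> density_mixture \<nu> (a t) (b t) p"
  using mixture[of t] p_meas p_nonneg nu_eq
  by (auto simp: density_mixture_def density_mixture_axioms_def)

lemma nn_integral_p: "(\<integral>\<^sup>+x. ennreal (p x) \<partial>lborel) = 1"
proof -
  have "emeasure \<nu> UNIV = 1" using prob prob_space.emeasure_space_1 nu_eq by fastforce
  then show ?thesis by (subst (asm) nu_eq) (simp add: emeasure_density)
qed

lemma integrable_p: "integrable lborel p"
  using nn_integral_p p_nonneg by (intro integrableI_nonneg) auto

text \<open>Jacobian of the dilation by \<open>b t\<close> times the Gaussian normalisation. It
  depends on time alone, so it cancels from differences of \<open>ln (mass t x)\<close> between two
  points.\<close>

definition normalizer :: "real \<Rightarrow> real" where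
  "normalizer t = b t ^ CARD('n) * (1 / sqrt (2 * pi * (a t)\<^sup>2)) ^ CARD('n)"

lemma normalizer_pos: "t \<in> {0<..<1} \<Longrightarrow> 0 < normalizer t"
  using a_pos[of t] b_pos[of t] by (simp add: normalizer_def)

lemma mass_tendsto:
  assumes "isCont p x"
  shows "((\<lambda>t. normalizer t * mass t x) \<longlongrightarrow> p x) (at_left 1)"
proof (rule tendsto_at_left_sequentially[of 0])
  fix S :: "nat \<Rightarrow> real" assume S: "\<And>n. S n < 1" "\<And>n. 0 < S n" "S \<longlonglongrightarrow> 1"
  then have St: "S n \<in> {0<..<1}" for n by simp
  have fl: "filterlim S (at_left 1) sequentially"
    using S by (auto simp: filterlim_at less_imp_neq intro!: always_eventually)
  have eq: "normalizer (S n) * mass (S n) x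
      = b (S n) ^ CARD('n) * (\<integral>y. gauss_density (a (S n)) (x - b (S n) *\<^sub>R y) * p y \<partial>lborel)" for n
  proof -
    interpret M: density_mixture \<nu> "a (S n)" "b (S n)" p by (rule density_mixture[OF St])
    have "mass (S n) x = (\<integral>y. M.kernel x y * p y \<partial>lborel)"
      using M.mass_pos[of x] M.nn_integral_kernel_density[of x]
      by (subst integral_eq_nn_integral) (auto simp: p_nonneg less_imp_le)
    then show ?thesis
      by (simp add: normalizer_def gauss_density_def M.kernel_def mult.assoc)
  qed
  show "(\<lambda>n. normalizer (S n) * mass (S n) x) \<longlonglongrightarrow> p x"
    unfolding eq
    by (intro gauss_mollifier_tendsto p_meas p_nonneg integrable_p assms a_pos b_pos St
        filterlim_compose[OF a_tendsto fl] filterlim_compose[OF b_tendsto fl])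
qed simp

lemma ln_mass_diff_tendsto:
  assumes "isCont p x" "isCont p y" "0 < p x" "0 < p y"
  shows "((\<lambda>t. ln (mass t y) - ln (mass t x)) \<longlongrightarrow> ln (p y) - ln (p x)) (at_left 1)"
proof -
  have A: "((\<lambda>t. ln (normalizer t * mass t y) - ln (normalizer t * mass t x)) \<longlongrightarrow> ln (p y) - ln (p x)) (at_left 1)"
    by (intro tendsto_diff tendsto_ln mass_tendsto) (use assms in auto)
  have B: "\<forall>\<^sub>F t in at_left 1. ln (normalizer t * mass t y) - ln (normalizer t * mass t x) = ln (mass t y) - ln (mass t x)"
    using eventually_interior
  proof eventually_elim
    case (elim t)
    interpret M: density_mixture \<nu> "a t" "b t" p by (rule density_mixture[OF elim])
    show ?case using normalizer_pos[OF elim] M.mass_pos[of x] M.mass_pos[of y] by (simp add: ln_mult)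
  qed
  from Lim_transform_eventually[OF A B] show ?thesis .
qed

text \<open>A lower Hessian bound with one constant, valid for all points and all times near 1,
  makes the functions \<open>ln (mass t x)\<close> uniformly semiconvex, so that pointwise
  convergence carries over to gradients.\<close>

lemma score_tendsto_convex:
  assumes S: "open S" "x \<in> S" "\<And>y. y \<in> S \<Longrightarrow> isCont p y \<and> 0 < p y"
    and G: "((\<lambda>y. ln (p y)) has_derivative (\<lambda>h. G \<bullet> h)) (at x)"
    and H: "\<forall>\<^sub>F t in at_left 1. \<forall>x u. - C * (u \<bullet> u) \<le> u \<bullet> hess t x u"
  shows "((\<lambda>t. score t x) \<longlongrightarrow> G) (at_left 1)"
proof -
  obtain r where r: "r > 0" "ball x r \<subseteq> S" using S(1,2) by (auto simp: open_contains_ball)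
  show ?thesis
  proof (rule tendsto_gradient_semiconvex[where C="C / 2" and F="\<lambda>t y. ln (mass t y)", OF _ r(1) _ G])
    show "\<forall>\<^sub>F t in at_left 1. \<forall>d. score t x \<bullet> d - C / 2 * (d \<bullet> d) \<le> ln (mass t (x + d)) - ln (mass t x)"
      using H eventually_interior
    proof eventually_elim
      case (elim t)
      interpret M: density_mixture \<nu> "a t" "b t" p by (rule density_mixture[OF elim(2)])
      show ?case
        using gradient_inequality_semiconvex[OF M.ln_mass_has_derivative M.score_has_derivative] elim(1) by blast
    qed
    show "((\<lambda>t. ln (mass t y) - ln (mass t x)) \<longlongrightarrow> ln (p y) - ln (p x)) (at_left 1)" if "dist y x < r" for y
      using that r(2) S(2,3) by (intro ln_mass_diff_tendsto) (auto simp: subset_iff dist_commute)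
  qed
qed

text \<open>Semiconcave functions are negatives of semiconvex ones, and gradient convergence is
  insensitive to the sign.\<close>

lemma score_tendsto_concave:
  assumes S: "open S" "x \<in> S" "\<And>y. y \<in> S \<Longrightarrow> isCont p y \<and> 0 < p y"
    and G: "((\<lambda>y. ln (p y)) has_derivative (\<lambda>h. G \<bullet> h)) (at x)"
    and H: "\<forall>\<^sub>F t in at_left 1. \<forall>x u. u \<bullet> hess t x u \<le> C * (u \<bullet> u)"
  shows "((\<lambda>t. score t x) \<longlongrightarrow> G) (at_left 1)"
proof -
  obtain r where r: "r > 0" "ball x r \<subseteq> S" using S(1,2) by (auto simp: open_contains_ball)
  have G': "((\<lambda>y. - ln (p y)) has_derivative (\<lambda>h. (- G) \<bullet> h)) (at x)"
    using has_derivative_minus[OF G] by simp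
  have "((\<lambda>t. - score t x) \<longlongrightarrow> - G) (at_left 1)"
  proof (rule tendsto_gradient_semiconvex[where C="C / 2" and F="\<lambda>t y. - ln (mass t y)", OF _ r(1) _ G'])
    show "\<forall>\<^sub>F t in at_left 1. \<forall>d. (- score t x) \<bullet> d - C / 2 * (d \<bullet> d) \<le> - ln (mass t (x + d)) - - ln (mass t x)"
      using H eventually_interior
    proof eventually_elim
      case (elim t)
      interpret M: density_mixture \<nu> "a t" "b t" p by (rule density_mixture[OF elim(2)])
      have "((\<lambda>y. - ln (M.mass y)) has_derivative (\<lambda>h. (- M.score y) \<bullet> h)) (at y)" for y
        using has_derivative_minus[OF M.ln_mass_has_derivative] by simp
      moreover have "((\<lambda>y. - M.score y) has_derivative (\<lambda>h. - M.hess y h)) (at y)" for y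
        by (rule has_derivative_minus[OF M.score_has_derivative])
      moreover have "- C * (u \<bullet> u) \<le> u \<bullet> (- M.hess y u)" for y u
        using elim(1) by simp
      ultimately show ?case
        using gradient_inequality_semiconvex[where F="\<lambda>y. - ln (M.mass y)" and g="\<lambda>y. - M.score y"
          and H="\<lambda>y h. - M.hess y h" and c=C] by blast
    qed
    show "((\<lambda>t. - ln (mass t y) - - ln (mass t x)) \<longlongrightarrow> - ln (p y) - - ln (p x)) (at_left 1)" if "dist y x < r" for y
    proof -
      have "((\<lambda>t. ln (mass t y) - ln (mass t x)) \<longlongrightarrow> ln (p y) - ln (p x)) (at_left 1)"
        using that r(2) S(2,3) by (intro ln_mass_diff_tendsto) (auto simp: subset_iff dist_commute)
      from tendsto_minus[OF this] show ?thesis by simp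
    qed
  qed
  from tendsto_minus[OF this] show ?thesis by simp
qed

end

section \<open>Gradient bounds\<close>

text \<open>The complement of the support is a union of open null sets, and the Lindelof property
  reduces it to a countable union.\<close>

lemma AE_measure_supp:
  fixes \<nu> :: "'a::second_countable_topology measure"
  assumes "sets \<nu> = sets borel"
  shows "AE y in \<nu>. y \<in> measure_supp \<nu>"
proof -
  define F where "F = {S. open S \<and> emeasure \<nu> S = 0}"
  obtain F' where F': "F' \<subseteq> F" "countable F'" "\<Union>F' = \<Union>F"
    using Lindelof[of F] by (auto simp: F_def)
  have "(\<Union>S\<in>F'. S) \<in> null_sets \<nu>"
    using F' assms by (intro null_sets_UN') (auto simp: F_def null_sets_def)
  moreover have "- measure_supp \<nu> \<subseteq> (\<Union>S\<in>F'. S)"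
    using F'(3) by (auto simp: measure_supp_def F_def zero_less_iff_neq_zero)
  ultimately show ?thesis by (intro AE_I'[of "\<Union>S\<in>F'. S"]) auto
qed

text \<open>Projected to a line, the support lies in an interval whose length is at most the diameter.\<close>

lemma AE_inner_bounded_support:
  fixes \<nu> :: "'a::euclidean_space measure"
  assumes "prob_space \<nu>" "sets \<nu> = sets borel" and bdd: "bounded (measure_supp \<nu>)"
  shows "\<exists>c. AE y in \<nu>. \<bar>u \<bullet> y - c\<bar> \<le> norm u * diameter (measure_supp \<nu>) / 2"
proof -
  interpret prob_space \<nu> by fact
  define S where "S = measure_supp \<nu>"
  have AE: "AE y in \<nu>. y \<in> S" unfolding S_def by (rule AE_measure_supp) fact
  then have ne: "S \<noteq> {}" by auto
  define L where "L = norm u * diameter S"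
  have le: "u \<bullet> y \<le> u \<bullet> z + L" if "y \<in> S" "z \<in> S" for y z
  proof -
    have "u \<bullet> (y - z) \<le> norm u * norm (y - z)" by (rule norm_cauchy_schwarz)
    also have "\<dots> \<le> L"
      unfolding L_def using diameter_bounded_bound[of S y z] bdd that
      by (intro mult_left_mono) (auto simp: S_def dist_norm)
    finally show ?thesis by (simp add: inner_diff_right)
  qed
  define s where "s = Sup ((\<bullet>) u ` S)"
  obtain y0 where "y0 \<in> S" using ne by blast
  then have "bdd_above ((\<bullet>) u ` S)" using le by (intro bdd_aboveI2[where M="u \<bullet> y0 + L"])
  then have up: "u \<bullet> y \<le> s" if "y \<in> S" for y unfolding s_def using that by (intro cSup_upper) auto
  have low: "s \<le> u \<bullet> y + L" if "y \<in> S" for y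
    unfolding s_def using ne le that by (intro cSup_least) auto
  have "AE y in \<nu>. \<bar>u \<bullet> y - (s - L / 2)\<bar> \<le> L / 2"
    using AE
  proof eventually_elim
    case (elim y)
    show ?case using up[OF elim] low[OF elim] unfolding abs_le_iff by linarith
  qed
  then show ?thesis by (auto simp: L_def S_def)
qed

text \<open>Comparison with a scalar matrix by \<open>\<preceq>\<close> already forces symmetry,
  since \<open>pos_semidef\<close> demands it of the difference.\<close>

lemma transpose_minus_eq:
  fixes H :: "real^'n^'n"
  assumes "transpose (mat c - H) = mat c - H \<or> transpose (H - mat c) = H - mat c"
  shows "transpose H = H"
proof -
  have "transpose (A - B) = transpose A - transpose B" for A B :: "real^'n^'n"
    by (simp add: transpose_def vec_eq_iff)
  then show ?thesis using assms by auto
qed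

lemma mat_preceqD:
  fixes H :: "real^'n^'n"
  assumes "mat c \<preceq> H"
  shows "transpose H = H" "c * (u \<bullet> u) \<le> u \<bullet> (H *v u)"
proof -
  show "transpose H = H"
    using assms by (intro transpose_minus_eq[of c]) (simp add: loewner_le_def pos_semidef_def)
  show "c * (u \<bullet> u) \<le> u \<bullet> (H *v u)"
    using assms by (simp add: loewner_le_def pos_semidef_def matrix_vector_mult_diff_rdistrib matrix_mat_mult_vec inner_diff_right)
qed

lemma preceq_matD:
  fixes H :: "real^'n^'n"
  assumes "H \<preceq> mat c"
  shows "transpose H = H" "u \<bullet> (H *v u) \<le> c * (u \<bullet> u)"
proof -
  show "transpose H = H"
    using assms by (intro transpose_minus_eq[of c]) (simp add: loewner_le_def pos_semidef_def)
  show "u \<bullet> (H *v u) \<le> c * (u \<bullet> u)"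
    using assms by (simp add: loewner_le_def pos_semidef_def matrix_vector_mult_diff_rdistrib matrix_mat_mult_vec inner_diff_right)
qed

section \<open>Potentials with a Hessian: support and velocity at the final time\<close>

lemma C2_with_hessian_minus:
  assumes "C2_with_hessian \<Omega> U H"
  shows "C2_with_hessian \<Omega> (\<lambda>x. - U x) (\<lambda>x. - H x)"
proof -
  obtain G where G: "\<forall>x\<in>\<Omega>. (U has_derivative (\<lambda>h. G x \<bullet> h)) (at x within \<Omega>) \<and>
      (G has_derivative (\<lambda>h. H x *v h)) (at x within \<Omega>)"
    and c: "continuous_on \<Omega> H"
    using assms unfolding C2_with_hessian_def by blast
  have neg: "(- A) *v h = - (A *v h)" for A :: "real^'n^'n" and h
    by (simp add: matrix_vector_mult_def vec_eq_iff sum_negf)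
  have "((\<lambda>x. - U x) has_derivative (\<lambda>h. (- G x) \<bullet> h)) (at x within \<Omega>) \<and>
      ((\<lambda>x. - G x) has_derivative (\<lambda>h. (- H x) *v h)) (at x within \<Omega>)" if "x \<in> \<Omega>" for x
  proof
    show "((\<lambda>x. - U x) has_derivative (\<lambda>h. (- G x) \<bullet> h)) (at x within \<Omega>)"
      using has_derivative_minus[OF conjunct1[OF bspec[OF G that]]] by simp
    show "((\<lambda>x. - G x) has_derivative (\<lambda>h. (- H x) *v h)) (at x within \<Omega>)"
      unfolding neg using has_derivative_minus[OF conjunct2[OF bspec[OF G that]]] .
  qed
  then show ?thesis
    unfolding C2_with_hessian_def using continuous_on_minus[OF c]
    by (intro conjI exI[of _ "\<lambda>x. - G x"] ballI) blast+
qed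

text \<open>The gradient \<open>G\<close> is a parameter because limits of the score are expressed
  by it. Derivatives are taken within \<Omega>, a convex set that may be neither open nor
  closed.\<close>

locale C2_density = interpolated_density a b \<nu> p for a b \<nu> and p :: "real^'n \<Rightarrow> real" +
  fixes \<Omega> :: "(real^'n) set" and U G H
  assumes convex: "convex \<Omega>" and p_eq: "\<And>x. p x = (if x \<in> \<Omega> then exp (- U x) else 0)"
    and U: "\<And>x. x \<in> \<Omega> \<Longrightarrow> (U has_derivative (\<lambda>h. G x \<bullet> h)) (at x within \<Omega>)"
    and G: "\<And>x. x \<in> \<Omega> \<Longrightarrow> (G has_derivative (\<lambda>h. (H x :: real^'n^'n) *v h)) (at x within \<Omega>)"
begin

lemma
  assumes y: "y \<in> interior \<Omega>"
  shows p_isCont: "isCont p y" and p_pos: "0 < p y"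
    and ln_p_has_derivative: "((\<lambda>y. ln (p y)) has_derivative (\<lambda>h. - G y \<bullet> h)) (at y)"
    and G_has_derivative: "(G has_derivative (\<lambda>h. H y *v h)) (at y)"
proof -
  have mem: "z \<in> \<Omega>" if "z \<in> interior \<Omega>" for z using that interior_subset by blast
  have at: "at y within \<Omega> = at y" using y by (rule at_within_interior)
  have U': "((\<lambda>y. - U y) has_derivative (\<lambda>h. - G y \<bullet> h)) (at y)"
    using has_derivative_minus[OF U[OF mem[OF y]]] by (simp add: at)
  show "0 < p y" using mem[OF y] by (simp add: p_eq)
  show "((\<lambda>y. ln (p y)) has_derivative (\<lambda>h. - G y \<bullet> h)) (at y)"
    by (rule has_derivative_transform_within_open[OF U' open_interior y]) (simp add: p_eq mem)
  have "((\<lambda>y. exp (- U y)) has_derivative (\<lambda>h. (- G y \<bullet> h) * exp (- U y))) (at y)"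
    by (rule has_derivative_exp[OF U'])
  then have "(p has_derivative (\<lambda>h. (- G y \<bullet> h) * exp (- U y))) (at y)"
    by (rule has_derivative_transform_within_open[OF _ open_interior y]) (simp add: p_eq mem)
  then show "isCont p y" by (rule has_derivative_continuous)
  show "(G has_derivative (\<lambda>h. H y *v h)) (at y)" using G[OF mem[OF y]] by (simp add: at)
qed

lemma AE_\<Omega>: "AE w in \<nu>. w \<in> \<Omega>"
proof -
  have "AE w in lborel. 0 < ennreal (p w) \<longrightarrow> w \<in> \<Omega>" by (auto simp: p_eq)
  then show ?thesis by (subst nu_eq, subst AE_density) auto
qed

text \<open>A convex set without interior is Lebesgue null, and then the density would have integral
  0 instead of 1.\<close>

lemma nonempty_interior: "interior \<Omega> \<noteq> {}"
proof
  assume "interior \<Omega> = {}"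
  then have "negligible \<Omega>" using negligible_convex_interior[OF convex] by simp
  then have "AE w in lebesgue. w \<notin> \<Omega>"
    unfolding negligible_iff_null_sets by (rule AE_not_in)
  then have "AE w in lebesgue. p w = 0" by eventually_elim (simp add: p_eq)
  then have "AE w in lborel. p w = 0" by (simp only: AE_completion_iff)
  then have "AE w in lborel. ennreal (p w) = 0" by eventually_elim simp
  then have "(\<integral>\<^sup>+w. ennreal (p w) \<partial>lborel) = 0"
    by (subst nn_integral_0_iff_AE) auto
  then show False using nn_integral_p by simp
qed

lemma measure_supp_subset: "measure_supp \<nu> \<subseteq> closure \<Omega>"
proof
  fix x assume x: "x \<in> measure_supp \<nu>"
  show "x \<in> closure \<Omega>"
  proof (rule ccontr)
    assume "x \<notin> closure \<Omega>"
    then have "0 < emeasure \<nu> (- closure \<Omega>)" using x open_Compl[OF closed_closure, of \<Omega>]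
      unfolding measure_supp_def by blast
    moreover have "AE w in \<nu>. w \<notin> - closure \<Omega>"
      using AE_\<Omega> by eventually_elim (use closure_subset in auto)
    then have "emeasure \<nu> (- closure \<Omega>) = 0"
      by (subst (asm) AE_iff_measurable[of "- closure \<Omega>"]) (auto simp: sets_\<nu> sets_eq_imp_space_eq[OF sets_\<nu>])
    ultimately show False by simp
  qed
qed

text \<open>The support lies in the closure of \<Omega>, and passing to the closure of a convex set
  adds no interior points.\<close>

lemma interior_measure_supp_subset: "interior (measure_supp \<nu>) \<subseteq> interior \<Omega>"
  using interior_mono[OF measure_supp_subset] by (simp add: convex_interior_closure[OF convex])

text \<open>The closure of \<Omega> is also the closure of its interior, where the density is
  positive. A null neighbourhood of a point in it would therefore meet an open set of positive mass,
  so \<open>y\<close> lies outside the closure and a hyperplane separates it strictly.\<close>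

lemma separation_from_support:
  assumes y: "y \<notin> measure_supp \<nu>"
  shows "\<exists>u \<delta>. 0 < \<delta> \<and> (AE w in \<nu>. u \<bullet> w \<le> u \<bullet> y - \<delta>)"
proof -
  obtain S where S: "open S" "y \<in> S" "emeasure \<nu> S = 0"
    using y by (auto simp: measure_supp_def zero_less_iff_neq_zero)
  have "y \<notin> closure \<Omega>"
  proof
    assume "y \<in> closure \<Omega>"
    then have "y \<in> closure (interior \<Omega>)"
      using convex_closure_interior[OF convex nonempty_interior] by simp
    then have ne: "S \<inter> interior \<Omega> \<noteq> {}"
      using S(1,2) by (auto simp: closure_iff_nhds_not_empty)
    have op: "open (S \<inter> interior \<Omega>)" using S(1) by auto
    have [measurable]: "S \<in> sets borel" using S(1) by simp
    have "(\<integral>\<^sup>+w. ennreal (p w) * indicator S w \<partial>lborel) = 0"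
      using S(3) by (subst (asm) nu_eq) (simp add: emeasure_density)
    then have "AE w in lborel. ennreal (p w) * indicator S w = 0"
      by (subst (asm) nn_integral_0_iff_AE) auto
    then have "AE w in lborel. w \<notin> S \<inter> interior \<Omega>"
    proof eventually_elim
      case (elim w)
      then show ?case using p_pos[of w] by (auto simp: indicator_def split: if_splits)
    qed
    then have "S \<inter> interior \<Omega> \<in> null_sets lborel"
      using op by (subst (asm) AE_iff_null_sets[symmetric]) auto
    then show False
      using open_not_negligible[OF op ne] by (simp add: negligible_iff_null_sets null_sets_completionI)
  qed
  then obtain d c where dc: "d \<bullet> y < c" "\<And>x. x \<in> closure \<Omega> \<Longrightarrow> c < d \<bullet> x"
    using separating_hyperplane_closed_point[OF convex_closure[OF convex] closed_closure] by blast
  have "AE w in \<nu>. (- d) \<bullet> w \<le> (- d) \<bullet> y - (c - d \<bullet> y)"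
    using AE_\<Omega>
  proof eventually_elim
    case (elim w)
    then have "w \<in> closure \<Omega>" using closure_subset by blast
    then show ?case using dc(2)[of w] by simp
  qed
  then show ?thesis using dc(1) by (intro exI[of _ "- d"] exI[of _ "c - d \<bullet> y"]) auto
qed

text \<open>Every neighbourhood of such an \<open>x\<close> contains points outside the support, at
  which the velocity has no limit.\<close>

lemma not_velocity_differentiable_1:
  assumes "x \<notin> interior (measure_supp \<nu>)"
  shows "\<not> velocity_differentiable a b \<nu> 1 x"
proof
  assume "velocity_differentiable a b \<nu> 1 x"
  then obtain N where N: "open N" "x \<in> N" "\<And>y. y \<in> N \<Longrightarrow> velocity_exists a b \<nu> 1 y"
    by (auto simp: velocity_differentiable_def eventually_nhds)
  have "\<not> N \<subseteq> measure_supp \<nu>" using assms N(1,2) by (auto simp: interior_def)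
  then obtain y where "y \<in> N" "y \<notin> measure_supp \<nu>" by auto
  with N(3) separation_from_support velocity_not_exists_1 show False by blast
qed

text \<open>The number \<open>a_adot a 1\<close> is nonpositive, so lower bounds on the Hessian of
  the potential turn into upper bounds on the velocity gradient, and conversely.\<close>

lemma
  assumes x: "x \<in> interior \<Omega>" and lim: "\<And>y. y \<in> interior \<Omega> \<Longrightarrow> ((\<lambda>t. score t y) \<longlongrightarrow> - G y) (at_left 1)"
  shows velocity_differentiable_1': "velocity_differentiable a b \<nu> 1 x"
    and velocity_grad_1_ge: "mat \<beta> \<preceq> H x \<Longrightarrow> velocity_grad a b \<nu> 1 x \<preceq> mat (\<beta> * a_adot a 1 + b' 1)"
    and velocity_grad_1_le: "H x \<preceq> mat \<beta> \<Longrightarrow> mat (\<beta> * a_adot a 1 + b' 1) \<preceq> velocity_grad a b \<nu> 1 x"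
proof -
  show "velocity_differentiable a b \<nu> 1 x"
    by (rule velocity_differentiable_1[OF open_interior x lim G_has_derivative[OF x]])
  note D = velocity_1_has_derivative[OF open_interior x lim G_has_derivative[OF x]]
  have sym: "u \<bullet> (b' 1 *\<^sub>R v + a_adot a 1 *\<^sub>R (H x *v v)) = v \<bullet> (b' 1 *\<^sub>R u + a_adot a 1 *\<^sub>R (H x *v u))"
    if "transpose (H x) = H x" for u v
    using symmetric_matrix_inner[OF that, of u v] by (simp add: inner_add_right inner_commute)
  have eq: "u \<bullet> (b' 1 *\<^sub>R u + a_adot a 1 *\<^sub>R (H x *v u)) = b' 1 * (u \<bullet> u) + a_adot a 1 * (u \<bullet> (H x *v u))" for u
    by (simp add: inner_add_right)
  { assume le: "mat \<beta> \<preceq> H x"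
    show "velocity_grad a b \<nu> 1 x \<preceq> mat (\<beta> * a_adot a 1 + b' 1)"
      unfolding velocity_grad_def
    proof (rule jacobian_le_mat[OF D sym[OF mat_preceqD(1)[OF le]]])
      fix u
      have "a_adot a 1 * (u \<bullet> (H x *v u)) \<le> a_adot a 1 * (\<beta> * (u \<bullet> u))"
        by (rule mult_left_mono_neg[OF mat_preceqD(2)[OF le] a_adot_1_le])
      then show "u \<bullet> (b' 1 *\<^sub>R u + a_adot a 1 *\<^sub>R (H x *v u)) \<le> (\<beta> * a_adot a 1 + b' 1) * (u \<bullet> u)"
        unfolding eq by (simp add: algebra_simps)
    qed }
  { assume le: "H x \<preceq> mat \<beta>"
    show "mat (\<beta> * a_adot a 1 + b' 1) \<preceq> velocity_grad a b \<nu> 1 x"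
      unfolding velocity_grad_def
    proof (rule mat_le_jacobian[OF D sym[OF preceq_matD(1)[OF le]]])
      fix u
      have "a_adot a 1 * (\<beta> * (u \<bullet> u)) \<le> a_adot a 1 * (u \<bullet> (H x *v u))"
        by (rule mult_left_mono_neg[OF preceq_matD(2)[OF le] a_adot_1_le])
      then show "(\<beta> * a_adot a 1 + b' 1) * (u \<bullet> u) \<le> u \<bullet> (b' 1 *\<^sub>R u + a_adot a 1 *\<^sub>R (H x *v u))"
        unfolding eq by (simp add: algebra_simps)
    qed }
qed

end

lemma semi_log_concaveE:
  assumes "interpolated_density a b \<nu> p" "semi_log_concave \<kappa> p"
  obtains \<Omega> U G H where "C2_density a b \<nu> p \<Omega> U G H" "\<And>x. x \<in> \<Omega> \<Longrightarrow> mat \<kappa> \<preceq> H x"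
    "C2_with_hessian \<Omega> U H"
proof -
  obtain \<Omega> U H where 1: "convex \<Omega>" "\<forall>x. p x = (if x \<in> \<Omega> then exp (- U x) else 0)"
      "C2_with_hessian \<Omega> U H" "\<forall>x\<in>\<Omega>. mat \<kappa> \<preceq> H x"
    using assms(2) unfolding semi_log_concave_def by blast
  then obtain G where "\<forall>x\<in>\<Omega>. (U has_derivative (\<lambda>h. G x \<bullet> h)) (at x within \<Omega>) \<and>
      (G has_derivative (\<lambda>h. H x *v h)) (at x within \<Omega>)"
    unfolding C2_with_hessian_def by blast
  with 1 assms(1) have "C2_density a b \<nu> p \<Omega> U G H"
    by (simp add: C2_density_def C2_density_axioms_def)
  then show ?thesis using 1 that by blast
qed

lemma semi_log_convexE:
  assumes "interpolated_density a b \<nu> p" "semi_log_convex \<beta> p"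
  obtains \<Omega> U G H where "C2_density a b \<nu> p \<Omega> U G H" "\<And>x. x \<in> \<Omega> \<Longrightarrow> H x \<preceq> mat \<beta>"
    "C2_with_hessian \<Omega> U H"
proof -
  obtain \<Omega> U H where 1: "convex \<Omega>" "\<forall>x. p x = (if x \<in> \<Omega> then exp (- U x) else 0)"
      "C2_with_hessian \<Omega> U H" "\<forall>x\<in>\<Omega>. H x \<preceq> mat \<beta>"
    using assms(2) unfolding semi_log_convex_def by blast
  then obtain G where "\<forall>x\<in>\<Omega>. (U has_derivative (\<lambda>h. G x \<bullet> h)) (at x within \<Omega>) \<and>
      (G has_derivative (\<lambda>h. H x *v h)) (at x within \<Omega>)"
    unfolding C2_with_hessian_def by blast
  with 1 assms(1) have "C2_density a b \<nu> p \<Omega> U G H"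
    by (simp add: C2_density_def C2_density_axioms_def)
  then show ?thesis using 1 that by blast
qed

context interpolation
begin

text \<open>Evaluates b'/b + \<kappa> l at the Hessian bound l = -c / (c a^2 + b^2). The parameter c
  is the convexity constant in (b) and (c), and 1 in (e).\<close>

lemma \<kappa>_quotient:
  assumes t: "t \<in> {0<..<1}" and q: "c * (a t)\<^sup>2 + (b t)\<^sup>2 \<noteq> 0"
  shows "b' t / b t - \<kappa> t * (c / (c * (a t)\<^sup>2 + (b t)\<^sup>2)) = (c * (a t * a' t) + b t * b' t) / (c * (a t)\<^sup>2 + (b t)\<^sup>2)"
proof -
  define q where "q = c * (a t)\<^sup>2 + (b t)\<^sup>2"
  have q0: "q \<noteq> 0" using q by (simp add: q_def)
  have "b' t / b t - \<kappa> t * (c / q) = (b' t * q - \<kappa> t * b t * c) / (b t * q)"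
    using q0 b_pos[OF t] by (simp add: field_simps)
  also have "b' t * q - \<kappa> t * b t * c = b t * (c * (a t * a' t) + b t * b' t)"
    unfolding \<kappa>_def q_def using b_pos[OF t] by (simp add: field_simps power2_eq_square)
  finally show ?thesis using b_pos[OF t] by (simp add: q_def)
qed

lemma denominator_tendsto: "((\<lambda>t. c * (a t)\<^sup>2 + (b t)\<^sup>2) \<longlongrightarrow> 1) (at_left 1)"
proof -
  have "((\<lambda>t. c * (a t)\<^sup>2 + (b t)\<^sup>2) \<longlongrightarrow> c * 0 + 1\<^sup>2) (at_left 1)"
    by (intro tendsto_intros a_sq_tendsto b_tendsto)
  then show ?thesis by simp
qed

text \<open>Supplies the time-uniform Hessian constant on which the convergence of the scores at
  time 1 rests.\<close>

lemma eventually_denominator: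
  "\<forall>\<^sub>F t in at_left 1. 0 < c * (a t)\<^sup>2 + (b t)\<^sup>2 \<and> \<bar>c / (c * (a t)\<^sup>2 + (b t)\<^sup>2)\<bar> \<le> \<bar>c\<bar> + 1"
proof -
  have "((\<lambda>t. \<bar>c / (c * (a t)\<^sup>2 + (b t)\<^sup>2)\<bar>) \<longlongrightarrow> \<bar>c / 1\<bar>) (at_left 1)"
    by (intro tendsto_rabs tendsto_divide denominator_tendsto tendsto_const) simp
  then have "\<forall>\<^sub>F t in at_left 1. \<bar>c / (c * (a t)\<^sup>2 + (b t)\<^sup>2)\<bar> < \<bar>c\<bar> + 1"
    by (rule order_tendstoD) simp
  moreover have "\<forall>\<^sub>F t in at_left 1. 0 < c * (a t)\<^sup>2 + (b t)\<^sup>2"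
    by (rule order_tendstoD[OF denominator_tendsto]) simp
  ultimately show ?thesis by eventually_elim simp
qed

end

context interpolated_measure
begin

lemma velocity_grad_lower:
  assumes t: "t \<in> {0<..<1}"
  shows "mat (a' t / a t) \<preceq> velocity_grad a b \<nu> t x"
proof (rule velocity_grad_ge[OF t])
  interpret M: gauss_mixture_vec \<nu> "a t" "b t" by (rule mixture[OF t])
  show "- 1 / (a t)\<^sup>2 * (u \<bullet> u) \<le> u \<bullet> hess t x u" for u
    using M.hess_ge[of u x] by simp
  show "a' t / a t \<le> b' t / b t + \<kappa> t * (- 1 / (a t)\<^sup>2)"
    unfolding \<kappa>_def using M.s_pos M.b_pos by (simp add: field_simps power2_eq_square)
qed

lemma velocity_grad_upper_bounded_support:
  assumes t: "t \<in> {0<..<1}" and bdd: "bounded (measure_supp \<nu>)"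
  shows "velocity_grad a b \<nu> t x
    \<preceq> mat (b t * (a t * b' t - a' t * b t) / (a t)^3 * ((1 / sqrt 2) * diameter (measure_supp \<nu>))\<^sup>2 + a' t / a t)"
proof (rule velocity_grad_le[OF t])
  interpret M: gauss_mixture_vec \<nu> "a t" "b t" by (rule mixture[OF t])
  define D where "D = (1 / sqrt 2) * diameter (measure_supp \<nu>)"
  show "u \<bullet> hess t x u \<le> ((b t / (a t)\<^sup>2)\<^sup>2 * D\<^sup>2 - 1 / (a t)\<^sup>2) * (u \<bullet> u)" for u
  proof -
    obtain c where c: "AE y in \<nu>. \<bar>u \<bullet> y - c\<bar> \<le> norm u * diameter (measure_supp \<nu>) / 2"
      using AE_inner_bounded_support[OF prob sets_\<nu> bdd, of u] by blast
    \<comment> \<open>The projected support has half-length |u| diam / 2, whose square is |u|^2 D^2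
      / 2, so D^2 leaves a factor 2 to spare.\<close>
    have "(norm u * diameter (measure_supp \<nu>) / 2)\<^sup>2 = (u \<bullet> u) * D\<^sup>2 / 2"
      by (simp add: D_def power_mult_distrib power_divide power2_norm_eq_inner)
    also have "\<dots> \<le> (u \<bullet> u) * D\<^sup>2" by simp
    finally have "(b t / (a t)\<^sup>2)\<^sup>2 * (norm u * diameter (measure_supp \<nu>) / 2)\<^sup>2 \<le> (b t / (a t)\<^sup>2)\<^sup>2 * ((u \<bullet> u) * D\<^sup>2)"
      by (intro mult_left_mono) auto
    then show ?thesis using M.hess_le[OF c, of x] by (simp add: algebra_simps)
  qed
  have "\<kappa> t * (b t / (a t)\<^sup>2)\<^sup>2 = b t * (a t * b' t - a' t * b t) / (a t)^3"
    "\<kappa> t / (a t)\<^sup>2 = b' t / b t - a' t / a t"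
    unfolding \<kappa>_def using M.s_pos M.b_pos
    by (simp_all add: field_simps power2_eq_square power3_eq_cube)
  then show "b' t / b t + \<kappa> t * ((b t / (a t)\<^sup>2)\<^sup>2 * D\<^sup>2 - 1 / (a t)\<^sup>2)
      \<le> b t * (a t * b' t - a' t * b t) / (a t)^3 * D\<^sup>2 + a' t / a t"
    by (simp add: right_diff_distrib mult.assoc[symmetric])
qed

text \<open>The two sides differ in their treatment of the squared term (u \<bullet> J)^2 of
  \<open>hess_q_bound\<close>: the upper bound drops it by its sign, the lower bound pays L^2 (b /
  (a^2 + b^2))^2 for it.\<close>

lemma velocity_grad_log_lipschitz:
  assumes t: "t \<in> {0<..<1}" and f: "\<nu> = density (gaussian 1) (\<lambda>x. ennreal (f x))" "log_lipschitz L f" "0 \<le> L"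
  defines "B \<equiv> 5 * L * b t * ((a t)\<^sup>2 + (b t)\<^sup>2) powr (- 3 / 2)
                  * (L + (ln (sqrt ((a t)\<^sup>2 + (b t)\<^sup>2) / b t)) powr (- 1 / 2))"
  shows "mat ((b' t / b t * (a t)\<^sup>2 - a' t * a t) * (- B - L\<^sup>2 * (b t / ((a t)\<^sup>2 + (b t)\<^sup>2))\<^sup>2)
             + (a' t * a t + b' t * b t) / ((a t)\<^sup>2 + (b t)\<^sup>2)) \<preceq> velocity_grad a b \<nu> t x"
    and "velocity_grad a b \<nu> t x \<preceq> mat ((b' t / b t * (a t)\<^sup>2 - a' t * a t) * B
             + (a' t * a t + b' t * b t) / ((a t)\<^sup>2 + (b t)\<^sup>2))"
proof -
  interpret M: gauss_mixture_vec \<nu> "a t" "b t" by (rule mixture[OF t])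
  interpret M: log_lipschitz_mixture \<nu> "a t" "b t" L f
    by unfold_locales (use f in auto)
  have r2: "M.r2 = (a t)\<^sup>2 + (b t)\<^sup>2" by (rule M.r2_def)
  have X: "\<bar>u \<bullet> hess t x u + (u \<bullet> u) / M.r2 + (u \<bullet> M.J x)\<^sup>2\<bar> \<le> B * (u \<bullet> u)" for u
    using M.hess_q_bound[of u x] mult_right_mono[OF M.lipschitz_constant_le, of "u \<bullet> u"]
    unfolding B_def r2[symmetric] by simp
  have J: "(u \<bullet> M.J x)\<^sup>2 \<le> L\<^sup>2 * (b t / M.r2)\<^sup>2 * (u \<bullet> u)" for u
  proof -
    have "\<bar>u \<bullet> M.J x\<bar>\<^sup>2 \<le> (L * M.m * norm u)\<^sup>2" by (intro power_mono M.J_le) simp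
    then show ?thesis by (simp only: power_mult_distrib M.m_def power2_norm_eq_inner power2_abs)
  qed
  have k: "b' t / b t - \<kappa> t * (1 / M.r2) = (a' t * a t + b' t * b t) / M.r2"
  proof -
    have "1 * (a t)\<^sup>2 + (b t)\<^sup>2 \<noteq> 0" using M.r2_pos unfolding r2 by linarith
    from \<kappa>_quotient[OF t this] show ?thesis by (simp add: r2 mult.commute)
  qed
  have \<kappa>: "b' t / b t * (a t)\<^sup>2 - a' t * a t = \<kappa> t" by (simp add: \<kappa>_def mult.commute)
  show "mat ((b' t / b t * (a t)\<^sup>2 - a' t * a t) * (- B - L\<^sup>2 * (b t / ((a t)\<^sup>2 + (b t)\<^sup>2))\<^sup>2)
             + (a' t * a t + b' t * b t) / ((a t)\<^sup>2 + (b t)\<^sup>2)) \<preceq> velocity_grad a b \<nu> t x"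
    unfolding \<kappa> r2[symmetric] k[symmetric]
  proof (rule velocity_grad_ge[OF t])
    show "(- B - L\<^sup>2 * (b t / M.r2)\<^sup>2 - 1 / M.r2) * (u \<bullet> u) \<le> u \<bullet> hess t x u" for u
      using X[of u] J[of u] by (simp add: abs_le_iff left_diff_distrib)
  qed (simp add: algebra_simps)
  show "velocity_grad a b \<nu> t x \<preceq> mat ((b' t / b t * (a t)\<^sup>2 - a' t * a t) * B
             + (a' t * a t + b' t * b t) / ((a t)\<^sup>2 + (b t)\<^sup>2))"
    unfolding \<kappa> r2[symmetric] k[symmetric]
  proof (rule velocity_grad_le[OF t])
    show "u \<bullet> hess t x u \<le> (B - 1 / M.r2) * (u \<bullet> u)" for u
    proof -
      have "u \<bullet> hess t x u + (u \<bullet> u) / M.r2 + (u \<bullet> M.J x)\<^sup>2 \<le> B * (u \<bullet> u)" using X[of u] by linarith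
      then have "u \<bullet> hess t x u + (u \<bullet> u) / M.r2 \<le> B * (u \<bullet> u)"
        using zero_le_power2[of "u \<bullet> M.J x"] by linarith
      then show ?thesis by (simp add: left_diff_distrib)
    qed
  qed (simp add: algebra_simps)
qed

end

text \<open>Stated in \<open>interpolation\<close>, with no measure fixed, because the measure of
  interest is built from \<open>\<rho>\<close>; the locale for the convolution is interpreted inside
  the proof.\<close>

lemma (in interpolation) velocity_grad_gaussian_convolution:
  fixes \<rho> :: "(real^'n) measure"
  assumes \<rho>: "prob_space \<rho>" "sets \<rho> = sets borel" "AE y in \<rho>. y \<in> cball c R" and \<sigma>: "0 < \<sigma>"
    and t: "t \<in> {0<..<1}"
  shows "velocity_differentiable a b (gaussian \<sigma> \<star> \<rho>) t x"
    and "mat ((a' t * a t + \<sigma>\<^sup>2 * b' t * b t) / ((a t)\<^sup>2 + \<sigma>\<^sup>2 * (b t)\<^sup>2)) \<preceq> velocity_grad a b (gaussian \<sigma> \<star> \<rho>) t x"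
    and "velocity_grad a b (gaussian \<sigma> \<star> \<rho>) t x
      \<preceq> mat (a t * b t * (a t * b' t - a' t * b t) / ((a t)\<^sup>2 + \<sigma>\<^sup>2 * (b t)\<^sup>2)\<^sup>2 * R\<^sup>2
              + (a' t * a t + \<sigma>\<^sup>2 * b' t * b t) / ((a t)\<^sup>2 + \<sigma>\<^sup>2 * (b t)\<^sup>2))"
proof -
  interpret I: interpolated_measure a b "gaussian \<sigma> \<star> \<rho>"
    by (intro interpolated_measure.intro interpolated_measure_axioms.intro interpolation_axioms
        prob_space_gaussian_convolution \<rho>(1,2) \<sigma> sets_convolution)
  interpret R: gauss_convolution \<rho> "a t" "b t" \<sigma>
    by (intro gauss_convolution.intro gauss_convolution_axioms.intro \<rho>(1,2) \<sigma> a_pos b_pos t)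
  show "velocity_differentiable a b (gaussian \<sigma> \<star> \<rho>) t x" by (rule I.velocity_differentiable_interior[OF t])
  define S where "S = (a t)\<^sup>2 + \<sigma>\<^sup>2 * (b t)\<^sup>2"
  have S: "R.S = S" unfolding R.S_def S_def ..
  have S_pos: "S > 0" using R.S_pos S by simp
  have k: "(a' t * a t + \<sigma>\<^sup>2 * b' t * b t) / S = b' t / b t - \<kappa> t * (1 / S)"
  proof -
    have "b' t / b t - \<kappa> t * (1 / S) = (b' t * S - \<kappa> t * b t) / (b t * S)"
      using S_pos b_pos[OF t] by (simp add: field_simps)
    also have "b' t * S - \<kappa> t * b t = b t * (a' t * a t + \<sigma>\<^sup>2 * b' t * b t)"
      unfolding \<kappa>_def S_def using b_pos[OF t] by (simp add: field_simps power2_eq_square)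
    finally show ?thesis using b_pos[OF t] by simp
  qed
  have k2: "a t * b t * (a t * b' t - a' t * b t) = \<kappa> t * (b t)\<^sup>2"
    unfolding \<kappa>_def using b_pos[OF t] by (simp add: field_simps power2_eq_square)
  show "mat ((a' t * a t + \<sigma>\<^sup>2 * b' t * b t) / ((a t)\<^sup>2 + \<sigma>\<^sup>2 * (b t)\<^sup>2)) \<preceq> velocity_grad a b (gaussian \<sigma> \<star> \<rho>) t x"
    unfolding S_def[symmetric] k
  proof (rule I.velocity_grad_ge[OF t])
    show "- 1 / S * (u \<bullet> u) \<le> u \<bullet> I.hess t x u" for u
      using R.hess_convolution_ge[of u x] by (simp add: S)
  qed simp
  show "velocity_grad a b (gaussian \<sigma> \<star> \<rho>) t x
      \<preceq> mat (a t * b t * (a t * b' t - a' t * b t) / ((a t)\<^sup>2 + \<sigma>\<^sup>2 * (b t)\<^sup>2)\<^sup>2 * R\<^sup>2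
              + (a' t * a t + \<sigma>\<^sup>2 * b' t * b t) / ((a t)\<^sup>2 + \<sigma>\<^sup>2 * (b t)\<^sup>2))"
    unfolding S_def[symmetric] k k2
  proof (rule I.velocity_grad_le[OF t])
    show "u \<bullet> I.hess t x u \<le> ((b t)\<^sup>2 * R\<^sup>2 / S\<^sup>2 - 1 / S) * (u \<bullet> u)" for u
      using R.hess_convolution_le[OF \<rho>(3), of u x] by (simp add: S)
  qed (simp add: algebra_simps)
qed

section \<open>Semi-log-convex and semi-log-concave densities\<close>

context C2_density
begin

text \<open>A round trip: the Hessian bound on the potential becomes a midpoint inequality for the
  density, passes to the mass, and is turned back into a Hessian bound there. With \<Omega> the
  whole space, every pair of symmetric points is available.\<close>

lemma hess_ge_log_convex:
  assumes t: "t \<in> {0<..<1}" and q: "0 < \<beta> * (a t)\<^sup>2 + (b t)\<^sup>2"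
    and C2: "C2_with_hessian \<Omega> U H" and H: "\<And>x. x \<in> \<Omega> \<Longrightarrow> H x \<preceq> mat \<beta>" and \<Omega>: "\<Omega> = UNIV"
  shows "- (\<beta> / (\<beta> * (a t)\<^sup>2 + (b t)\<^sup>2)) * (u \<bullet> u) \<le> u \<bullet> hess t x u"
proof -
  interpret M: density_mixture \<nu> "a t" "b t" p by (rule density_mixture[OF t])
  define c where "c = \<beta> / (\<beta> * (a t)\<^sup>2 + (b t)\<^sup>2)"
  have pm: "(p m)\<^sup>2 \<le> p (m + w) * p (m - w) * exp (\<beta> * (norm w)\<^sup>2)" for m w
  proof -
    have neg: "u \<bullet> (- A *v u) = - (u \<bullet> (A *v u))" for A :: "real^'n^'n" and u
      by (simp add: matrix_vector_mult_def inner_vec_def sum_negf)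
    have "2 * (- U m) + (- \<beta>) * (w \<bullet> w) \<le> - U (m + w) + - U (m - w)"
      by (rule midpoint_le_of_hessian_ge[OF convex C2_with_hessian_minus[OF C2]])
        (use preceq_matD(2)[OF H] in \<open>auto simp: neg \<Omega>\<close>)
    then have "exp (2 * (- U m)) \<le> exp (- U (m + w) + - U (m - w) + \<beta> * (w \<bullet> w))" by simp
    then show ?thesis
      by (simp only: p_eq \<Omega> UNIV_I if_True exp_add power2_norm_eq_inner exp_double)
  qed
  show ?thesis
    unfolding c_def[symmetric]
  proof (rule second_derivative_ge_of_midpoint[OF M.ln_mass_has_derivative M.score_has_derivative])
    fix v
    have "(M.mass x)\<^sup>2 \<le> M.mass (x + v) * M.mass (x - v) * exp (c * (norm v)\<^sup>2)"
      unfolding c_def by (rule M.mass_midpoint_log_convex[OF q pm])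
    then have "ln ((M.mass x)\<^sup>2) \<le> ln (M.mass (x + v) * M.mass (x - v) * exp (c * (norm v)\<^sup>2))"
      by (rule iffD2[OF ln_le_cancel_iff, rotated 2])
        (intro mult_pos_pos zero_less_power M.mass_pos exp_gt_zero)+
    then show "2 * ln (M.mass x) \<le> ln (M.mass (x + v)) + ln (M.mass (x - v)) + c * (v \<bullet> v)"
      using M.mass_pos[of x] M.mass_pos[of "x + v"] M.mass_pos[of "x - v"]
      by (simp add: ln_mult ln_realpow power2_norm_eq_inner)
  qed
qed

lemma hess_le_log_concave:
  assumes t: "t \<in> {0<..<1}" and q: "0 < k * (a t)\<^sup>2 + (b t)\<^sup>2"
    and C2: "C2_with_hessian \<Omega> U H" and H: "\<And>x. x \<in> \<Omega> \<Longrightarrow> mat k \<preceq> H x"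
  shows "u \<bullet> hess t x u \<le> - (k / (k * (a t)\<^sup>2 + (b t)\<^sup>2)) * (u \<bullet> u)"
proof -
  interpret M: density_mixture \<nu> "a t" "b t" p by (rule density_mixture[OF t])
  define c where "c = k / (k * (a t)\<^sup>2 + (b t)\<^sup>2)"
  have pm: "p (m + w) * p (m - w) * exp (k * (norm w)\<^sup>2) \<le> (p m)\<^sup>2" for m w
  \<comment> \<open>Outside \<Omega> the density vanishes and the left-hand side is 0; if both end
    points lie in \<Omega>, convexity puts the midpoint there as well.\<close>
  proof (cases "m + w \<in> \<Omega> \<and> m - w \<in> \<Omega>")
    case True
    have "m = (1/2) *\<^sub>R (m + w) + (1/2) *\<^sub>R (m - w)" by (simp add: algebra_simps flip: scaleR_add_left)
    then have m: "m \<in> \<Omega>" using convexD[OF convex, of "m + w" "m - w" "1/2" "1/2"] True by simp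
    have "2 * U m + k * (w \<bullet> w) \<le> U (m + w) + U (m - w)"
      by (rule midpoint_le_of_hessian_ge[OF convex C2]) (use mat_preceqD(2)[OF H] True in auto)
    then have "exp (- U (m + w) + - U (m - w) + k * (w \<bullet> w)) \<le> exp (2 * (- U m))" by simp
    then show ?thesis
      using True m by (simp only: p_eq if_True exp_add power2_norm_eq_inner exp_double)
  qed (auto simp: p_eq)
  show ?thesis
    unfolding c_def[symmetric]
  proof (rule second_derivative_le_of_midpoint[OF M.ln_mass_has_derivative M.score_has_derivative])
    fix v
    have "M.mass (x + v) * M.mass (x - v) * exp (c * (norm v)\<^sup>2) \<le> (M.mass x)\<^sup>2"
      unfolding c_def by (rule M.mass_midpoint_log_concave[OF q pm])
    then have "ln (M.mass (x + v) * M.mass (x - v) * exp (c * (norm v)\<^sup>2)) \<le> ln ((M.mass x)\<^sup>2)"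
      by (rule iffD2[OF ln_le_cancel_iff, rotated 2])
        (intro mult_pos_pos zero_less_power M.mass_pos exp_gt_zero)+
    then show "ln (M.mass (x + v)) + ln (M.mass (x - v)) + c * (v \<bullet> v) \<le> 2 * ln (M.mass x)"
      using M.mass_pos[of x] M.mass_pos[of "x + v"] M.mass_pos[of "x - v"]
      by (simp add: ln_mult ln_realpow power2_norm_eq_inner)
  qed
qed

lemma interior_regular: "y \<in> interior \<Omega> \<Longrightarrow> isCont p y \<and> 0 < p y"
  using p_isCont p_pos by blast

lemma score_tendsto_log_convex:
  assumes "C2_with_hessian \<Omega> U H" "\<And>x. x \<in> \<Omega> \<Longrightarrow> H x \<preceq> mat \<beta>" "\<Omega> = UNIV" and x: "x \<in> interior \<Omega>"
  shows "((\<lambda>t. score t x) \<longlongrightarrow> - G x) (at_left 1)"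
proof (rule score_tendsto_convex[OF open_interior x interior_regular ln_p_has_derivative[OF x]])
  show "\<forall>\<^sub>F t in at_left 1. \<forall>x u. - (\<bar>\<beta>\<bar> + 1) * (u \<bullet> u) \<le> u \<bullet> hess t x u"
    using eventually_denominator[of \<beta>] eventually_interior
  proof eventually_elim
    case (elim t)
    show ?case
    proof (intro allI)
      fix x u :: "real^'n"
      have "\<beta> / (\<beta> * (a t)\<^sup>2 + (b t)\<^sup>2) \<le> \<bar>\<beta>\<bar> + 1"
        using elim(1) unfolding abs_le_iff by blast
      then have "- (\<bar>\<beta>\<bar> + 1) * (u \<bullet> u) \<le> - (\<beta> / (\<beta> * (a t)\<^sup>2 + (b t)\<^sup>2)) * (u \<bullet> u)"
        by (intro mult_right_mono) auto
      also have "\<dots> \<le> u \<bullet> hess t x u"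
        using elim by (intro hess_ge_log_convex assms(1,3)) (auto intro: assms(2))
      finally show "- (\<bar>\<beta>\<bar> + 1) * (u \<bullet> u) \<le> u \<bullet> hess t x u" .
    qed
  qed
qed

lemma score_tendsto_log_concave:
  assumes "C2_with_hessian \<Omega> U H" "\<And>x. x \<in> \<Omega> \<Longrightarrow> mat k \<preceq> H x" and x: "x \<in> interior \<Omega>"
  shows "((\<lambda>t. score t x) \<longlongrightarrow> - G x) (at_left 1)"
proof (rule score_tendsto_concave[OF open_interior x interior_regular ln_p_has_derivative[OF x]])
  show "\<forall>\<^sub>F t in at_left 1. \<forall>x u. u \<bullet> hess t x u \<le> (\<bar>k\<bar> + 1) * (u \<bullet> u)"
    using eventually_denominator[of k] eventually_interior
  proof eventually_elim
    case (elim t)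
    show ?case
    proof (intro allI)
      fix x u :: "real^'n"
      have "u \<bullet> hess t x u \<le> - (k / (k * (a t)\<^sup>2 + (b t)\<^sup>2)) * (u \<bullet> u)"
        using elim by (intro hess_le_log_concave assms(1)) (auto intro: assms(2))
      moreover have "- (k / (k * (a t)\<^sup>2 + (b t)\<^sup>2)) \<le> \<bar>k\<bar> + 1"
        using elim(1) unfolding abs_le_iff by blast
      then have "- (k / (k * (a t)\<^sup>2 + (b t)\<^sup>2)) * (u \<bullet> u) \<le> (\<bar>k\<bar> + 1) * (u \<bullet> u)"
        by (rule mult_right_mono) simp
      ultimately show "u \<bullet> hess t x u \<le> (\<bar>k\<bar> + 1) * (u \<bullet> u)" by linarith
    qed
  qed
qed

end

context interpolated_density
begin

lemma velocity_grad_semi_log_convex: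
  assumes \<beta>: "\<beta> > 0" and p: "semi_log_convex \<beta> p" and supp: "measure_supp \<nu> = UNIV" and t: "t \<in> {0<..1}"
  shows "velocity_differentiable a b \<nu> t x"
    and "mat ((\<beta> * a_adot a t + b t * b' t) / (\<beta> * (a t)\<^sup>2 + (b t)\<^sup>2)) \<preceq> velocity_grad a b \<nu> t x"
proof -
  obtain \<Omega> U G H where C2: "C2_density a b \<nu> p \<Omega> U G H" and H: "\<And>x. x \<in> \<Omega> \<Longrightarrow> H x \<preceq> mat \<beta>"
    and C2': "C2_with_hessian \<Omega> U H"
    using semi_log_convexE[OF interpolated_density_axioms p] by blast
  interpret C2_density a b \<nu> p \<Omega> U G H by (rule C2)
  \<comment> \<open>Full support makes the interior of \<Omega>, hence \<Omega> itself, the whole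
    space.\<close>
  have int: "interior \<Omega> = UNIV" using interior_measure_supp_subset by (auto simp: supp)
  then have \<Omega>: "\<Omega> = UNIV" using interior_subset[of \<Omega>] by auto
  have x: "x \<in> interior \<Omega>" by (simp add: int)
  have lim: "((\<lambda>t. score t y) \<longlongrightarrow> - G y) (at_left 1)" if "y \<in> interior \<Omega>" for y
    by (rule score_tendsto_log_convex[OF C2' H \<Omega> that])
  show "velocity_differentiable a b \<nu> t x"
    using velocity_differentiable_interior[of t x] velocity_differentiable_1'[OF x lim] t
    by (cases "t = 1") auto
  show "mat ((\<beta> * a_adot a t + b t * b' t) / (\<beta> * (a t)\<^sup>2 + (b t)\<^sup>2)) \<preceq> velocity_grad a b \<nu> t x"
  proof (cases "t = 1")
    case True
    then show ?thesis using velocity_grad_1_le[OF x lim H] by (simp add: \<Omega> a_1 b_1)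
  next
    case False
    then have t: "t \<in> {0<..<1}" using t by simp
    have q: "0 < \<beta> * (a t)\<^sup>2 + (b t)\<^sup>2" using \<beta> b_pos[OF t] by (intro add_nonneg_pos) auto
    show ?thesis
    proof (rule velocity_grad_ge[OF t hess_ge_log_convex[OF t q C2' H \<Omega>]])
      have "a_adot a t = a t * a' t" using False by (simp add: a_adot_def)
      then show "(\<beta> * a_adot a t + b t * b' t) / (\<beta> * (a t)\<^sup>2 + (b t)\<^sup>2)
          \<le> b' t / b t + \<kappa> t * (- (\<beta> / (\<beta> * (a t)\<^sup>2 + (b t)\<^sup>2)))"
        using \<kappa>_quotient[OF t, of \<beta>] q by simp
    qed
  qed
qed

text \<open>
  If the denominator vanishes at some time after the root, then the ratio of b to a is constant
  up to that time, so both derivatives vanish there and the velocity is constant in space.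
\<close>

lemma denominator_cases:
  assumes t: "t \<in> {0<..<1}"
    and t0: "if k < 0 then t0 \<in> {0<..<1} \<and> k + (b t0)\<^sup>2 / (a t0)\<^sup>2 = 0 else t0 = 0" and "t0 < t"
  shows "0 < k * (a t)\<^sup>2 + (b t)\<^sup>2 \<or> k * (a t)\<^sup>2 + (b t)\<^sup>2 = 0 \<and> a' t = 0 \<and> b' t = 0"
proof (cases "k < 0")
  case False
  then show ?thesis using b_pos[OF t] by (auto intro!: add_nonneg_pos)
next
  case True
  then have t0: "t0 \<in> {0<..<1}" "k + (b t0)\<^sup>2 / (a t0)\<^sup>2 = 0" using t0 by auto
  define \<phi> where "\<phi> s = k * (a s)\<^sup>2 + (b s)\<^sup>2" for s
  have d: "(\<phi> has_real_derivative 2 * (k * (a s * a' s) + b s * b' s)) (at s)" if "s \<in> {0<..<1}" for s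
    unfolding \<phi>_def[abs_def] using a_deriv[OF that] b_deriv[OF that]
    by (auto intro!: derivative_eq_intros simp: algebra_simps)
  have nn: "0 \<le> k * (a s * a' s)" "0 \<le> b s * b' s" if "s \<in> {0<..<1}" for s
    using True a_pos[OF that] a'_le[OF that] b_pos[OF that] b'_ge[of s] that
    by (auto intro!: mult_nonpos_nonpos mult_nonneg_nonpos)
  have "\<phi> t0 = 0" using t0(2) a_pos[OF t0(1)] by (simp add: \<phi>_def field_simps)
  have \<phi>_nn: "0 \<le> \<phi> s" if "t0 \<le> s" "s < 1" for s
  proof -
    have "\<phi> t0 \<le> \<phi> s"
    proof (rule DERIV_nonneg_imp_nondecreasing[OF that(1)])
      fix r assume "t0 \<le> r" "r \<le> s"
      then have r: "r \<in> {0<..<1}" using t0(1) that by auto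
      show "\<exists>y. (\<phi> has_real_derivative y) (at r) \<and> 0 \<le> y"
        using d[OF r] nn[OF r] by (intro exI[of _ "2 * (k * (a r * a' r) + b r * b' r)"]) auto
    qed
    then show ?thesis by (simp add: \<open>\<phi> t0 = 0\<close>)
  qed
  show ?thesis
  proof (cases "\<phi> t = 0")
    case False
    then show ?thesis using \<phi>_nn[of t] t \<open>t0 < t\<close> by (simp add: \<phi>_def less_le)
  next
    case zero: True
    \<comment> \<open>A positive derivative would make \<phi> negative just before t, against its
      sign on [t0, 1). Both summands of the derivative are nonnegative as k < 0, so each must
      vanish.\<close>
    have "\<not> 0 < 2 * (k * (a t * a' t) + b t * b' t)"
    proof
      assume "0 < 2 * (k * (a t * a' t) + b t * b' t)"
      then obtain e where e: "e > 0" "\<And>h. 0 < h \<Longrightarrow> h < e \<Longrightarrow> \<phi> (t - h) < \<phi> t"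
        using has_real_derivative_pos_inc_left[OF d[OF t]] by auto
      define h where "h = min e (t - t0) / 2"
      have h: "0 < h" "h < e" "h < t - t0" using e(1) \<open>t0 < t\<close> by (auto simp: h_def min_def)
      then show False using e(2)[of h] \<phi>_nn[of "t - h"] zero t by auto
    qed
    then have "k * (a t * a' t) + b t * b' t \<le> 0" by simp
    then have "k * (a t * a' t) + b t * b' t = 0" using nn[OF t] by linarith
    then have "k * (a t * a' t) = 0 \<and> b t * b' t = 0" using nn[OF t] by (simp only: add_nonneg_eq_0_iff)
    then show ?thesis using zero True a_pos[OF t] b_pos[OF t] by (auto simp: \<phi>_def)
  qed
qed

lemma velocity_grad_semi_log_concave:
  assumes p: "semi_log_concave k p"
    and t0: "if k < 0 then t0 \<in> {0<..<1} \<and> k + (b t0)\<^sup>2 / (a t0)\<^sup>2 = 0 else t0 = 0"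
    and t: "t \<in> {t0<..1}"
  shows "t < 1 \<or> x \<in> interior (measure_supp \<nu>) \<Longrightarrow> velocity_differentiable a b \<nu> t x"
    and "velocity_differentiable a b \<nu> t x \<Longrightarrow>
      velocity_grad a b \<nu> t x \<preceq> mat ((k * a_adot a t + b t * b' t) / (k * (a t)\<^sup>2 + (b t)\<^sup>2))"
proof -
  obtain \<Omega> U G H where C2: "C2_density a b \<nu> p \<Omega> U G H" and H: "\<And>x. x \<in> \<Omega> \<Longrightarrow> mat k \<preceq> H x"
    and C2': "C2_with_hessian \<Omega> U H"
    using semi_log_concaveE[OF interpolated_density_axioms p] by blast
  interpret C2_density a b \<nu> p \<Omega> U G H by (rule C2)
  have lim: "((\<lambda>t. score t y) \<longlongrightarrow> - G y) (at_left 1)" if "y \<in> interior \<Omega>" for y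
    by (rule score_tendsto_log_concave[OF C2' H that])
  have "0 \<le> t0" using t0 by (auto split: if_splits)
  then have t1: "t \<in> {0<..<1}" if "t \<noteq> 1" using t that by auto
  show "velocity_differentiable a b \<nu> t x" if "t < 1 \<or> x \<in> interior (measure_supp \<nu>)"
  proof (cases "t = 1")
    case True
    then have x: "x \<in> interior \<Omega>" using that interior_measure_supp_subset by auto
    show ?thesis unfolding True by (rule velocity_differentiable_1'[OF x lim])
  qed (rule velocity_differentiable_interior[OF t1])
  show "velocity_grad a b \<nu> t x \<preceq> mat ((k * a_adot a t + b t * b' t) / (k * (a t)\<^sup>2 + (b t)\<^sup>2))"
    if diff: "velocity_differentiable a b \<nu> t x"
  proof (cases "t = 1")
    case True
    \<comment> \<open>Differentiability at time 1 is used contrapositively: it excludes points that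
      are not interior to the support.\<close>
    then have x: "x \<in> interior \<Omega>"
      using not_velocity_differentiable_1[of x] diff interior_measure_supp_subset by auto
    then have "x \<in> \<Omega>" using interior_subset by blast
    from velocity_grad_1_ge[OF x lim H[OF this]] True show ?thesis by (simp add: a_1 b_1)
  next
    case False
    note t = t1[OF False]
    have aa: "a_adot a t = a t * a' t" using False by (simp add: a_adot_def)
    consider "0 < k * (a t)\<^sup>2 + (b t)\<^sup>2" | "k * (a t)\<^sup>2 + (b t)\<^sup>2 = 0" "a' t = 0" "b' t = 0"
      using denominator_cases[OF t t0] assms(3) by auto
    then show ?thesis
    proof cases
      case 1
      show ?thesis
      proof (rule velocity_grad_le[OF t hess_le_log_concave[OF t 1 C2' H]])
        show "b' t / b t + \<kappa> t * (- (k / (k * (a t)\<^sup>2 + (b t)\<^sup>2)))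
            \<le> (k * a_adot a t + b t * b' t) / (k * (a t)\<^sup>2 + (b t)\<^sup>2)"
          using \<kappa>_quotient[OF t, of k] 1 by (simp add: aa)
      qed
    next
      case 2
      \<comment> \<open>The bound is a division by 0, hence 0 by convention; the derivative of the
        velocity is 0 as well, so the inequality holds with equality.\<close>
      then have z: "b' t / b t = 0" "\<kappa> t = 0" by (auto simp: \<kappa>_def)
      show ?thesis
        unfolding velocity_grad_def
        by (rule jacobian_le_mat[OF velocity_has_derivative[OF t]]) (simp_all add: z 2)
    qed
  qed
qed

end

text \<open>On the form of the statement: the upper bound in (a) is guarded by boundedness because
  \<open>diameter\<close> is meaningful only for bounded sets, and an infinite diameter makes the
  bound void. In (c) the velocity at time 1 has no limit outside the support, so the bound there
  presupposes differentiability, which is asserted on the interior of the support. Part (d) concerns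
  its own measure, with \<open>c\<close> the centre of the ball.\<close>

theorem proposition20:
  fixes a b :: "real \<Rightarrow> real" and p1 :: "real^'n \<Rightarrow> real" and \<nu> :: "(real^'n) measure"
  assumes coeffs: "interpolation_coeffs a b"
    and p1_meas: "p1 \<in> borel_measurable borel"
    and p1_nonneg: "\<And>x. 0 \<le> p1 x"
    and nu: "\<nu> = density lborel (\<lambda>x. ennreal (p1 x))"
    and prob: "prob_space \<nu>"
  shows
   "let a' = time_deriv a; b' = time_deriv b; aa' = a_adot a;
        D = (1 / sqrt 2) * diameter (measure_supp \<nu>)
    in
    \<comment> \<open>(a)\<close>
    (\<forall>t\<in>{0<..<1}. \<forall>x.
       velocity_differentiable a b \<nu> t x \<and>
       mat (a' t / a t) \<preceq> velocity_grad a b \<nu> t x \<and>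
       (bounded (measure_supp \<nu>) \<longrightarrow>
         velocity_grad a b \<nu> t x
           \<preceq> mat (b t * (a t * b' t - a' t * b t) / (a t)^3 * D\<^sup>2 + a' t / a t))) \<and>
    \<comment> \<open>(b)\<close>
    (\<forall>\<beta>>0. semi_log_convex \<beta> p1 \<and> measure_supp \<nu> = UNIV \<longrightarrow>
       (\<forall>t\<in>{0<..1}. \<forall>x.
          velocity_differentiable a b \<nu> t x \<and>
          mat ((\<beta> * aa' t + b t * b' t) / (\<beta> * (a t)\<^sup>2 + (b t)\<^sup>2))
            \<preceq> velocity_grad a b \<nu> t x)) \<and>
    \<comment> \<open>(c)\<close>
    (\<forall>\<kappa> t0. semi_log_concave \<kappa> p1 \<and>
        (if \<kappa> < 0 then t0 \<in> {0<..<1} \<and> \<kappa> + (b t0)\<^sup>2 / (a t0)\<^sup>2 = 0 else t0 = 0) \<longrightarrow>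
       (\<forall>t\<in>{t0<..1}. \<forall>x.
          (t < 1 \<or> x \<in> interior (measure_supp \<nu>) \<longrightarrow> velocity_differentiable a b \<nu> t x) \<and>
          (velocity_differentiable a b \<nu> t x \<longrightarrow>
             velocity_grad a b \<nu> t x
               \<preceq> mat ((\<kappa> * aa' t + b t * b' t) / (\<kappa> * (a t)\<^sup>2 + (b t)\<^sup>2))))) \<and>
    \<comment> \<open>(d)\<close>
    (\<forall>(\<rho> :: (real^'n) measure) c R \<sigma>.
        prob_space \<rho> \<and> sets \<rho> = sets borel \<and> (AE y in \<rho>. y \<in> cball c R) \<and> 0 < \<sigma> \<longrightarrow>
       (\<forall>t\<in>{0<..<1}. \<forall>x.
          velocity_differentiable a b (gaussian \<sigma> \<star> \<rho>) t x \<and>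
          mat ((a' t * a t + \<sigma>\<^sup>2 * b' t * b t) / ((a t)\<^sup>2 + \<sigma>\<^sup>2 * (b t)\<^sup>2))
            \<preceq> velocity_grad a b (gaussian \<sigma> \<star> \<rho>) t x \<and>
          velocity_grad a b (gaussian \<sigma> \<star> \<rho>) t x
            \<preceq> mat (a t * b t * (a t * b' t - a' t * b t) / ((a t)\<^sup>2 + \<sigma>\<^sup>2 * (b t)\<^sup>2)\<^sup>2 * R\<^sup>2
                    + (a' t * a t + \<sigma>\<^sup>2 * b' t * b t) / ((a t)\<^sup>2 + \<sigma>\<^sup>2 * (b t)\<^sup>2)))) \<and>
    \<comment> \<open>(e)\<close>
    (\<forall>L f. 0 \<le> L \<and> \<nu> = density (gaussian 1) (\<lambda>x. ennreal (f x)) \<and> log_lipschitz L f \<longrightarrow>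
       (\<forall>t\<in>{0<..<1}. \<forall>x.
          let B = 5 * L * b t * ((a t)\<^sup>2 + (b t)\<^sup>2) powr (- 3 / 2)
                  * (L + (ln (sqrt ((a t)\<^sup>2 + (b t)\<^sup>2) / b t)) powr (- 1 / 2))
          in
          velocity_differentiable a b \<nu> t x \<and>
          mat ((b' t / b t * (a t)\<^sup>2 - a' t * a t)
                 * (- B - L\<^sup>2 * (b t / ((a t)\<^sup>2 + (b t)\<^sup>2))\<^sup>2)
               + (a' t * a t + b' t * b t) / ((a t)\<^sup>2 + (b t)\<^sup>2))
            \<preceq> velocity_grad a b \<nu> t x \<and>
          velocity_grad a b \<nu> t x
            \<preceq> mat ((b' t / b t * (a t)\<^sup>2 - a' t * a t) * B
                    + (a' t * a t + b' t * b t) / ((a t)\<^sup>2 + (b t)\<^sup>2))))"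
proof -
  interpret interpolated_density a b \<nu> p1
    by (intro interpolated_density.intro interpolated_measure.intro interpolation.intro
        interpolated_measure_axioms.intro interpolated_density_axioms.intro assms) (simp add: nu)
  show ?thesis
    unfolding Let_def
  proof (intro conjI ballI allI impI)
    fix t :: real and x :: "real^'n" assume t: "t \<in> {0<..<1}"
    show "velocity_differentiable a b \<nu> t x" by (rule velocity_differentiable_interior[OF t])
    show "mat (a' t / a t) \<preceq> velocity_grad a b \<nu> t x" by (rule velocity_grad_lower[OF t])
    show "velocity_grad a b \<nu> t x \<preceq> mat (b t * (a t * b' t - a' t * b t) / (a t)^3
        * ((1 / sqrt 2) * diameter (measure_supp \<nu>))\<^sup>2 + a' t / a t)" if "bounded (measure_supp \<nu>)"
      by (rule velocity_grad_upper_bounded_support[OF t that])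
  next
    fix \<beta> t :: real and x :: "real^'n"
    assume "0 < \<beta>" "semi_log_convex \<beta> p1 \<and> measure_supp \<nu> = UNIV" "t \<in> {0<..1}"
    then show "velocity_differentiable a b \<nu> t x"
      and "mat ((\<beta> * a_adot a t + b t * b' t) / (\<beta> * (a t)\<^sup>2 + (b t)\<^sup>2)) \<preceq> velocity_grad a b \<nu> t x"
      using velocity_grad_semi_log_convex by blast+
  next
    fix k t0 t :: real and x :: "real^'n"
    assume k: "semi_log_concave k p1 \<and> (if k < 0 then t0 \<in> {0<..<1} \<and> k + (b t0)\<^sup>2 / (a t0)\<^sup>2 = 0 else t0 = 0)"
      and t: "t \<in> {t0<..1}"
    note * = velocity_grad_semi_log_concave[OF conjunct1[OF k] conjunct2[OF k] t, of x]
    show "velocity_differentiable a b \<nu> t x" if "t < 1 \<or> x \<in> interior (measure_supp \<nu>)"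
      using *(1) that .
    show "velocity_grad a b \<nu> t x \<preceq> mat ((k * a_adot a t + b t * b' t) / (k * (a t)\<^sup>2 + (b t)\<^sup>2))"
      if "velocity_differentiable a b \<nu> t x"
      using *(2) that .
  next
    fix \<rho> :: "(real^'n) measure" and c x :: "real^'n" and R \<sigma> t :: real
    assume \<rho>: "prob_space \<rho> \<and> sets \<rho> = sets borel \<and> (AE y in \<rho>. y \<in> cball c R) \<and> 0 < \<sigma>"
      and t: "t \<in> {0<..<1}"
    note * = velocity_grad_gaussian_convolution[OF conjunct1[OF \<rho>] conjunct1[OF conjunct2[OF \<rho>]]
        conjunct1[OF conjunct2[OF conjunct2[OF \<rho>]]] conjunct2[OF conjunct2[OF conjunct2[OF \<rho>]]] t, of x]
    show "velocity_differentiable a b (gaussian \<sigma> \<star> \<rho>) t x" by (rule *(1))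
    show "mat ((a' t * a t + \<sigma>\<^sup>2 * b' t * b t) / ((a t)\<^sup>2 + \<sigma>\<^sup>2 * (b t)\<^sup>2))
        \<preceq> velocity_grad a b (gaussian \<sigma> \<star> \<rho>) t x" by (rule *(2))
    show "velocity_grad a b (gaussian \<sigma> \<star> \<rho>) t x
        \<preceq> mat (a t * b t * (a t * b' t - a' t * b t) / ((a t)\<^sup>2 + \<sigma>\<^sup>2 * (b t)\<^sup>2)\<^sup>2 * R\<^sup>2
            + (a' t * a t + \<sigma>\<^sup>2 * b' t * b t) / ((a t)\<^sup>2 + \<sigma>\<^sup>2 * (b t)\<^sup>2))" by (rule *(3))
  next
    fix L t :: real and f and x :: "real^'n"
    assume f: "0 \<le> L \<and> \<nu> = density (gaussian 1) (\<lambda>x. ennreal (f x)) \<and> log_lipschitz L f"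
      and t: "t \<in> {0<..<1}"
    note * = velocity_grad_log_lipschitz[OF t conjunct1[OF conjunct2[OF f]] conjunct2[OF conjunct2[OF f]]
        conjunct1[OF f], of x]
    show "velocity_differentiable a b \<nu> t x" by (rule velocity_differentiable_interior[OF t])
    show "mat ((b' t / b t * (a t)\<^sup>2 - a' t * a t)
             * (- (5 * L * b t * ((a t)\<^sup>2 + (b t)\<^sup>2) powr (- 3 / 2)
                * (L + (ln (sqrt ((a t)\<^sup>2 + (b t)\<^sup>2) / b t)) powr (- 1 / 2)))
                - L\<^sup>2 * (b t / ((a t)\<^sup>2 + (b t)\<^sup>2))\<^sup>2)
             + (a' t * a t + b' t * b t) / ((a t)\<^sup>2 + (b t)\<^sup>2)) \<preceq> velocity_grad a b \<nu> t x"
      by (rule *(1))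
    show "velocity_grad a b \<nu> t x \<preceq> mat ((b' t / b t * (a t)\<^sup>2 - a' t * a t)
             * (5 * L * b t * ((a t)\<^sup>2 + (b t)\<^sup>2) powr (- 3 / 2)
                * (L + (ln (sqrt ((a t)\<^sup>2 + (b t)\<^sup>2) / b t)) powr (- 1 / 2)))
             + (a' t * a t + b' t * b t) / ((a t)\<^sup>2 + (b t)\<^sup>2))"
      by (rule *(2))
  qed
qed

end
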